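(* Let $V$ be a finite-dimensional complex representation of $S_N$, $V^*$ its dual representation, $\langle\ ,\ \rangle$ the canonical pairing between $V$ and $V^*$, and $m$ an integer. Then for any two solutions $\psi\in\mathit{KZ}(V,m)$ and $\phi\in\mathit{KZ}(V^*,-m)$ the product $\langle\psi(z_1,\dots,z_N),\phi(z_1,\dots,z_N)\rangle$ is independent of $z_1,\dots,z_N$, and thus defines a non-degenerate canonical pairing $$\mathit{KZ}(V,m)\times\mathit{KZ}(V^*,-m)\to\mathbb C.$$
   Context: For a representation $V$ of the symmetric group $S_N$ and an integer $m$, $\mathit{KZ}(V,m)$ is the space of holomorphic functions $\psi\colon C_N\to V$ on $C_N=\mathbb C^N\smallsetminus\bigcup_{i<j}\{z_i=z_j\}$ satisfying the Knizhnik--Zamolodchikov equation $\partial_i\psi=m\sum_{j\ne i}\frac{s_{ij}+1}{z_i-z_j}\psi$, $i=1,\dots,N$, where $s_{ij}\in S_N$ is the transposition of $i$ and $j$ acting on $V$. It is known that for integer $m$ all local solutions extend to global single-valued solutions on $C_N$, so $\dim\mathit{KZ}(V,m)=\dim V$. *)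

theory Defs
  imports "HOL-Analysis.Analysis" "HOL-Library.Function_Algebras"
    "HOL-Combinatorics.Permutations"
begin

class complex_vector = ab_group_add +
  fixes scaleC :: "complex \<Rightarrow> 'a \<Rightarrow> 'a" (infixr \<open>*\<^sub>C\<close> 75)
  assumes scaleC_add_right: "a *\<^sub>C (x + y) = a *\<^sub>C x + a *\<^sub>C y"
    and scaleC_add_left: "(a + b) *\<^sub>C x = a *\<^sub>C x + b *\<^sub>C x"
    and scaleC_scaleC: "a *\<^sub>C b *\<^sub>C x = (a * b) *\<^sub>C x"
    and scaleC_one: "1 *\<^sub>C x = x"

global_interpretation complex_vector:
  vector_space "scaleC :: complex \<Rightarrow> 'a \<Rightarrow> 'a :: complex_vector"
  by unfold_locales
    (simp_all add: scaleC_add_right scaleC_add_left scaleC_scaleC scaleC_one)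

instantiation complex :: complex_vector
begin
definition scaleC_complex_def: "c *\<^sub>C (x :: complex) = c * x"
instance
  by standard (simp_all add: scaleC_complex_def algebra_simps)
end

instantiation "fun" :: (type, complex_vector) complex_vector
begin
definition scaleC_fun_def: "c *\<^sub>C f = (\<lambda>x. c *\<^sub>C f x)"
instance
  by standard (simp_all add: scaleC_fun_def fun_eq_iff scaleC_add_right scaleC_add_left
      scaleC_scaleC scaleC_one)
end

abbreviation clinear :: "('a :: complex_vector \<Rightarrow> 'b :: complex_vector) \<Rightarrow> bool"
  where "clinear \<equiv> Vector_Spaces.linear scaleC scaleC"

definition finite_dimensional :: "'v :: complex_vector itself \<Rightarrow> bool"
  where "finite_dimensional _ \<longleftrightarrow>
    (\<exists>B :: 'v set. finite B \<and> complex_vector.span B = UNIV)"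

lemma clinear_iff:
  "clinear f \<longleftrightarrow> (\<forall>x y. f (x + y) = f x + f y) \<and> (\<forall>c x. f (c *\<^sub>C x) = c *\<^sub>C f x)"
  by (auto simp: Vector_Spaces.linear_iff complex_vector.vector_space_axioms)

typedef (overloaded) 'v dual = "{l :: 'v :: complex_vector \<Rightarrow> complex. clinear l}"
  by (rule exI [of _ "\<lambda>_. 0"]) (simp add: clinear_iff scaleC_complex_def)

setup_lifting type_definition_dual

instantiation dual :: (complex_vector) complex_vector
begin

lift_definition zero_dual :: "'a dual" is "\<lambda>_. 0"
  by (simp add: clinear_iff scaleC_complex_def)

lift_definition plus_dual :: "'a dual \<Rightarrow> 'a dual \<Rightarrow> 'a dual" is "\<lambda>l k v. l v + k v"
  by (simp add: clinear_iff scaleC_complex_def algebra_simps)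

lift_definition minus_dual :: "'a dual \<Rightarrow> 'a dual \<Rightarrow> 'a dual" is "\<lambda>l k v. l v - k v"
  by (simp add: clinear_iff scaleC_complex_def algebra_simps)

lift_definition uminus_dual :: "'a dual \<Rightarrow> 'a dual" is "\<lambda>l v. - l v"
  by (simp add: clinear_iff scaleC_complex_def algebra_simps)

lift_definition scaleC_dual :: "complex \<Rightarrow> 'a dual \<Rightarrow> 'a dual" is "\<lambda>c l v. c *\<^sub>C l v"
  by (simp add: clinear_iff scaleC_complex_def algebra_simps)

instance
  by standard (transfer, simp add: fun_eq_iff scaleC_complex_def algebra_simps)+

end

definition pairing :: "'v :: complex_vector \<Rightarrow> 'v dual \<Rightarrow> complex"
  where "pairing v l = Rep_dual l v"

definition is_representation ::
    "(('n :: finite \<Rightarrow> 'n) \<Rightarrow> 'v :: complex_vector \<Rightarrow> 'v) \<Rightarrow> bool"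
  where "is_representation \<rho> \<longleftrightarrow>
    (\<forall>p. p permutes UNIV \<longrightarrow> clinear (\<rho> p)) \<and>
    \<rho> id = id \<and>
    (\<forall>p q. p permutes UNIV \<longrightarrow> q permutes UNIV \<longrightarrow> \<rho> (p \<circ> q) = \<rho> p \<circ> \<rho> q)"

definition dual_rep ::
    "(('n :: finite \<Rightarrow> 'n) \<Rightarrow> 'v :: complex_vector \<Rightarrow> 'v) \<Rightarrow> ('n \<Rightarrow> 'n) \<Rightarrow> 'v dual \<Rightarrow> 'v dual"
  where "dual_rep \<rho> p l = Abs_dual (\<lambda>v. pairing (\<rho> (inv p) v) l)"

definition config_space :: "(complex ^ 'n :: finite) set"
  where "config_space = {z. \<forall>i j. i \<noteq> j \<longrightarrow> z $ i \<noteq> z $ j}"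

(* A finite-dimensional complex vector space has a unique Hausdorff vector topology, for which
   every linear functional is continuous.  Holomorphy and partial derivatives of vector-valued
   functions are therefore those of all their coordinates, that is, of their compositions with
   linear functionals.  Both notions are meant for finite-dimensional target spaces only. *)
definition vholomorphic_on ::
    "(complex ^ 'n :: finite \<Rightarrow> 'v :: complex_vector) \<Rightarrow> (complex ^ 'n) set \<Rightarrow> bool"
  where "vholomorphic_on f S \<longleftrightarrow>
    (\<forall>l :: 'v \<Rightarrow> complex. clinear l \<longrightarrow>
      (\<forall>z\<in>S. \<exists>D. ((\<lambda>w. l (f w)) has_derivative D) (at z) \<and> Vector_Spaces.linear (*s) (*) D))"

definition has_partial_derivative ::
    "(complex ^ 'n :: finite \<Rightarrow> 'v :: complex_vector) \<Rightarrow> 'n \<Rightarrow> 'v \<Rightarrow> complex ^ 'n \<Rightarrow> bool"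
  where "has_partial_derivative f i v z \<longleftrightarrow>
    (\<forall>l :: 'v \<Rightarrow> complex. clinear l \<longrightarrow>
      ((\<lambda>t. l (f (z + axis i t))) has_field_derivative l v) (at 0))"

(* Functions on the configuration space are represented by total functions that vanish off it,
   so that equality of solutions is equality of functions. *)
definition KZ ::
    "(('n :: finite \<Rightarrow> 'n) \<Rightarrow> 'v :: complex_vector \<Rightarrow> 'v) \<Rightarrow> int \<Rightarrow> (complex ^ 'n \<Rightarrow> 'v) set"
  where "KZ \<rho> m = {\<psi>.
    (\<forall>z. z \<notin> config_space \<longrightarrow> \<psi> z = 0) \<and>
    vholomorphic_on \<psi> config_space \<and>
    (\<forall>z\<in>config_space. \<forall>i. has_partial_derivative \<psi> i
      (of_int m *\<^sub>C (\<Sum>j\<in>UNIV - {i}.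
        (1 / (z $ i - z $ j)) *\<^sub>C (\<rho> (Transposition.transpose i j) (\<psi> z) + \<psi> z))) z)}"

(* The common value of the pairing at all points of the configuration space; a meaningful
   description only when the pairing is constant there. *)
definition KZ_pairing ::
    "(complex ^ 'n :: finite \<Rightarrow> 'v :: complex_vector) \<Rightarrow> (complex ^ 'n \<Rightarrow> 'v dual) \<Rightarrow> complex"
  where "KZ_pairing \<psi> \<phi> = (THE c. \<forall>z\<in>config_space. pairing (\<psi> z) (\<phi> z) = c)"

definition nondegenerate_pairing ::
    "'a :: complex_vector set \<Rightarrow> 'b :: complex_vector set \<Rightarrow> ('a \<Rightarrow> 'b \<Rightarrow> complex) \<Rightarrow> bool"
  where "nondegenerate_pairing A B \<beta> \<longleftrightarrow>
    complex_vector.subspace A \<and> complex_vector.subspace B \<and>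
    (\<forall>x\<in>A. \<forall>x'\<in>A. \<forall>y\<in>B. \<beta> (x + x') y = \<beta> x y + \<beta> x' y) \<and>
    (\<forall>x\<in>A. \<forall>y\<in>B. \<forall>y'\<in>B. \<beta> x (y + y') = \<beta> x y + \<beta> x y') \<and>
    (\<forall>c. \<forall>x\<in>A. \<forall>y\<in>B. \<beta> (c *\<^sub>C x) y = c * \<beta> x y \<and> \<beta> x (c *\<^sub>C y) = c * \<beta> x y) \<and>
    (\<forall>x\<in>A. (\<forall>y\<in>B. \<beta> x y = 0) \<longrightarrow> x = 0) \<and>
    (\<forall>y\<in>B. (\<forall>x\<in>A. \<beta> x y = 0) \<longrightarrow> y = 0)"

end

theory Submission
  imports Defs "HOL-Computational_Algebra.Polynomial_FPS"
begin

text \<open>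
  Constancy of the pairing is the product rule: transpositions act self-adjointly with respect to
  the canonical pairing, and the two equations carry opposite signs, so all partial derivatives of
  \<open>\<langle>\<psi>, \<phi>\<rangle>\<close> vanish. A function on the configuration space with vanishing derivative is constant
  because two points span a complex line that leaves the space only at finitely many parameters
  (\<open>config_space_constant\<close>, \<open>KZ_pairing_constant\<close>).

  Nondegeneracy follows once every vector \<open>v\<close> is the value at a prescribed point \<open>z\<^sub>0\<close> of a solution on
  the whole configuration space (\<open>KZ_initial_value\<close>), applied to \<open>V\<close> and to \<open>V\<^sup>*\<close>. This is the
  statement that the KZ equation has no monodromy for integer \<open>m\<close>. The proof below avoids analytic
  continuation and fundamental groups altogether: for \<open>m > 0\<close> the solutions turn out to be
  polynomials, and they are found by linear algebra.

  It suffices to treat the group algebra of the symmetric group, that is, scalar functions \<open>F\<^sub>p(z)\<close>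
  indexed by permutations \<open>p\<close>, since \<open>\<Sum>\<^sub>p F\<^sub>p \<rho>(p) v\<close> then solves the equation in \<open>V\<close>. Multiplying
  by the sign of \<open>p\<close> and a power of the discriminant exchanges \<open>m\<close> and \<open>-m\<close>, so let \<open>m > 0\<close>.
  The radial part of the equation has a unique formal solution \<open>\<Sum>\<^sub>n t\<^sup>n P\<^sub>n(u)\<close> along the line
  \<open>z\<^sub>0 + t u\<close>, with \<open>P\<^sub>n\<close> polynomial in \<open>u\<close>. Flatness of the connection (which rests on the relation
  \<open>1/(z\<^sub>i\<^sub>jz\<^sub>j\<^sub>k) + 1/(z\<^sub>j\<^sub>kz\<^sub>k\<^sub>i) + 1/(z\<^sub>k\<^sub>iz\<^sub>i\<^sub>j) = 0\<close>) gives the remaining equations, so all that is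
  needed is that \<open>P\<^sub>n = 0\<close> for all large \<open>n\<close>; then \<open>\<Sum>\<^sub>n P\<^sub>n(z - z\<^sub>0)\<close> is a polynomial solution.

  By density it is enough to know this for a generic direction \<open>u\<close>, where the line meets the
  hyperplanes \<open>z\<^sub>i = z\<^sub>j\<close> one at a time. At a crossing the residue of the connection has the
  eigenvalues \<open>0\<close> and \<open>2m\<close>, which differ by an integer, and a logarithm could appear. It does not:
  the obstruction does not change when the direction of the line is tilted along the hyperplane, by
  flatness, and it vanishes for the direction orthogonal to the hyperplane, because it sits in the
  even degree \<open>2m\<close> while the reflection forces it to be odd (\<open>dual_solution\<close>). Hence
  the polynomial vectors that pair regularly with the dual local solutions at all crossings form a
  lattice that the connection preserves. On its members of degree at most \<open>D\<close> the connection
  lowers the degree, and the lattice contains \<open>q w\<close> for a monic polynomial \<open>q\<close> of degree \<open>D\<close> and all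
  vectors \<open>w\<close>. So \<open>f \<mapsto> \<nabla>f + q f(0)\<close> is an endomorphism of a finite-dimensional space; it is
  injective because a solution is determined by its initial value, hence surjective, and a preimage
  of \<open>q w\<close> is a polynomial solution with initial value \<open>w\<close> (\<open>radial_vanishes\<close>).
\<close>

notation fps_nth (infixl \<open>$$\<close> 90)

section \<open>The KZ operators on the group algebra and their commutation\<close>

abbreviation swap :: "'n \<Rightarrow> 'n \<Rightarrow> 'n \<Rightarrow> 'n"
  where "swap \<equiv> Transposition.transpose"

text \<open>
  An element \<open>\<Sum>\<^sub>p f\<^sub>p p\<close> of the group algebra is stored as the function \<open>f\<close>; left multiplication by
  the transposition of \<open>i\<close> and \<open>j\<close> becomes \<open>f \<mapsto> (\<lambda>p. f (swap i j \<circ> p))\<close>. The index \<open>p\<close> runs over all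
  self-maps of \<open>'n\<close>, so that it ranges over a finite type; permutations form an invariant subset.
  The sum is over ordered pairs, so a symmetric array \<open>a\<close> contributes twice for each pair.
\<close>

definition kzop :: "('n :: finite \<Rightarrow> 'n \<Rightarrow> 'r :: comm_ring_1) \<Rightarrow> (('n \<Rightarrow> 'n) \<Rightarrow> 'r) \<Rightarrow> ('n \<Rightarrow> 'n) \<Rightarrow> 'r"
  where "kzop a f p = (\<Sum>i\<in>UNIV. \<Sum>j\<in>UNIV. a i j * (f (swap i j \<circ> p) + f p))"

text \<open>
  The cyclic relation between two arrays of logarithmic derivatives of the forms \<open>z\<^sub>i - z\<^sub>j\<close> that
  makes the quadratic part of the curvature vanish.
\<close>

definition arnold :: "('n \<Rightarrow> 'n \<Rightarrow> 'r :: comm_ring_1) \<Rightarrow> ('n \<Rightarrow> 'n \<Rightarrow> 'r) \<Rightarrow> bool"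
  where "arnold a b \<longleftrightarrow> (\<forall>i j k. i \<noteq> j \<longrightarrow> j \<noteq> k \<longrightarrow> k \<noteq> i \<longrightarrow>
    a i j * (b i k - b j k) + a j k * (b j i - b k i) + a k i * (b k j - b i j) = 0)"

lemma swap_conj: "swap i j \<circ> (swap k l \<circ> p) = swap (swap i j k) (swap i j l) \<circ> (swap i j \<circ> p)"
proof -
  have "swap i j (swap k l x) = swap (swap i j k) (swap i j l) (swap i j x)" for x
    by (metis bij_is_inj bij_transpose inj_def transpose_apply_commute transpose_apply_first
        transpose_apply_second transpose_apply_other)
  then show ?thesis by (simp add: fun_eq_iff)
qed

lemma sum_swap_reindex:
  fixes g :: "'n :: finite \<Rightarrow> 'r :: comm_monoid_add"
  shows "(\<Sum>k\<in>UNIV. g (swap i j k)) = (\<Sum>k\<in>UNIV. g k)"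
  by (rule sum.reindex_bij_betw[of "swap i j" UNIV UNIV g]) simp

text \<open>
  Conjugating the transposition of \<open>k\<close> and \<open>l\<close> by that of \<open>i\<close> and \<open>j\<close> moves it only if exactly
  one index is shared, so in a commutator only pairs \<open>{i, k}\<close> and \<open>{j, k}\<close> with a third index survive.
\<close>

lemma sum_conj_diff:
  fixes b y :: "'n :: finite \<Rightarrow> 'n \<Rightarrow> 'r :: comm_ring_1"
  assumes ij: "i \<noteq> j" and b: "\<And>k l. b k l = b l k" and y: "\<And>k l. y k l = y l k"
    and b0: "\<And>k. b k k = 0"
  shows "(\<Sum>k\<in>UNIV. \<Sum>l\<in>UNIV. (b k l - b (swap i j k) (swap i j l)) * y k l) =
    2 * (\<Sum>k\<in>UNIV - {i, j}. (b i k - b j k) * y i k + (b j k - b i k) * y j k)"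
proof -
  define c where "c k l = (b k l - b (swap i j k) (swap i j l)) * y k l" for k l
  have c0: "c k l = 0" if "k \<in> UNIV - {i,j}" "l \<in> UNIV - {i,j}" for k l
    using that by (simp add: c_def)
  have cs: "c k l = c l k" for k l unfolding c_def using b y by metis
  have cij: "c i i = 0" "c j j = 0" "c i j = 0" "c j i = 0"
    unfolding c_def using b b0 by simp_all
  have split: "(\<Sum>l\<in>UNIV. g l) = g i + g j + (\<Sum>l\<in>UNIV - {i,j}. g l)" for g :: "'n \<Rightarrow> 'r"
  proof -
    have "(\<Sum>l\<in>UNIV. g l) = (\<Sum>l\<in>{i,j}. g l) + (\<Sum>l\<in>UNIV - {i,j}. g l)"
      by (metis finite sum.subset_diff subset_UNIV add.commute)
    then show ?thesis using ij by simp
  qed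
  have "(\<Sum>k\<in>UNIV. \<Sum>l\<in>UNIV. c k l) = (\<Sum>l\<in>UNIV. c i l) + (\<Sum>l\<in>UNIV. c j l)
      + (\<Sum>k\<in>UNIV - {i,j}. \<Sum>l\<in>UNIV. c k l)"
    by (rule split)
  also have "(\<Sum>l\<in>UNIV. c i l) = (\<Sum>l\<in>UNIV - {i,j}. c i l)"
    by (subst split) (simp add: cij)
  also have "(\<Sum>l\<in>UNIV. c j l) = (\<Sum>l\<in>UNIV - {i,j}. c j l)"
    by (subst split) (simp add: cij)
  also have "(\<Sum>k\<in>UNIV - {i,j}. \<Sum>l\<in>UNIV. c k l) = (\<Sum>k\<in>UNIV - {i,j}. c i k + c j k)"
    by (intro sum.cong refl, subst split) (simp add: c0 cs[of _ i] cs[of _ j])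
  finally have "(\<Sum>k\<in>UNIV. \<Sum>l\<in>UNIV. c k l) = 2 * (\<Sum>k\<in>UNIV - {i,j}. c i k + c j k)"
    by (simp add: sum.distrib)
  moreover have "c i k + c j k = (b i k - b j k) * y i k + (b j k - b i k) * y j k"
    if "k \<in> UNIV - {i,j}" for k
    using that by (simp add: c_def)
  ultimately show ?thesis by (simp add: c_def)
qed

lemma swap_cycle:
  assumes "i \<noteq> j" "j \<noteq> k" "k \<noteq> i"
  shows "swap i k \<circ> (swap i j \<circ> p) = swap j i \<circ> (swap j k \<circ> p)"
  using assms by (auto simp: fun_eq_iff Transposition.transpose_def)

lemma sum3_rotate:
  fixes g :: "'n :: finite \<Rightarrow> 'n \<Rightarrow> 'n \<Rightarrow> 'r :: comm_monoid_add"
  shows "(\<Sum>i\<in>UNIV. \<Sum>j\<in>UNIV. \<Sum>k\<in>UNIV. g j k i) = (\<Sum>i\<in>UNIV. \<Sum>j\<in>UNIV. \<Sum>k\<in>UNIV. g i j k)"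
proof -
  have "(\<Sum>i\<in>UNIV. \<Sum>j\<in>UNIV. \<Sum>k\<in>UNIV. g j k i) = (\<Sum>j\<in>UNIV. \<Sum>i\<in>UNIV. \<Sum>k\<in>UNIV. g j k i)"
    by (rule sum.swap)
  also have "\<dots> = (\<Sum>j\<in>UNIV. \<Sum>k\<in>UNIV. \<Sum>i\<in>UNIV. g j k i)"
    by (intro sum.cong refl sum.swap)
  finally show ?thesis .
qed

text \<open>
  All commutators of transpositions reduce to three-cycles. A three-cycle is a product of two
  transpositions in three ways, so its coefficient is a cyclic sum, which is the Arnold relation.
\<close>

lemma kzop_commute:
  fixes a b :: "'n :: finite \<Rightarrow> 'n \<Rightarrow> 'r :: {idom, semiring_char_0}"
  assumes a: "\<And>k l. a k l = a l k" and b: "\<And>k l. b k l = b l k"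
    and a0: "\<And>k. a k k = 0" and b0: "\<And>k. b k k = 0"
    and ar: "arnold a b"
  shows "kzop a (kzop b f) = kzop b (kzop a f)"
proof
  fix p
  let ?S = "\<lambda>g. \<Sum>i\<in>UNIV. \<Sum>j\<in>UNIV. \<Sum>k\<in>UNIV. \<Sum>l\<in>UNIV. (g i j k l :: 'r)"
  have comp: "a i j * (kzop b f (swap i j \<circ> p) + kzop b f p) =
      (\<Sum>k\<in>UNIV. \<Sum>l\<in>UNIV. a i j * b k l * (f (swap k l \<circ> (swap i j \<circ> p))
     + f (swap i j \<circ> p) + f (swap k l \<circ> p) + f p))" for a b :: "'n \<Rightarrow> 'n \<Rightarrow> 'r" and i j
    unfolding kzop_def sum.distrib[symmetric] sum_distrib_left
    by (intro sum.cong refl) (simp add: algebra_simps)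
  have 1: "kzop a (kzop b f) p = ?S (\<lambda>i j k l. a i j * b k l * (f (swap k l \<circ> (swap i j \<circ> p))
     + f (swap i j \<circ> p) + f (swap k l \<circ> p) + f p))"
    by (subst kzop_def) (simp only: comp)
  have "kzop b (kzop a f) p = (\<Sum>k\<in>UNIV. \<Sum>l\<in>UNIV. \<Sum>i\<in>UNIV. \<Sum>j\<in>UNIV. a i j * b k l *
     (f (swap i j \<circ> (swap k l \<circ> p)) + f (swap i j \<circ> p) + f (swap k l \<circ> p) + f p))"
    by (subst kzop_def) (intro sum.cong refl, subst comp, intro sum.cong refl, simp add: ac_simps)
  also have "\<dots> = (\<Sum>k\<in>UNIV. \<Sum>i\<in>UNIV. \<Sum>l\<in>UNIV. \<Sum>j\<in>UNIV. a i j * b k l *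
     (f (swap i j \<circ> (swap k l \<circ> p)) + f (swap i j \<circ> p) + f (swap k l \<circ> p) + f p))"
    by (intro sum.cong refl sum.swap)
  also have "\<dots> = (\<Sum>i\<in>UNIV. \<Sum>k\<in>UNIV. \<Sum>j\<in>UNIV. \<Sum>l\<in>UNIV. a i j * b k l *
     (f (swap i j \<circ> (swap k l \<circ> p)) + f (swap i j \<circ> p) + f (swap k l \<circ> p) + f p))"
    by (subst sum.swap) (intro sum.cong refl sum.swap)
  also have "\<dots> = ?S (\<lambda>i j k l. a i j * b k l *
     (f (swap i j \<circ> (swap k l \<circ> p)) + f (swap i j \<circ> p) + f (swap k l \<circ> p) + f p))"
    by (intro sum.cong refl sum.swap)
  finally have 2: "kzop b (kzop a f) p = ?S (\<lambda>i j k l. a i j * b k l *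
     (f (swap i j \<circ> (swap k l \<circ> p)) + f (swap i j \<circ> p) + f (swap k l \<circ> p) + f p))" .
  have 3: "kzop a (kzop b f) p - kzop b (kzop a f) p =
     (\<Sum>i\<in>UNIV. \<Sum>j\<in>UNIV. a i j * ((\<Sum>k\<in>UNIV. \<Sum>l\<in>UNIV. b k l * f (swap k l \<circ> (swap i j \<circ> p)))
        - (\<Sum>k\<in>UNIV. \<Sum>l\<in>UNIV. b k l * f (swap i j \<circ> (swap k l \<circ> p)))))"
    unfolding 1 2 sum_subtractf[symmetric] sum_distrib_left
    by (intro sum.cong refl) (simp add: algebra_simps)
  define G where "G i j k = (if i \<noteq> j \<and> j \<noteq> k \<and> k \<noteq> i
     then a i j * (b i k - b j k) * f (swap i k \<circ> (swap i j \<circ> p)) else 0)" for i j k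
  have 4: "a i j * ((\<Sum>k\<in>UNIV. \<Sum>l\<in>UNIV. b k l * f (swap k l \<circ> (swap i j \<circ> p)))
        - (\<Sum>k\<in>UNIV. \<Sum>l\<in>UNIV. b k l * f (swap i j \<circ> (swap k l \<circ> p))))
      = 2 * (\<Sum>k\<in>UNIV. G i j k + G j i k)" for i j
  proof (cases "i = j")
    case True
    then show ?thesis by (simp add: a0 G_def)
  next
    case ij: False
    let ?y = "\<lambda>k l. f (swap k l \<circ> (swap i j \<circ> p))"
    have "(\<Sum>k\<in>UNIV. \<Sum>l\<in>UNIV. b k l * f (swap i j \<circ> (swap k l \<circ> p)))
       = (\<Sum>k\<in>UNIV. \<Sum>l\<in>UNIV. b k l * ?y (swap i j k) (swap i j l))"
      by (simp only: swap_conj[of i j])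
    also have "\<dots> = (\<Sum>k\<in>UNIV. \<Sum>l\<in>UNIV. b (swap i j k) l * ?y k (swap i j l))"
      by (subst sum_swap_reindex[of _ i j, symmetric]) (simp cong: sum.cong)
    also have "\<dots> = (\<Sum>k\<in>UNIV. \<Sum>l\<in>UNIV. b (swap i j k) (swap i j l) * ?y k l)"
    proof (rule sum.cong[OF refl])
      fix k
      show "(\<Sum>l\<in>UNIV. b (swap i j k) l * ?y k (swap i j l)) =
          (\<Sum>l\<in>UNIV. b (swap i j k) (swap i j l) * ?y k l)"
        by (subst sum_swap_reindex[of _ i j, symmetric]) simp
    qed
    finally have d1: "(\<Sum>k\<in>UNIV. \<Sum>l\<in>UNIV. b k l * ?y k l)
        - (\<Sum>k\<in>UNIV. \<Sum>l\<in>UNIV. b k l * f (swap i j \<circ> (swap k l \<circ> p)))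
       = (\<Sum>k\<in>UNIV. \<Sum>l\<in>UNIV. (b k l - b (swap i j k) (swap i j l)) * ?y k l)"
      by (simp add: sum_subtractf[symmetric] left_diff_distrib)
    have d2: "(\<Sum>k\<in>UNIV. \<Sum>l\<in>UNIV. (b k l - b (swap i j k) (swap i j l)) * ?y k l)
       = 2 * (\<Sum>k\<in>UNIV - {i, j}. (b i k - b j k) * ?y i k + (b j k - b i k) * ?y j k)"
      by (rule sum_conj_diff[OF ij b _ b0]) (simp add: transpose_commute)
    have d3: "a i j * (2 * (\<Sum>k\<in>UNIV - {i, j}. (b i k - b j k) * ?y i k + (b j k - b i k) * ?y j k))
       = 2 * (\<Sum>k\<in>UNIV - {i, j}. G i j k + G j i k)"
    proof -
      have "a i j * ((b i k - b j k) * ?y i k + (b j k - b i k) * ?y j k) = G i j k + G j i k"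
        if "k \<in> UNIV - {i, j}" for k
      proof -
        have "k \<noteq> i" "k \<noteq> j" "i \<noteq> k" "j \<noteq> k" using that by auto
        then show ?thesis
          using ij unfolding G_def
          by (simp add: transpose_commute[of j i] a[of j i] distrib_left mult.assoc)
      qed
      then have "(\<Sum>k\<in>UNIV - {i, j}. a i j * ((b i k - b j k) * ?y i k + (b j k - b i k) * ?y j k))
          = (\<Sum>k\<in>UNIV - {i, j}. G i j k + G j i k)"
        by (rule sum.cong[OF refl])
      then show ?thesis
        by (simp only: mult.left_commute[of "a i j" 2] sum_distrib_left[of "a i j"])
    qed
    have d4: "(\<Sum>k\<in>UNIV - {i, j}. G i j k + G j i k) = (\<Sum>k\<in>UNIV. G i j k + G j i k)"
      by (rule sum.mono_neutral_left) (auto simp: G_def)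
    show ?thesis by (simp only: d1 d2 d3 d4)
  qed
  have 5: "kzop a (kzop b f) p - kzop b (kzop a f) p = 4 * (\<Sum>i\<in>UNIV. \<Sum>j\<in>UNIV. \<Sum>k\<in>UNIV. G i j k)"
  proof -
    have "(\<Sum>i\<in>UNIV. \<Sum>j\<in>UNIV. \<Sum>k\<in>UNIV. G j i k) = (\<Sum>i\<in>UNIV. \<Sum>j\<in>UNIV. \<Sum>k\<in>UNIV. G i j k)"
      by (rule sum.swap)
    then show ?thesis
      unfolding 3 4 by (simp add: sum.distrib sum_distrib_left[symmetric])
  qed
  have 6: "G i j k + G j k i + G k i j = 0" for i j k
  proof (cases "i \<noteq> j \<and> j \<noteq> k \<and> k \<noteq> i")
    case True
    have "swap j i \<circ> (swap j k \<circ> p) = swap i k \<circ> (swap i j \<circ> p)"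
      and "swap k j \<circ> (swap k i \<circ> p) = swap i k \<circ> (swap i j \<circ> p)"
      using swap_cycle[of i j k p] swap_cycle[of j k i p] swap_cycle[of k i j p] True by auto
    then have "G i j k + G j k i + G k i j =
        (a i j * (b i k - b j k) + a j k * (b j i - b k i) + a k i * (b k j - b i j))
          * f (swap i k \<circ> (swap i j \<circ> p))"
      using True by (simp add: G_def algebra_simps)
    then show ?thesis using ar True by (simp add: arnold_def)
  qed (auto simp: G_def)
  have "3 * (\<Sum>i\<in>UNIV. \<Sum>j\<in>UNIV. \<Sum>k\<in>UNIV. G i j k) = (\<Sum>i\<in>UNIV. \<Sum>j\<in>UNIV. \<Sum>k\<in>UNIV. G i j k)
     + (\<Sum>i\<in>UNIV. \<Sum>j\<in>UNIV. \<Sum>k\<in>UNIV. G j k i) + (\<Sum>i\<in>UNIV. \<Sum>j\<in>UNIV. \<Sum>k\<in>UNIV. G k i j)"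
    by (simp add: sum3_rotate[of G] sum3_rotate[of "\<lambda>i j k. G j k i"])
  also have "\<dots> = 0"
    by (simp add: sum.distrib[symmetric] 6)
  finally show "kzop a (kzop b f) p = kzop b (kzop a f) p"
    using 5 by simp
qed

text \<open>
  Both arrays are quotients of differences by the same differences \<open>d\<^sub>i - d\<^sub>j\<close>; stating this without
  division lets the relation be used for power series whose denominators are not invertible, in
  particular at a point where one of the differences vanishes.
\<close>

lemma arnoldI:
  fixes a b :: "'n \<Rightarrow> 'n \<Rightarrow> 'r :: idom"
  assumes a: "\<And>i j. a i j * (d i - d j) = x * (\<alpha> i - \<alpha> j)"
    and b: "\<And>i j. b i j * (d i - d j) = y * (\<beta> i - \<beta> j)"
    and d: "\<And>i j. i \<noteq> j \<Longrightarrow> d i \<noteq> d j"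
  shows "arnold a b"
  unfolding arnold_def
proof (intro allI impI)
  fix i j k :: 'n assume "i \<noteq> j" "j \<noteq> k" "k \<noteq> i"
  let ?D = "(d i - d j) * (d j - d k) * (d k - d i)"
  have D: "?D \<noteq> 0" using d \<open>i \<noteq> j\<close> \<open>j \<noteq> k\<close> \<open>k \<noteq> i\<close> by auto
  have t: "a i j * (b i k - b j k) * ((d i - d j) * (d j - d k) * (d k - d i)) =
     x * (\<alpha> i - \<alpha> j) * (- (y * (\<beta> i - \<beta> k)) * (d j - d k) - y * (\<beta> j - \<beta> k) * (d k - d i))" for i j k :: 'n
  proof -
    have "a i j * (b i k - b j k) * ((d i - d j) * (d j - d k) * (d k - d i)) =
      (a i j * (d i - d j)) * (- (b i k * (d i - d k)) * (d j - d k) - (b j k * (d j - d k)) * (d k - d i))"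
      by (simp add: algebra_simps)
    then show ?thesis by (simp only: a b)
  qed
  have gen: "(X + Y + Z) * (A * B * C) = X * (A * B * C) + Y * (B * C * A) + Z * (C * A * B)"
    for X Y Z A B C :: 'r
    by (simp add: algebra_simps)
  have "(a i j * (b i k - b j k) + a j k * (b j i - b k i) + a k i * (b k j - b i j)) * ?D =
      a i j * (b i k - b j k) * ((d i - d j) * (d j - d k) * (d k - d i))
    + a j k * (b j i - b k i) * ((d j - d k) * (d k - d i) * (d i - d j))
    + a k i * (b k j - b i j) * ((d k - d i) * (d i - d j) * (d j - d k))"
    by (rule gen)
  also have "\<dots> = 0"
    unfolding t by (simp add: left_diff_distrib right_diff_distrib distrib_left distrib_right mult_ac)
  finally have "(a i j * (b i k - b j k) + a j k * (b j i - b k i) + a k i * (b k j - b i j)) * ?D = 0" .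
  then show "a i j * (b i k - b j k) + a j k * (b j i - b k i) + a k i * (b k j - b i j) = 0"
    using no_zero_divisors[OF _ D] by blast
qed

lemma kzop_diff: "kzop a (\<lambda>q. f q - g q) p = kzop a f p - kzop a g p"
  unfolding kzop_def by (simp add: sum_subtractf[symmetric] algebra_simps)

lemma kzop_scale: "kzop a (\<lambda>q. c * f q) p = c * kzop a f p"
  unfolding kzop_def by (simp add: sum_distrib_left algebra_simps)

lemma additive_sum:
  fixes D :: "'r :: ab_group_add \<Rightarrow> 's :: ab_group_add"
  assumes "\<And>x y. D (x + y) = D x + D y"
  shows "D (\<Sum>i\<in>S. g i) = (\<Sum>i\<in>S. D (g i))"
proof -
  have "D 0 = 0" using assms[of 0 0] by simp
  then show ?thesis by (induction S rule: infinite_finite_induct) (auto simp: assms)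
qed

lemma kzop_derivation:
  assumes add: "\<And>x y. D (x + y) = D x + D y" and leib: "\<And>x y. D (x * y) = D x * y + x * D y"
  shows "D (kzop a f p) = kzop (\<lambda>i j. D (a i j)) f p + kzop a (\<lambda>q. D (f q)) p"
  unfolding kzop_def
  by (simp add: additive_sum[of D, OF add] leib add sum.distrib)

text \<open>
  Flatness for two commuting derivations \<open>E\<close> and \<open>D\<close>: the operators \<open>E - c - A\<close> and \<open>D - B\<close> commute.
  Applied to an arbitrary \<open>f\<close>, this transports the defect of one equation along the other one.
\<close>

lemma flat_identity:
  fixes a b :: "'n :: finite \<Rightarrow> 'n \<Rightarrow> 'r :: comm_ring_1"
  assumes E_add: "\<And>x y. E (x + y) = E x + E y" and E_leib: "\<And>x y. E (x * y) = E x * y + x * E y"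
    and D_add: "\<And>x y. D (x + y) = D x + D y" and D_leib: "\<And>x y. D (x * y) = D x * y + x * D y"
    and ED: "\<And>x. E (D x) = D (E x)" and Dc: "D c = 0"
    and closed: "\<And>i j. E (b i j) = D (a i j)"
    and comm: "kzop a (kzop b f) = kzop b (kzop a f)"
  shows "D (E (f p) - c * f p - kzop a f p)
           - kzop b (\<lambda>q. E (f q) - c * f q - kzop a f q) p
       = E (D (f p) - kzop b f p) - c * (D (f p) - kzop b f p)
           - kzop a (\<lambda>q. D (f q) - kzop b f q) p"
proof -
  have dD: "D (x - y) = D x - D y" for x y
    using D_add[of "x - y" y] by (simp add: algebra_simps)
  have dE: "E (x - y) = E x - E y" for x y
    using E_add[of "x - y" y] by (simp add: algebra_simps)
  have "D (E (f p) - c * f p - kzop a f p) - kzop b (\<lambda>q. E (f q) - c * f q - kzop a f q) p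
      = D (E (f p)) - c * D (f p) - kzop (\<lambda>i j. D (a i j)) f p - kzop a (\<lambda>q. D (f q)) p
        - kzop b (\<lambda>q. E (f q)) p + c * kzop b f p + kzop b (kzop a f) p"
    by (simp only: dD D_leib Dc kzop_diff kzop_scale kzop_derivation[of D, OF D_add D_leib]) simp
  moreover have "E (D (f p) - kzop b f p) - c * (D (f p) - kzop b f p)
           - kzop a (\<lambda>q. D (f q) - kzop b f q) p
      = E (D (f p)) - kzop (\<lambda>i j. E (b i j)) f p - kzop b (\<lambda>q. E (f q)) p
        - c * D (f p) + c * kzop b f p - kzop a (\<lambda>q. D (f q)) p + kzop a (kzop b f) p"
    by (simp only: dE kzop_diff kzop_derivation[of E, OF E_add E_leib]) (simp add: algebra_simps)
  ultimately show ?thesis by (simp add: ED closed comm)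
qed

section \<open>A formal pencil of lines and its flat connection\<close>

text \<open>
  Put \<open>z = z\<^sub>i - z\<^sub>j\<close> and \<open>x = u\<^sub>i - u\<^sub>j\<close>, and let \<open>w\<close> be the inverse of \<open>z\<close> (or \<open>0\<close> if \<open>z = 0\<close>). These are
  the Taylor coefficients in \<open>X\<close> of \<open>\<mu> X x / (z + X x)\<close>. If \<open>z = 0\<close> the quotient is the constant \<open>\<mu>\<close>, which
  enters through the separate constant term \<open>e\<close>.
\<close>

definition line_coeff :: "'r :: comm_ring_1 \<Rightarrow> 'r \<Rightarrow> 'r \<Rightarrow> 'r \<Rightarrow> nat \<Rightarrow> 'r"
  where "line_coeff \<mu> w e x n = (if n = 0 then e else - \<mu> * (- (w * x)) ^ n)"

text \<open>
  Taylor coefficients in \<open>X\<close> of \<open>\<mu> X y / (z + X x)\<close>, the coefficient of the connection in the direction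
  in which the line is tilted; \<open>y\<close> is the derivative of \<open>x\<close>.
\<close>

definition tilt_coeff :: "'r :: comm_ring_1 \<Rightarrow> 'r \<Rightarrow> 'r \<Rightarrow> 'r \<Rightarrow> nat \<Rightarrow> 'r"
  where "tilt_coeff \<mu> w x y n = (if n = 0 then 0 else \<mu> * w * y * (- (w * x)) ^ (n - 1))"

lemma linear_fps_mult_nth:
  fixes F :: "'r :: comm_ring_1 fps"
  shows "((fps_const z + fps_const x * fps_X) * F) $$ n = z * F $$ n + (if n = 0 then 0 else x * F $$ (n - 1))"
  by (simp add: distrib_right mult.assoc fps_X_mult_nth)

lemma line_coeff_eq:
  fixes z w e x \<mu> :: "'r :: idom"
  assumes "z * w = 1 \<and> e = 0 \<or> z = 0 \<and> w = 0 \<and> (e = \<mu> \<or> x = 0)"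
  shows "(fps_const z + fps_const x * fps_X) * Abs_fps (line_coeff \<mu> w e x) = fps_const \<mu> * fps_X * fps_const x"
proof (rule fps_ext)
  fix n
  have R: "(fps_const \<mu> * fps_X * fps_const x) $$ n = (if n = 1 then \<mu> * x else 0)"
    by (simp add: mult.assoc fps_X_mult_nth mult.commute[of fps_X])
  have zw: "z * (w * y) = (if z * w = 1 then y else 0)" for y
    using assms by (auto simp: mult.assoc[symmetric])
  consider "n = 0" | "n = 1" | k where "n = Suc (Suc k)" by (metis One_nat_def not0_implies_Suc)
  then show "((fps_const z + fps_const x * fps_X) * Abs_fps (line_coeff \<mu> w e x)) $$ n =
    (fps_const \<mu> * fps_X * fps_const x) $$ n"
    unfolding linear_fps_mult_nth R
  proof cases
    case 3
    then show "z * Abs_fps (line_coeff \<mu> w e x) $$ n + (if n = 0 then 0 else x * Abs_fps (line_coeff \<mu> w e x) $$ (n - 1)) =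
         (if n = 1 then \<mu> * x else 0)"
      using assms by (auto simp: line_coeff_def algebra_simps zw)
  qed (use assms in \<open>auto simp: line_coeff_def algebra_simps zw\<close>)
qed

lemma tilt_coeff_eq:
  fixes z w x y \<mu> :: "'r :: idom"
  assumes "z * w = 1 \<or> z = 0 \<and> w = 0 \<and> y = 0"
  shows "(fps_const z + fps_const x * fps_X) * Abs_fps (tilt_coeff \<mu> w x y) = fps_const \<mu> * fps_X * fps_const y"
proof (rule fps_ext)
  fix n
  have R: "(fps_const \<mu> * fps_X * fps_const y) $$ n = (if n = 1 then \<mu> * y else 0)"
    by (simp add: mult.assoc fps_X_mult_nth mult.commute[of fps_X])
  have zw: "z * (w * y) = (if z * w = 1 then y else 0)" for y
    using assms by (auto simp: mult.assoc[symmetric])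
  consider "n = 0" | "n = 1" | k where "n = Suc (Suc k)" by (metis One_nat_def not0_implies_Suc)
  then show "((fps_const z + fps_const x * fps_X) * Abs_fps (tilt_coeff \<mu> w x y)) $$ n =
    (fps_const \<mu> * fps_X * fps_const y) $$ n"
    unfolding linear_fps_mult_nth R
    by cases (use assms in \<open>auto simp: tilt_coeff_def algebra_simps zw\<close>)
qed

text \<open>
  The pencil of lines through \<open>z\<close> with directions \<open>u + \<theta> v\<close> is treated formally: series in the line
  parameter \<open>X\<close> whose coefficients are polynomials in \<open>\<theta>\<close>.
\<close>

definition theta_deriv :: "complex poly fps \<Rightarrow> complex poly fps"
  where "theta_deriv f = Abs_fps (\<lambda>n. pderiv (f $$ n))"

text \<open>
  The derivation \<open>X d/dX\<close>; it keeps a simple pole of the connection at \<open>X = 0\<close> inside the power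
  series.
\<close>

definition euler :: "'r :: comm_ring_1 fps \<Rightarrow> 'r fps"
  where "euler f = fps_X * fps_deriv f"

lemma euler_nth [simp]: "euler f $$ n = of_nat n * f $$ n"
  by (cases n) (auto simp: euler_def fps_X_mult_nth)

lemma theta_deriv_nth [simp]: "theta_deriv f $$ n = pderiv (f $$ n)"
  by (simp add: theta_deriv_def)

lemma euler_add: "euler (x + y) = euler x + euler y"
  by (simp add: euler_def algebra_simps)

lemma euler_mult: "euler (x * y) = euler x * y + x * euler y"
  by (simp add: euler_def algebra_simps)

lemma theta_deriv_add: "theta_deriv (x + y) = theta_deriv x + theta_deriv y"
  by (rule fps_ext) (simp add: pderiv_add)

lemma theta_deriv_mult: "theta_deriv (x * y) = theta_deriv x * y + x * theta_deriv y"
  by (rule fps_ext)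
    (simp add: fps_mult_nth additive_sum[of pderiv, OF pderiv_add] pderiv_mult,
     simp add: sum.distrib[symmetric] ac_simps)

lemma euler_theta_deriv: "euler (theta_deriv x) = theta_deriv (euler x)"
  by (rule fps_ext) (simp add: pderiv_mult)

definition pencil_array :: "complex \<Rightarrow> ('n \<Rightarrow> complex) \<Rightarrow> ('n \<Rightarrow> complex) \<Rightarrow> ('n \<Rightarrow> complex) \<Rightarrow> 'n \<Rightarrow> 'n \<Rightarrow> complex poly fps"
  where "pencil_array \<mu> z u v i j = Abs_fps (line_coeff [:\<mu>:] [:1 / (z i - z j):]
    (if i \<noteq> j \<and> z i = z j then [:\<mu>:] else 0) [:u i - u j, v i - v j:])"

definition tilt_array :: "complex \<Rightarrow> ('n \<Rightarrow> complex) \<Rightarrow> ('n \<Rightarrow> complex) \<Rightarrow> ('n \<Rightarrow> complex) \<Rightarrow> 'n \<Rightarrow> 'n \<Rightarrow> complex poly fps"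
  where "tilt_array \<mu> z u v i j = Abs_fps (tilt_coeff [:\<mu>:] [:1 / (z i - z j):]
    [:u i - u j, v i - v j:] [:v i - v j:])"

definition line_array :: "complex \<Rightarrow> ('n \<Rightarrow> complex) \<Rightarrow> ('n \<Rightarrow> complex) \<Rightarrow> 'n \<Rightarrow> 'n \<Rightarrow> complex fps"
  where "line_array \<mu> z u i j = Abs_fps (line_coeff \<mu> (1 / (z i - z j))
    (if i \<noteq> j \<and> z i = z j then \<mu> else 0) (u i - u j))"

lemma pencil_array_eval: "poly (pencil_array \<mu> z u v i j $$ n) \<theta> = line_array \<mu> z (\<lambda>k. u k + \<theta> * v k) i j $$ n"
proof -
  have "(u i + \<theta> * v i) - (u j + \<theta> * v j) = (u i - u j) + \<theta> * (v i - v j)"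
    by (simp add: algebra_simps)
  then show ?thesis
    by (simp only: pencil_array_def line_array_def line_coeff_def fps_nth_Abs_fps) (simp add: poly_power add_divide_distrib)
qed

lemma line_array_eq:
  "(fps_const (z i - z j) + fps_const (u i - u j) * fps_X) * line_array \<mu> z u i j
     = fps_const \<mu> * fps_X * fps_const (u i - u j)"
  unfolding line_array_def by (rule line_coeff_eq) auto

lemma pencil_array_eq:
  "(fps_const [:z i - z j:] + fps_const [:u i - u j, v i - v j:] * fps_X) * pencil_array \<mu> z u v i j
     = fps_const [:\<mu>:] * fps_X * fps_const [:u i - u j, v i - v j:]"
  unfolding pencil_array_def by (rule line_coeff_eq) (auto simp: one_pCons)

lemma tilt_array_eq:
  assumes "z i = z j \<Longrightarrow> v i = v j"
  shows "(fps_const [:z i - z j:] + fps_const [:u i - u j, v i - v j:] * fps_X) * tilt_array \<mu> z u v i j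
     = fps_const [:\<mu>:] * fps_X * fps_const [:v i - v j:]"
  unfolding tilt_array_def using assms by (intro tilt_coeff_eq) (auto simp: one_pCons)

lemma line_coeff_sym: "line_coeff \<mu> (- w) e (- x) = line_coeff \<mu> w e x"
  by (rule ext) (simp add: line_coeff_def)

lemma tilt_coeff_sym: "tilt_coeff \<mu> (- w) (- x) (- y) = tilt_coeff \<mu> w x y"
  by (rule ext) (simp add: tilt_coeff_def)

lemma pencil_array_sym: "pencil_array \<mu> z u v i j = pencil_array \<mu> z u v j i"
proof -
  have "[:1 / (z i - z j):] = - [:1 / (z j - z i):]"
    by (simp add: minus_divide_right)
  moreover have "[:u i - u j, v i - v j:] = - [:u j - u i, v j - v i:]" by simp
  ultimately show ?thesis
    by (simp only: pencil_array_def line_coeff_sym eq_commute[of i j] eq_commute[of "z i"])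
qed

lemma tilt_array_sym: "tilt_array \<mu> z u v i j = tilt_array \<mu> z u v j i"
proof -
  have "[:1 / (z i - z j):] = - [:1 / (z j - z i):]"
    by (simp add: minus_divide_right)
  moreover have "[:u i - u j, v i - v j:] = - [:u j - u i, v j - v i:]" 
    and "[:v i - v j:] = - [:v j - v i:]" by simp_all
  ultimately show ?thesis
    by (simp only: tilt_array_def tilt_coeff_sym)
qed

lemma pencil_array_diag: "pencil_array \<mu> z u v i i = 0"
  by (rule fps_ext) (simp add: pencil_array_def line_coeff_def power_0_left)

lemma tilt_array_diag: "tilt_array \<mu> z u v i i = 0"
  by (rule fps_ext) (simp add: tilt_array_def tilt_coeff_def)

lemma tilt_array_pencil_array: "euler (tilt_array \<mu> z u v i j) = theta_deriv (pencil_array \<mu> z u v i j)"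
proof (rule fps_ext)
  fix n
  show "euler (tilt_array \<mu> z u v i j) $$ n = theta_deriv (pencil_array \<mu> z u v i j) $$ n"
  proof (cases n)
    case 0
    then show ?thesis by (simp add: tilt_array_def pencil_array_def tilt_coeff_def line_coeff_def pderiv_pCons)
  next
    case (Suc k)
    then show ?thesis
      by (simp add: tilt_array_def pencil_array_def tilt_coeff_def line_coeff_def pderiv_pCons pderiv_mult pderiv_smult pderiv_minus
            pderiv_power_Suc smult_add_left of_nat_poly algebra_simps del: of_nat_Suc power_Suc)
  qed
qed

text \<open>
  The hypothesis on \<open>z\<close> and \<open>v\<close> says that a hyperplane through the base point contains the tilting
  direction, so that the coefficient of \<open>d\<theta>\<close> has no pole there.
\<close>

lemma formal_flatness:
  fixes f :: "('n :: finite \<Rightarrow> 'n) \<Rightarrow> complex poly fps" and c \<mu> :: complex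
  assumes zu: "\<And>i j. i \<noteq> j \<Longrightarrow> z i \<noteq> z j \<or> u i \<noteq> u j"
    and zv: "\<And>i j. z i = z j \<Longrightarrow> v i = v j"
  defines "h \<equiv> \<lambda>q. euler (f q) - fps_const [:c:] * f q - kzop (pencil_array \<mu> z u v) f q"
    and "g \<equiv> \<lambda>q. theta_deriv (f q) - kzop (tilt_array \<mu> z u v) f q"
  shows "theta_deriv (h p) - kzop (tilt_array \<mu> z u v) h p
       = euler (g p) - fps_const [:c:] * g p - kzop (pencil_array \<mu> z u v) g p"
proof -
  define d where "d i = fps_const [:z i:] + fps_const [:u i, v i:] * fps_X" for i
  have d: "d i - d j = fps_const [:z i - z j:] + fps_const [:u i - u j, v i - v j:] * fps_X" for i j
    by (rule fps_ext) (simp add: d_def fps_X_nth)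
  have c1: "fps_const [:u i - u j, v i - v j:] = fps_const [:u i, v i:] - fps_const [:u j, v j:]"
    and c2: "fps_const [:v i - v j:] = fps_const [:v i:] - fps_const [:v j:]" for i j
    by simp_all
  have "arnold (pencil_array \<mu> z u v) (tilt_array \<mu> z u v)"
  proof (rule arnoldI)
    show "pencil_array \<mu> z u v i j * (d i - d j) = fps_const [:\<mu>:] * fps_X * (fps_const [:u i, v i:] - fps_const [:u j, v j:])" for i j
      using pencil_array_eq[of z i j u v \<mu>] unfolding d c1[symmetric] by (subst mult.commute)
    show "tilt_array \<mu> z u v i j * (d i - d j) = fps_const [:\<mu>:] * fps_X * (fps_const [:v i:] - fps_const [:v j:])" for i j
      using tilt_array_eq[of z i j v u \<mu>] zv unfolding d c2[symmetric] by (subst mult.commute) blast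
    show "d i \<noteq> d j" if "i \<noteq> j" for i j
    proof
      assume "d i = d j"
      then have "(d i - d j) $$ n = 0" for n by simp
      from this[of 0] this[of 1] show False
        using zu[OF that] by (simp add: d)
    qed
  qed
  then have "kzop (pencil_array \<mu> z u v) (kzop (tilt_array \<mu> z u v) f) = kzop (tilt_array \<mu> z u v) (kzop (pencil_array \<mu> z u v) f)"
    by (rule kzop_commute[OF pencil_array_sym tilt_array_sym pencil_array_diag tilt_array_diag])
  then show ?thesis
    unfolding h_def g_def
    by (intro flat_identity euler_add euler_mult theta_deriv_add theta_deriv_mult euler_theta_deriv tilt_array_pencil_array)
      (auto intro!: fps_ext simp: pderiv_pCons)
qed

lemma fps_mult_nth_rev: "(a * b :: 'r :: comm_ring_1 fps) $$ n = (\<Sum>k\<le>n. a $$ (n - k) * b $$ k)"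
  by (subst mult.commute) (subst fps_mult_nth, simp add: atLeast0AtMost mult.commute)

lemma kzop_nth:
  "kzop A f p $$ n = (\<Sum>k\<le>n. kzop (\<lambda>i j. A i j $$ (n - k)) (\<lambda>q. f q $$ k) p)"
proof -
  have "kzop A f p $$ n = (\<Sum>i\<in>UNIV. \<Sum>j\<in>UNIV. \<Sum>k\<le>n. A i j $$ (n - k) * (f (swap i j \<circ> p) $$ k + f p $$ k))"
    unfolding kzop_def
    by (simp add: fps_sum_nth fps_mult_nth_rev)
  also have "\<dots> = (\<Sum>i\<in>UNIV. \<Sum>k\<le>n. \<Sum>j\<in>UNIV. A i j $$ (n - k) * (f (swap i j \<circ> p) $$ k + f p $$ k))"
    by (intro sum.cong refl sum.swap)
  also have "\<dots> = (\<Sum>k\<le>n. \<Sum>i\<in>UNIV. \<Sum>j\<in>UNIV. A i j $$ (n - k) * (f (swap i j \<circ> p) $$ k + f p $$ k))"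
    by (rule sum.swap)
  finally show ?thesis by (simp add: kzop_def)
qed

lemma kzop_zero [simp]: "kzop a (\<lambda>q. 0) p = 0"
  by (simp add: kzop_def)

lemma kzop_zero_array [simp]: "kzop (\<lambda>i j. 0) f p = 0"
  by (simp add: kzop_def)

lemma poly_kzop: "poly (kzop a f p) \<theta> = kzop (\<lambda>i j. poly (a i j) \<theta>) (\<lambda>q. poly (f q) \<theta>) p"
  by (simp add: kzop_def poly_sum)

section \<open>Formal solutions along a line and at a crossing\<close>

text \<open>
  Both recursions that occur below have this shape: the unknown of order \<open>n\<close> is obtained from the
  lower ones by an operator in the algebra generated by one reflection \<open>s\<close>, with the coefficients
  \<open>r n\<close> and \<open>r' n\<close>.
\<close>

fun two_term_series :: "('n :: finite \<Rightarrow> 'n) \<Rightarrow> (nat \<Rightarrow> 'r) \<Rightarrow> (nat \<Rightarrow> 'r) \<Rightarrow> (nat \<Rightarrow> 'n \<Rightarrow> 'n \<Rightarrow> 'r)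
    \<Rightarrow> (('n \<Rightarrow> 'n) \<Rightarrow> 'r :: comm_ring_1) \<Rightarrow> nat \<Rightarrow> ('n \<Rightarrow> 'n) \<Rightarrow> 'r"
  where "two_term_series s r r' a f0 n = (if n = 0 then f0 else (\<lambda>p.
     r n * (\<Sum>k<n. kzop (a (n - k)) (two_term_series s r r' a f0 k) p)
   + r' n * (\<Sum>k<n. kzop (a (n - k)) (two_term_series s r r' a f0 k) (s \<circ> p))))"

declare two_term_series.simps [simp del]

lemma two_term_series_0 [simp]: "two_term_series s r r' a f0 0 = f0"
  by (simp add: two_term_series.simps)

lemma poly_two_term_series:
  "poly (two_term_series s r r' a f0 n p) \<theta> = two_term_series s (\<lambda>n. poly (r n) \<theta>) (\<lambda>n. poly (r' n) \<theta>)
     (\<lambda>n i j. poly (a n i j) \<theta>) (\<lambda>p. poly (f0 p) \<theta>) n p"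
proof (induction n arbitrary: p rule: less_induct)
  case (less n)
  show ?case
    by (subst (1 2) two_term_series.simps) (simp add: poly_sum poly_kzop less.IH)
qed

text \<open>
  The homogeneous components \<open>P\<^sub>n(u)\<close> of the formal solution based at \<open>z\<close> with value \<open>w\<close> there.
\<close>

definition radial :: "complex \<Rightarrow> ('n :: finite \<Rightarrow> complex) \<Rightarrow> ('n \<Rightarrow> complex) \<Rightarrow> (('n \<Rightarrow> 'n) \<Rightarrow> complex)
     \<Rightarrow> nat \<Rightarrow> ('n \<Rightarrow> 'n) \<Rightarrow> complex"
  where "radial \<mu> z u w = two_term_series id (\<lambda>n. 1 / of_nat n) (\<lambda>_. 0) (\<lambda>n i j. line_array \<mu> z u i j $$ n) w"

text \<open>
  The component \<open>P\<^sub>n(u + \<theta> v)\<close> as a polynomial in \<open>\<theta>\<close>.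
\<close>

definition pencil_radial :: "complex \<Rightarrow> ('n :: finite \<Rightarrow> complex) \<Rightarrow> ('n \<Rightarrow> complex) \<Rightarrow> ('n \<Rightarrow> complex)
     \<Rightarrow> (('n \<Rightarrow> 'n) \<Rightarrow> complex) \<Rightarrow> nat \<Rightarrow> ('n \<Rightarrow> 'n) \<Rightarrow> complex poly"
  where "pencil_radial \<mu> z u v w = two_term_series id (\<lambda>n. [:1 / of_nat n:]) (\<lambda>_. 0)
    (\<lambda>n i j. pencil_array \<mu> z u v i j $$ n) (\<lambda>p. [:w p:])"

lemma pencil_radial_eval: "poly (pencil_radial \<mu> z u v w n p) \<theta> = radial \<mu> z (\<lambda>k. u k + \<theta> * v k) w n p"
  by (simp add: pencil_radial_def radial_def poly_two_term_series pencil_array_eval)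

lemma sum_atMost_split: "(\<Sum>k\<le>n. f k) = (\<Sum>k<n. f k) + (f n :: 'r :: comm_monoid_add)" for n :: nat
  by (simp add: lessThan_Suc_atMost[symmetric])

lemma radial_unique:
  assumes z: "\<And>i j. i \<noteq> j \<Longrightarrow> z i \<noteq> z j"
    and F: "\<And>p. euler (F p) = kzop (line_array \<mu> z u) F p"
    and F0: "\<And>p. F p $$ 0 = w p"
  shows "F p $$ n = radial \<mu> z u w n p"
proof (induction n arbitrary: p rule: less_induct)
  case (less n)
  show ?case
  proof (cases "n = 0")
    case True
    then show ?thesis by (simp add: radial_def F0)
  next
    case False
    have "of_nat n * F p $$ n = (\<Sum>k\<le>n. kzop (\<lambda>i j. line_array \<mu> z u i j $$ (n - k)) (\<lambda>q. F q $$ k) p)"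
      using arg_cong[OF F[of p], of "\<lambda>f. f $$ n"] by (simp add: kzop_nth)
    also have "\<dots> = (\<Sum>k<n. kzop (\<lambda>i j. line_array \<mu> z u i j $$ (n - k)) (\<lambda>q. F q $$ k) p)
        + kzop (\<lambda>i j. line_array \<mu> z u i j $$ 0) (\<lambda>q. F q $$ n) p"
      by (simp add: sum_atMost_split)
    also have "(\<lambda>i j. line_array \<mu> z u i j $$ 0) = (\<lambda>i j. 0)"
      using z by (auto simp: fun_eq_iff line_array_def line_coeff_def)
    also have "(\<Sum>k<n. kzop (\<lambda>i j. line_array \<mu> z u i j $$ (n - k)) (\<lambda>q. F q $$ k) p)
      = (\<Sum>k<n. kzop (\<lambda>i j. line_array \<mu> z u i j $$ (n - k)) (radial \<mu> z u w k) p)"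
      by (intro sum.cong refl) (simp add: less.IH)
    finally have *: "of_nat n * F p $$ n =
        (\<Sum>k<n. kzop (\<lambda>i j. line_array \<mu> z u i j $$ (n - k)) (radial \<mu> z u w k) p)"
      by simp
    have "radial \<mu> z u w n p = 1 / of_nat n * (of_nat n * F p $$ n)"
      unfolding * using False by (subst (1) radial_def, subst two_term_series.simps) (simp add: radial_def)
    then show ?thesis using False by simp
  qed
qed

text \<open>
  The radial equation alone determines the series, and flatness then yields the equation in every
  other direction: the defect \<open>g\<close> satisfies the radial equation with initial value \<open>0\<close>.
\<close>

lemma pencil_radial_deriv:
  assumes z: "\<And>i j. i \<noteq> j \<Longrightarrow> z i \<noteq> z j"
  shows "pderiv (pencil_radial \<mu> z u v w n p) =
     (\<Sum>k\<le>n. kzop (\<lambda>i j. tilt_array \<mu> z u v i j $$ (n - k)) (pencil_radial \<mu> z u v w k) p)"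
proof -
  define f where "f p = Abs_fps (\<lambda>n. pencil_radial \<mu> z u v w n p)" for p
  define h where "h = (\<lambda>q. euler (f q) - fps_const [:0:] * f q - kzop (pencil_array \<mu> z u v) f q)"
  define g where "g = (\<lambda>q. theta_deriv (f q) - kzop (tilt_array \<mu> z u v) f q)"
  have A0: "(\<lambda>i j. pencil_array \<mu> z u v i j $$ 0) = (\<lambda>i j. 0)"
    using z by (auto simp: fun_eq_iff pencil_array_def line_coeff_def)
  have B0: "(\<lambda>i j. tilt_array \<mu> z u v i j $$ 0) = (\<lambda>i j. 0)"
    by (auto simp: fun_eq_iff tilt_array_def tilt_coeff_def)
  have "h q $$ n = 0" for q n
  proof (cases "n = 0")
    case True
    then show ?thesis by (simp add: h_def kzop_nth A0)
  next
    case False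
    have "of_nat n * f q $$ n = (\<Sum>k<n. kzop (\<lambda>i j. pencil_array \<mu> z u v i j $$ (n - k)) (\<lambda>q. f q $$ k) q)"
      unfolding f_def fps_nth_Abs_fps
      using False by (subst pencil_radial_def, subst two_term_series.simps) (simp add: pencil_radial_def of_nat_poly)
    then show ?thesis
      by (simp add: h_def kzop_nth sum_atMost_split A0)
  qed
  then have h0: "h = (\<lambda>q. 0)" by (auto intro!: fps_ext)
  have fl: "theta_deriv (h q) - kzop (tilt_array \<mu> z u v) h q
     = euler (g q) - fps_const [:0:] * g q - kzop (pencil_array \<mu> z u v) g q" for q
    unfolding h_def g_def by (rule formal_flatness) (use z in metis)+
  have "g q $$ n = 0" for q n
  proof (induction n arbitrary: q rule: less_induct)
    case (less n)
    show ?case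
    proof (cases "n = 0")
      case True
      then show ?thesis by (simp add: g_def kzop_nth B0 f_def pencil_radial_def pderiv_pCons)
    next
      case False
      have "of_nat n * g q $$ n = kzop (pencil_array \<mu> z u v) g q $$ n"
        using arg_cong[OF fl[of q], of "\<lambda>f. f $$ n"] by (simp add: h0 theta_deriv_def)
      also have "\<dots> = 0"
        by (simp add: kzop_nth sum_atMost_split A0 less.IH)
      finally show ?thesis using False by (simp add: of_nat_poly)
    qed
  qed
  then have "g p $$ n = 0" .
  then show ?thesis by (simp add: g_def kzop_nth f_def)
qed

lemma kzop_swap_equivariant:
  "kzop a w (swap i0 j0 \<circ> p) = kzop (\<lambda>i j. a (swap i0 j0 i) (swap i0 j0 j)) (\<lambda>q. w (swap i0 j0 \<circ> q)) p"
proof -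
  let ?s = "swap i0 j0"
  have "kzop (\<lambda>i j. a (?s i) (?s j)) (\<lambda>q. w (?s \<circ> q)) p =
     (\<Sum>i\<in>UNIV. \<Sum>j\<in>UNIV. a (?s i) (?s j) * (w (swap (?s i) (?s j) \<circ> (?s \<circ> p)) + w (?s \<circ> p)))"
    unfolding kzop_def by (simp only: swap_conj[of i0 j0])
  also have "\<dots> = (\<Sum>i\<in>UNIV. \<Sum>j\<in>UNIV. a (?s i) j * (w (swap (?s i) j \<circ> (?s \<circ> p)) + w (?s \<circ> p)))"
    by (intro sum.cong refl sum_swap_reindex[of "\<lambda>j. a _ j * (w (swap _ j \<circ> (?s \<circ> p)) + w (?s \<circ> p))"])
  also have "\<dots> = kzop a w (?s \<circ> p)"
    unfolding kzop_def by (rule sum_swap_reindex[of "\<lambda>i. \<Sum>j\<in>UNIV. a i j * (w (swap i j \<circ> (?s \<circ> p)) + w (?s \<circ> p))"])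
  finally show ?thesis by simp
qed

lemma kzop_single_pair:
  assumes "i0 \<noteq> j0"
    and "\<And>i j. a i j = (if i = i0 \<and> j = j0 \<or> i = j0 \<and> j = i0 then c else 0)"
  shows "kzop a w p = 2 * c * (w (swap i0 j0 \<circ> p) + w p)"
proof -
  have "kzop a w p = (\<Sum>i\<in>UNIV. \<Sum>j\<in>UNIV. (if i = i0 \<and> j = j0 then c * (w (swap i0 j0 \<circ> p) + w p) else 0)
     + (if i = j0 \<and> j = i0 then c * (w (swap i0 j0 \<circ> p) + w p) else 0))"
    unfolding kzop_def using assms
    by (intro sum.cong refl) (auto simp: transpose_commute)
  also have "\<dots> = (\<Sum>i\<in>UNIV. if i = i0 then c * (w (swap i0 j0 \<circ> p) + w p) else 0) +
     (\<Sum>i\<in>UNIV. if i = j0 then c * (w (swap i0 j0 \<circ> p) + w p) else 0)"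
    unfolding sum.distrib
    by (intro arg_cong2[of _ _ _ _ "(+)"] sum.cong refl) (auto simp: if_distrib cong: if_cong)
  finally show ?thesis by (simp add: algebra_simps)
qed

text \<open>
  Absence of logarithms at a point \<open>z\<close> of exactly one hyperplane. The series \<open>\<eta>\<close> is the regular factor
  of a solution \<open>X\<^sup>-\<^sup>2\<^sup>m \<eta>\<close> of the dual equation, with any leading coefficient \<open>l\<close> fixed by the
  reflection. The recursion for \<open>\<eta>\<close> divides by \<open>n\<close> on the invariants of the reflection \<open>s\<close> and by
  \<open>n - 2m\<close> on its anti-invariants, so the only obstruction sits at \<open>n = 2m\<close>. Write \<open>u = e + v\<close> with \<open>e\<close>
  orthogonal to the hyperplane and \<open>v\<close> inside it, and consider the directions \<open>e + \<theta> v\<close>. The obstruction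
  is a polynomial in \<open>\<theta>\<close> whose derivative vanishes by flatness. At \<open>\<theta> = 0\<close> the reflection turns \<open>X\<close>
  into \<open>-X\<close>, so the coefficient of order \<open>n\<close> has parity \<open>(-1)\<^sup>n\<close>; as \<open>2m\<close> is even, it has no
  anti-invariant part.
\<close>

lemma dual_solution:
  fixes z u :: "'n :: finite \<Rightarrow> complex" and m :: nat
  assumes m: "m > 0" and ij: "i0 \<noteq> j0" and zij: "z i0 = z j0" and uij: "u i0 \<noteq> u j0"
    and z: "\<And>i j. i \<noteq> j \<Longrightarrow> {i, j} \<noteq> {i0, j0} \<Longrightarrow> z i \<noteq> z j"
    and lam: "\<And>p. l (swap i0 j0 \<circ> p) = l p"
  obtains \<eta> :: "('n \<Rightarrow> 'n) \<Rightarrow> complex fps"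
  where "\<And>p. \<eta> p $$ 0 = l p"
    and "\<And>p n. n \<le> 2 * m \<Longrightarrow>
      (euler (\<eta> p) - fps_const (of_nat (2 * m)) * \<eta> p - kzop (line_array (- of_nat m / 2) z u) \<eta> p) $$ n = 0"
proof -
  define \<mu> :: complex where "\<mu> = - of_nat m / 2"
  let ?s = "swap i0 j0"
  define e where "e k = (u k - u (?s k)) / 2" for k
  define v where "v k = (u k + u (?s k)) / 2" for k
  have ss: "?s \<circ> (?s \<circ> p) = p" for p :: "'n \<Rightarrow> 'n" by (simp add: fun_eq_iff)
  have zz: "z i = z j \<longleftrightarrow> i = j \<or> (i = i0 \<and> j = j0) \<or> (i = j0 \<and> j = i0)" for i j
    using z[of i j] zij by (auto simp: doubleton_eq_iff)
  have zu: "z i \<noteq> z j \<or> e i \<noteq> e j" if "i \<noteq> j" for i j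
    using that uij zz[of i j] by (auto simp: e_def)
  have zv: "v i = v j" if "z i = z j" for i j
    using that zz[of i j] by (auto simp: v_def)
  have zs: "z (?s k) = z k" for k
    using zij by (simp add: Transposition.transpose_def)
  have es: "e (?s k) = - e k" for k
    by (simp add: e_def field_simps)
  define d :: "nat \<Rightarrow> complex" where "d n = of_nat n - 2 * of_nat m" for n
  \<comment> \<open>\<open>r + r' s\<close> acts as \<open>1/n\<close> on invariants and as \<open>1/(n - 2m)\<close> on anti-invariants. At \<open>n = 2m\<close> the
    second inverse is \<open>0\<close>, which drops the obstructed part and records it in \<open>h\<close>.\<close>
  define r where "r n = (1 / of_nat n + 1 / d n) / 2" for n
  define r' where "r' n = (1 / of_nat n - 1 / d n) / 2" for n
  have d0: "d n \<noteq> 0" if "n \<noteq> 2 * m" for n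
  proof
    assume "d n = 0"
    then have "(of_nat n :: complex) = of_nat (2 * m)" by (simp add: d_def)
    then show False using that by (simp only: of_nat_eq_iff)
  qed
  define x where "x = two_term_series ?s (\<lambda>n. [:r n:]) (\<lambda>n. [:r' n:]) (\<lambda>n i j. pencil_array \<mu> z e v i j $$ n) (\<lambda>p. [:l p:])"
  define R where "R n p = (\<Sum>k<n. kzop (\<lambda>i j. pencil_array \<mu> z e v i j $$ (n - k)) (x k) p)" for n p
  have x0: "x 0 p = [:l p:]" for p by (simp add: x_def)
  have xn: "x n p = [:r n:] * R n p + [:r' n:] * R n (?s \<circ> p)" if "n > 0" for n p
    using that by (subst x_def, subst two_term_series.simps) (simp add: R_def x_def)
  have A0: "kzop (\<lambda>i j. pencil_array \<mu> z e v i j $$ 0) w p = - [:of_nat m:] * (w (?s \<circ> p) + w p)" for w p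
  proof -
    have "kzop (\<lambda>i j. pencil_array \<mu> z e v i j $$ 0) w p = 2 * [:\<mu>:] * (w (?s \<circ> p) + w p)"
      using ij by (intro kzop_single_pair) (auto simp: pencil_array_def line_coeff_def zz)
    also have "2 * [:\<mu>:] = - [:of_nat m:]"
      by (simp add: \<mu>_def numeral_poly)
    finally show ?thesis .
  qed
  have B0: "(\<lambda>i j. tilt_array \<mu> z e v i j $$ 0) = (\<lambda>i j. 0)"
    by (auto simp: fun_eq_iff tilt_array_def tilt_coeff_def)
  define f where "f p = Abs_fps (\<lambda>n. x n p)" for p
  define h where "h = (\<lambda>q. euler (f q) - fps_const [:of_nat (2*m):] * f q - kzop (pencil_array \<mu> z e v) f q)"
  define g where "g = (\<lambda>q. theta_deriv (f q) - kzop (tilt_array \<mu> z e v) f q)"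
  have Lop: "(euler (y p) - fps_const [:of_nat (2*m):] * y p - kzop (pencil_array \<mu> z e v) y p) $$ n
     = [:of_nat n - of_nat m:] * y p $$ n + [:of_nat m:] * y (?s \<circ> p) $$ n
       - (\<Sum>k<n. kzop (\<lambda>i j. pencil_array \<mu> z e v i j $$ (n - k)) (\<lambda>q. y q $$ k) p)" for y n p
    by (simp add: kzop_nth sum_atMost_split A0 of_nat_poly smult_add_right algebra_simps)
       (simp add: smult_diff_left[symmetric] smult_add_left[symmetric])
  have h_eq: "h p $$ n = [:of_nat n - of_nat m:] * x n p + [:of_nat m:] * x n (?s \<circ> p) - R n p" for n p
    unfolding h_def Lop by (simp add: f_def R_def)
  have h_n: "h p $$ n = (if n = 2 * m then smult (1/2) (R n (?s \<circ> p) - R n p) else 0)" for n p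
  proof (cases "n = 0")
    case True
    then show ?thesis using m lam by (simp add: h_eq x0 R_def)
  next
    case False
    have "h p $$ n = [:(of_nat n - of_nat m) * r n + of_nat m * r' n - 1:] * R n p
       + [:(of_nat n - of_nat m) * r' n + of_nat m * r n:] * R n (?s \<circ> p)"
      unfolding h_eq using False
      by (simp add: xn ss smult_add_right smult_diff_right smult_add_left smult_diff_left algebra_simps)
    also have "\<dots> = (if n = 2 * m then smult (1/2) (R n (?s \<circ> p) - R n p) else 0)"
    proof (cases "n = 2 * m")
      case True
      then have "d n = 0" by (simp add: d_def)
      then have "r n = 1 / (4 * of_nat m)" "r' n = 1 / (4 * of_nat m)"
        using True by (simp_all add: r_def r'_def)
      then have "of_nat m * r n = 1/4" "of_nat m * r' n = 1/4"
        using m by simp_all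
      moreover have "of_nat n - of_nat m = (of_nat m :: complex)" using True by simp
      ultimately have c: "(of_nat n - of_nat m) * r n + of_nat m * r' n - 1 = - (1/2)"
        "(of_nat n - of_nat m) * r' n + of_nat m * r n = 1/2"
        by (simp_all only:) simp_all
      show ?thesis unfolding c using True by (simp add: smult_diff_right)
    next
      case n: False
      have "(of_nat n - of_nat m) * r n + of_nat m * r' n - 1 = 0"
        and "(of_nat n - of_nat m) * r' n + of_nat m * r n = 0"
        using False d0[OF n] unfolding r_def r'_def by (simp_all add: field_simps) (simp_all add: d_def algebra_simps)
      then show ?thesis using n by simp
    qed
    finally show ?thesis .
  qed
  have fl: "theta_deriv (h q) - kzop (tilt_array \<mu> z e v) h q
     = euler (g q) - fps_const [:of_nat (2*m):] * g q - kzop (pencil_array \<mu> z e v) g q" for q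
    unfolding h_def g_def by (rule formal_flatness) (erule zu zv)+
  have fl_n: "pderiv (h q $$ n) = [:of_nat n - of_nat m:] * g q $$ n + [:of_nat m:] * g (?s \<circ> q) $$ n
       - (\<Sum>k<n. kzop (\<lambda>i j. pencil_array \<mu> z e v i j $$ (n - k)) (\<lambda>q. g q $$ k) q)" if "n \<le> 2 * m" for n q
  proof -
    have "kzop (tilt_array \<mu> z e v) h q $$ n = 0"
      using that by (simp add: kzop_nth sum_atMost_split B0 h_n)
    then show ?thesis
      using arg_cong[OF fl[of q], of "\<lambda>f. f $$ n"] unfolding Lop by simp
  qed
  \<comment> \<open>Below order \<open>2m\<close> both eigenvalues \<open>n\<close> and \<open>n - 2m\<close> are nonzero, so the defect in the direction of
    \<open>\<theta>\<close> vanishes.\<close>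
  have g0: "g q $$ n = 0" if "n < 2 * m" for q n
    using that
  proof (induction n arbitrary: q rule: less_induct)
    case (less n)
    show ?case
    proof (cases "n = 0")
      case True
      then show ?thesis by (simp add: g_def kzop_nth B0 f_def x0 pderiv_pCons)
    next
      case False
      have eq: "[:of_nat n - of_nat m:] * g q $$ n + [:of_nat m:] * g (?s \<circ> q) $$ n = 0" for q
        using fl_n[of n q] less by (simp add: h_n)
      have "[:of_nat n * d n:] * g q $$ n = [:of_nat n - of_nat m:] * ([:of_nat n - of_nat m:] * g q $$ n + [:of_nat m:] * g (?s \<circ> q) $$ n)
          - [:of_nat m:] * ([:of_nat n - of_nat m:] * g (?s \<circ> q) $$ n + [:of_nat m:] * g (?s \<circ> (?s \<circ> q)) $$ n)"
        unfolding ss by (simp add: d_def algebra_simps smult_add_right smult_diff_right smult_add_left smult_diff_left numeral_poly)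
      also have "\<dots> = 0" unfolding eq by simp
      finally show ?thesis using False d0[of n] less.prems by simp
    qed
  qed
  \<comment> \<open>The derivative of the obstruction is invariant under the reflection, the obstruction itself is
    anti-invariant.\<close>
  have ph: "pderiv (h q $$ (2*m)) = 0" for q
  proof -
    have *: "pderiv (h q $$ (2*m)) = [:of_nat m:] * (g q $$ (2*m) + g (?s \<circ> q) $$ (2*m))" for q
      using fl_n[of "2*m" q] by (simp add: g0 smult_add_right)
    have "h (?s \<circ> q) $$ (2*m) = - h q $$ (2*m)"
      by (simp add: h_n ss smult_diff_right)
    then have "pderiv (h q $$ (2*m)) = - pderiv (h q $$ (2*m))"
      using *[of q] *[of "?s \<circ> q"] by (simp add: ss pderiv_minus add.commute)
    then show ?thesis by (simp add: equal_neg_zero)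
  qed
  have par: "poly (x n (?s \<circ> p)) 0 = (-1) ^ n * poly (x n p) 0 \<and> poly (R n (?s \<circ> p)) 0 = (-1) ^ n * poly (R n p) 0" for n p
  proof (induction n arbitrary: p rule: less_induct)
    case (less n)
    have A: "line_array \<mu> z e (?s i) (?s j) $$ k = (-1) ^ k * line_array \<mu> z e i j $$ k" for i j k
    proof -
      have "- ((e j - e i) / (z i - z j)) = (-1) * (- ((e i - e j) / (z i - z j)))"
        by (simp add: field_simps)
      then have "(- ((e j - e i) / (z i - z j))) ^ k = (-1) ^ k * (- ((e i - e j) / (z i - z j))) ^ k"
        by (simp only: power_mult_distrib)
      moreover have "- e i - - e j = e j - e i" by simp
      ultimately show ?thesis
        by (simp add: line_array_def line_coeff_def zs es inj_eq[OF bij_is_inj[OF bij_transpose]])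
    qed
    have Rp: "poly (R n (?s \<circ> p)) 0 = (-1) ^ n * poly (R n p) 0" for p
    proof -
      have "poly (R n (?s \<circ> p)) 0 = (\<Sum>k<n. kzop (\<lambda>i j. line_array \<mu> z e i j $$ (n - k)) (\<lambda>q. poly (x k q) 0) (?s \<circ> p))"
        by (simp add: R_def poly_sum poly_kzop pencil_array_eval)
      also have "\<dots> = (\<Sum>k<n. kzop (\<lambda>i j. (-1) ^ (n - k) * line_array \<mu> z e i j $$ (n - k)) (\<lambda>q. (-1) ^ k * poly (x k q) 0) p)"
        by (intro sum.cong refl) (simp add: kzop_swap_equivariant A less.IH)
      also have "\<dots> = (\<Sum>k<n. (-1) ^ n * kzop (\<lambda>i j. line_array \<mu> z e i j $$ (n - k)) (\<lambda>q. poly (x k q) 0) p)"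
      proof (intro sum.cong refl)
        fix k assume "k \<in> {..<n}"
        then have "(-1) ^ n = (-1) ^ (n - k) * (-1 :: complex) ^ k" by (simp add: power_add[symmetric])
        then show "kzop (\<lambda>i j. (-1) ^ (n - k) * line_array \<mu> z e i j $$ (n - k)) (\<lambda>q. (-1) ^ k * poly (x k q) 0) p
           = (-1) ^ n * kzop (\<lambda>i j. line_array \<mu> z e i j $$ (n - k)) (\<lambda>q. poly (x k q) 0) p"
          by (simp add: kzop_def sum_distrib_left algebra_simps)
      qed
      also have "\<dots> = (-1) ^ n * poly (R n p) 0"
        by (simp add: R_def poly_sum poly_kzop pencil_array_eval sum_distrib_left)
      finally show ?thesis .
    qed
    have "poly (x n (?s \<circ> p)) 0 = (-1) ^ n * poly (x n p) 0"
    proof (cases "n = 0")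
      case True
      then show ?thesis by (simp add: x0 lam)
    next
      case False
      have "poly (R n p) 0 = (-1) ^ n * poly (R n (?s \<circ> p)) 0"
        using Rp[of "?s \<circ> p"] by (simp add: ss)
      then show ?thesis using False Rp[of p]
        by (simp add: xn ss algebra_simps power_mult_distrib[symmetric])
    qed
    then show ?case using Rp by blast
  qed
  have h2m: "h q $$ (2*m) = 0" for q
  proof -
    obtain c where c: "h q $$ (2*m) = [:c:]"
      using ph[of q] by (auto simp: pderiv_eq_0_iff elim!: degree_eq_zeroE)
    have "poly (h q $$ (2*m)) 0 = 0"
      using par[of "2*m" q] by (simp add: h_n)
    then show ?thesis using c by simp
  qed
  have hz: "h q $$ n = 0" if "n \<le> 2*m" for q n
    using h2m[of q] h_n[of q n] by (cases "n = 2*m") auto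
  define \<eta> where "\<eta> p = Abs_fps (\<lambda>n. poly (x n p) 1)" for p
  have ev: "u k = e k + 1 * v k" for k by (simp add: e_def v_def field_simps)
  show ?thesis
  proof (rule that)
    show "\<eta> p $$ 0 = l p" for p by (simp add: \<eta>_def x0)
    fix p n assume n: "n \<le> 2 * m"
    have "line_array \<mu> z u = line_array \<mu> z (\<lambda>k. e k + 1 * v k)" using ev by presburger
    then have A: "line_array \<mu> z u i j $$ k = poly (pencil_array \<mu> z e v i j $$ k) 1" for i j k
      by (simp only: pencil_array_eval)
    have "(euler (\<eta> p) - fps_const (of_nat (2 * m)) * \<eta> p - kzop (line_array \<mu> z u) \<eta> p) $$ n
        = poly (h p $$ n) 1"
      by (simp add: h_def kzop_nth A poly_kzop poly_sum \<eta>_def f_def of_nat_poly)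
    then show "(euler (\<eta> p) - fps_const (of_nat (2 * m)) * \<eta> p - kzop (line_array (- of_nat m / 2) z u) \<eta> p) $$ n = 0"
      using hz[OF n] by (simp add: \<mu>_def)
  qed
qed

section \<open>Polynomial solutions on a generic line\<close>

text \<open>
  Stated for a subspace of an ambient space of arbitrary dimension, because the polynomial vectors
  of bounded degree do not form a type of their own.
\<close>

lemma (in vector_space) injective_endo_surjective:
  assumes M: "subspace M" and B: "finite B" "M \<subseteq> span B"
    and T: "Vector_Spaces.linear scale scale T" and TM: "\<And>x. x \<in> M \<Longrightarrow> T x \<in> M"
    and inj: "\<And>x. x \<in> M \<Longrightarrow> T x = 0 \<Longrightarrow> x = 0"
    and y: "y \<in> M"
  obtains x where "x \<in> M" "T x = y"
proof -
  interpret T: Vector_Spaces.linear scale scale T by fact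
  obtain C where C: "C \<subseteq> M" "independent C" "M \<subseteq> span C"
    by (rule maximal_independent_subset)
  have sC: "span C = M" using C M by (simp add: span_minimal subset_antisym)
  have fin: "finite C" using independent_span_bound[OF B(1) C(2)] C(1) B(2) by auto
  have injC: "inj_on T (span C)"
    unfolding sC
  proof (rule inj_onI)
    fix x x' assume "x \<in> M" "x' \<in> M" "T x = T x'"
    then show "x = x'" using inj[of "x - x'"] M by (simp add: T.diff subspace_diff)
  qed
  have ind: "independent (T ` C)"
    using C(2) injC by (rule T.independent_injective_image)
  have card: "card (T ` C) = card C"
    using injC span_superset by (metis card_image inj_on_subset)
  have "y \<in> span (T ` C)"
  proof (rule ccontr)
    assume n: "y \<notin> span (T ` C)"
    then have "independent (insert y (T ` C))" using ind by (rule independent_insertI)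
    moreover have "insert y (T ` C) \<subseteq> span C"
      using y TM C(1) unfolding sC by auto
    ultimately have "card (insert y (T ` C)) \<le> card C"
      using independent_span_bound[OF fin] by blast
    moreover have "y \<notin> T ` C" using n span_superset by blast
    ultimately show False using fin card by simp
  qed
  then have "y \<in> T ` M" by (simp add: T.span_image sC)
  then show ?thesis using that by blast
qed

definition expand_at :: "complex \<Rightarrow> complex poly \<Rightarrow> complex fps"
  where "expand_at a f = fps_of_poly (pcompose f [:a, 1:])"

lemma expand_add: "expand_at a (f + g) = expand_at a f + expand_at a g"
  by (simp add: expand_at_def pcompose_add fps_of_poly_add)

lemma expand_mult: "expand_at a (f * g) = expand_at a f * expand_at a g"
  by (simp add: expand_at_def pcompose_mult fps_of_poly_mult)

lemma expand_diff: "expand_at a (f - g) = expand_at a f - expand_at a g"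
  by (simp add: expand_at_def pcompose_diff fps_of_poly_diff)

lemma expand_smult: "expand_at a (smult c f) = fps_const c * expand_at a f"
  by (simp add: expand_at_def pcompose_smult fps_of_poly_smult)

lemma expand_0 [simp]: "expand_at a 0 = 0"
  by (simp add: expand_at_def)

lemma expand_sum: "expand_at a (\<Sum>i\<in>S. f i) = (\<Sum>i\<in>S. expand_at a (f i))"
  by (induction S rule: infinite_finite_induct) (auto simp: expand_add)

lemma expand_pderiv: "expand_at a (pderiv f) = fps_deriv (expand_at a f)"
  by (simp add: expand_at_def fps_of_poly_pderiv[symmetric] pderiv_pcompose pderiv_pCons)

lemma expand_nth_0: "expand_at a f $$ 0 = poly f a"
  by (simp add: expand_at_def poly_0_coeff_0[symmetric] poly_pcompose)

lemma expand_at_zero: "expand_at 0 f = fps_of_poly f"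
  by (simp add: expand_at_def pcompose_idR)

lemma expand_linear: "expand_at a [:- t, 1:] = fps_const (a - t) + fps_X"
  by (simp add: expand_at_def pcompose_pCons fps_of_poly_pCons)

definition fpair :: "('k :: finite \<Rightarrow> complex fps) \<Rightarrow> ('k \<Rightarrow> complex fps) \<Rightarrow> complex fps"
  where "fpair x y = (\<Sum>p\<in>UNIV. x p * y p)"

lemma sum_comp_swap:
  fixes g :: "('n :: finite \<Rightarrow> 'n) \<Rightarrow> 'r :: comm_monoid_add"
  shows "(\<Sum>p\<in>UNIV. g (swap i j \<circ> p)) = (\<Sum>p\<in>UNIV. g p)"
proof (rule sum.reindex_bij_betw)
  have "swap i j \<circ> (swap i j \<circ> p) = p" for p :: "'n \<Rightarrow> 'n" by (simp add: fun_eq_iff)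
  then show "bij ((\<circ>) (swap i j) :: ('n \<Rightarrow> 'n) \<Rightarrow> _)"
    by (intro o_bij[of "(\<circ>) (swap i j)"]) (auto simp: fun_eq_iff)
qed

text \<open>
  Transpositions are involutions of the index set, so the KZ operators are self-adjoint; this
  identifies the dual of the connection with its negative.
\<close>

lemma fpair_kzop: "fpair x (kzop a y) = fpair (kzop a x) y"
proof -
  have 1: "(\<Sum>p\<in>UNIV. x p * (a i j * (y (swap i j \<circ> p) + y p))) =
      (\<Sum>p\<in>UNIV. a i j * (x (swap i j \<circ> p) + x p) * y p)" for i j
  proof -
    have "swap i j \<circ> (swap i j \<circ> p) = p" for p :: "'a \<Rightarrow> 'a" by (simp add: fun_eq_iff)
    then have "(\<Sum>p\<in>UNIV. x p * y (swap i j \<circ> p)) = (\<Sum>p\<in>UNIV. x (swap i j \<circ> p) * y p)"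
      using sum_comp_swap[of "\<lambda>p. x (swap i j \<circ> p) * y p" i j] by simp
    then have "(\<Sum>p\<in>UNIV. a i j * (x p * y (swap i j \<circ> p)) + a i j * (x p * y p)) =
       (\<Sum>p\<in>UNIV. a i j * (x (swap i j \<circ> p) * y p) + a i j * (x p * y p))"
      by (simp add: sum.distrib sum_distrib_left[symmetric])
    then show ?thesis by (simp add: algebra_simps)
  qed
  have "fpair x (kzop a y) = (\<Sum>i\<in>UNIV. \<Sum>j\<in>UNIV. \<Sum>p\<in>UNIV. x p * (a i j * (y (swap i j \<circ> p) + y p)))"
    unfolding fpair_def kzop_def sum_distrib_left
    by (subst sum.swap) (intro sum.cong refl sum.swap)
  also have "\<dots> = (\<Sum>i\<in>UNIV. \<Sum>j\<in>UNIV. \<Sum>p\<in>UNIV. a i j * (x (swap i j \<circ> p) + x p) * y p)"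
    by (simp only: 1)
  also have "\<dots> = fpair (kzop a x) y"
    unfolding fpair_def kzop_def sum_distrib_right
    by (subst (2) sum.swap) (intro sum.cong refl sum.swap)
  finally show ?thesis .
qed

lemma fpair_euler: "euler (fpair x y) = fpair (\<lambda>p. euler (x p)) y + fpair x (\<lambda>p. euler (y p))"
  unfolding fpair_def by (simp add: additive_sum[of euler, OF euler_add] euler_mult sum.distrib)

lemma fpair_add_right: "fpair x (\<lambda>p. y p + y' p) = fpair x y + fpair x y'"
  unfolding fpair_def by (simp add: algebra_simps sum.distrib)

lemma fpair_scale_right: "fpair x (\<lambda>p. c * y p) = c * fpair x y"
  unfolding fpair_def by (simp add: sum_distrib_left algebra_simps)

lemma fpair_low_order:
  assumes "\<And>p k. k \<le> n \<Longrightarrow> x p $$ k = 0"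
  shows "fpair x y $$ n = 0"
  unfolding fpair_def using assms by (simp add: fps_sum_nth fps_mult_nth)

lemma line_array_minus: "line_array (- \<mu>) z u i j = - line_array \<mu> z u i j"
  by (rule fps_ext) (simp add: line_array_def line_coeff_def)

text \<open>
  The line \<open>z + t u\<close> starts outside the hyperplanes and meets each of them, at pairwise different
  parameters.
\<close>

locale generic_line =
  fixes z u :: "'n :: finite \<Rightarrow> complex" and m :: nat
  assumes m: "m > 0"
    and z: "\<And>i j. i \<noteq> j \<Longrightarrow> z i \<noteq> z j"
    and u: "\<And>i j. i \<noteq> j \<Longrightarrow> u i \<noteq> u j"
    and generic: "\<And>i j k l. i \<noteq> j \<Longrightarrow> k \<noteq> l \<Longrightarrow> {i, j} \<noteq> {k, l} \<Longrightarrow>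
      (z i - z j) * (u k - u l) \<noteq> (z k - z l) * (u i - u j)"
begin

definition \<mu> :: complex where "\<mu> = of_nat m / 2"

definition crossing :: "'n \<Rightarrow> 'n \<Rightarrow> complex" where "crossing i j = - ((z i - z j) / (u i - u j))"

definition line_point :: "complex \<Rightarrow> 'n \<Rightarrow> complex" where "line_point a k = z k + a * u k"

lemma crossing_eq: assumes "i \<noteq> j" shows "z i - z j = - crossing i j * (u i - u j)"
  using u[OF assms] by (simp add: crossing_def)

text \<open>
  The covariant derivative along the line. Euclidean division makes it a linear map on all polynomial
  vectors; it is the true covariant derivative where the divisions are exact, which is the case on
  the lattice below.
\<close>

definition nabla :: "(('n \<Rightarrow> 'n) \<Rightarrow> complex poly) \<Rightarrow> ('n \<Rightarrow> 'n) \<Rightarrow> complex poly"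
  where "nabla f p = pderiv (f p) - (\<Sum>i\<in>UNIV. \<Sum>j\<in>UNIV. if i = j then 0 else
     smult \<mu> ((f (swap i j \<circ> p) + f p) div [:- crossing i j, 1:]))"

definition dual_sol :: "'n \<Rightarrow> 'n \<Rightarrow> (('n \<Rightarrow> 'n) \<Rightarrow> complex fps) \<Rightarrow> bool"
  where "dual_sol i j \<eta> \<longleftrightarrow> (\<forall>p n. n \<le> 2 * m \<longrightarrow>
     (euler (\<eta> p) - fps_const (of_nat (2 * m)) * \<eta> p - kzop (line_array (- \<mu>) (line_point (crossing i j)) u) \<eta> p) $$ n = 0)"

text \<open>
  Membership says that \<open>X\<^sup>-\<^sup>2\<^sup>m \<langle>\<eta>, f\<rangle>\<close> is regular at each crossing for each dual solution
  \<open>X\<^sup>-\<^sup>2\<^sup>m \<eta>\<close>; equivalently, \<open>f\<close> is locally a combination of flat sections with regular coefficients.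
  Describing it by dual solutions replaces completeness arguments by finitely many linear
  conditions.
\<close>

definition lattice :: "(('n \<Rightarrow> 'n) \<Rightarrow> complex poly) set"
  where "lattice = {f. \<forall>i j \<eta> n. i \<noteq> j \<longrightarrow> dual_sol i j \<eta> \<longrightarrow> n < 2 * m \<longrightarrow>
     fpair \<eta> (\<lambda>p. expand_at (crossing i j) (f p)) $$ n = 0}"

lemma line_point_diff: "i \<noteq> j \<Longrightarrow> line_point a i - line_point a j = (a - crossing i j) * (u i - u j)"
  using crossing_eq[of i j] by (simp add: line_point_def algebra_simps)

text \<open>
  The leading coefficient of a dual solution can be any invariant of the reflection; choosing the
  sum of two point masses shows that the residue of the connection annihilates \<open>f\<close> at the crossing.
\<close>

lemma lattice_root:
  assumes f: "f \<in> lattice" and ij: "i \<noteq> j"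
  shows "poly (f (swap i j \<circ> p) + f p) (crossing i j) = 0"
proof -
  let ?s = "swap i j"
  have ss: "?s \<circ> (?s \<circ> p) = p" for p :: "'n \<Rightarrow> 'n" by (simp add: fun_eq_iff)
  define l :: "('n \<Rightarrow> 'n) \<Rightarrow> complex" where "l q = (if q = ?s \<circ> p then 1 else 0) + (if q = p then 1 else 0)" for q
  have lam: "l (?s \<circ> q) = l q" for q
  proof -
    have "?s \<circ> q = ?s \<circ> p \<longleftrightarrow> q = p" "?s \<circ> q = p \<longleftrightarrow> q = ?s \<circ> p" using ss by metis+
    then show ?thesis by (simp add: l_def)
  qed
  have p1: "line_point (crossing i j) i = line_point (crossing i j) j" using line_point_diff[OF ij, of "crossing i j"] by simp
  have p2: "line_point (crossing i j) k \<noteq> line_point (crossing i j) k'" if "k \<noteq> k'" "{k, k'} \<noteq> {i, j}" for k k'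
  proof
    assume "line_point (crossing i j) k = line_point (crossing i j) k'"
    then have "z k - z k' = - crossing i j * (u k - u k')"
      by (simp add: line_point_def algebra_simps)
    then have "(z k - z k') * (u i - u j) = (z i - z j) * (u k - u k')"
      by (simp add: crossing_eq[OF ij])
    then show False using generic[of k k' i j] that ij by metis
  qed
  obtain \<eta> where \<eta>: "\<And>p. \<eta> p $$ 0 = l p"
    "\<And>p n. n \<le> 2 * m \<Longrightarrow>
      (euler (\<eta> p) - fps_const (of_nat (2 * m)) * \<eta> p - kzop (line_array (- of_nat m / 2) (line_point (crossing i j)) u) \<eta> p) $$ n = 0"
    using dual_solution[where z = "line_point (crossing i j)" and u = u and l = l, OF m ij p1 u[OF ij] p2 lam] by blast
  have "dual_sol i j \<eta>" unfolding dual_sol_def using \<eta>(2) by (simp add: \<mu>_def)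
  then have "fpair \<eta> (\<lambda>p. expand_at (crossing i j) (f p)) $$ 0 = 0"
    using f ij m unfolding lattice_def by simp
  then have "(\<Sum>q\<in>UNIV. l q * poly (f q) (crossing i j)) = 0"
    by (simp add: fpair_def fps_sum_nth expand_nth_0 \<eta>(1))
  moreover have "(\<Sum>q\<in>UNIV. l q * poly (f q) (crossing i j)) = poly (f (?s \<circ> p)) (crossing i j) + poly (f p) (crossing i j)"
    unfolding l_def by (simp add: distrib_right sum.distrib if_distrib[of "\<lambda>c. c * _"] cong: if_cong)
  ultimately show ?thesis by simp
qed

lemma lattice_div:
  assumes f: "f \<in> lattice" and ij: "i \<noteq> j"
  shows "[:- crossing i j, 1:] * ((f (swap i j \<circ> p) + f p) div [:- crossing i j, 1:]) = f (swap i j \<circ> p) + f p"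
  using lattice_root[OF assms, of p] by (simp only: poly_eq_0_iff_dvd dvd_mult_div_cancel)

lemma nabla_expand:
  assumes f: "f \<in> lattice"
  defines "F \<equiv> \<lambda>a p. expand_at a (f p)"
  shows "fps_X * expand_at a (nabla f p) = euler (F a p) - kzop (line_array \<mu> (line_point a) u) (F a) p"
proof -
  have 1: "line_array \<mu> (line_point a) u i j * (F a (swap i j \<circ> p) + F a p) =
      fps_X * (if i = j then 0 else fps_const \<mu> * expand_at a ((f (swap i j \<circ> p) + f p) div [:- crossing i j, 1:]))" for i j
  proof (cases "i = j")
    case True
    have "line_array \<mu> (line_point a) u i i = 0"
      by (rule fps_ext) (simp add: line_array_def line_coeff_def power_0_left)
    then show ?thesis using True by simp
  next
    case ij: False
    define Q where "Q = (f (swap i j \<circ> p) + f p) div [:- crossing i j, 1:]"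
    define d where "d = fps_const (line_point a i - line_point a j) + fps_const (u i - u j) * fps_X"
    define c where "c = fps_const (u i - u j)"
    have dd: "d = c * expand_at a [:- crossing i j, 1:]"
      unfolding d_def expand_linear c_def using ij
      by (simp add: line_point_diff distrib_left mult.commute)
    have "d $$ 1 \<noteq> 0" using u[OF ij] by (simp add: d_def)
    then have d0: "d \<noteq> 0" by auto
    have FF: "F a (swap i j \<circ> p) + F a p = expand_at a [:- crossing i j, 1:] * expand_at a Q"
      unfolding F_def expand_add[symmetric] expand_mult[symmetric] Q_def lattice_div[OF f ij] ..
    have "d * (line_array \<mu> (line_point a) u i j * (F a (swap i j \<circ> p) + F a p)) =
        (d * line_array \<mu> (line_point a) u i j) * (expand_at a [:- crossing i j, 1:] * expand_at a Q)"
      by (simp only: FF mult.assoc)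
    also have "d * line_array \<mu> (line_point a) u i j = fps_const \<mu> * fps_X * c"
      unfolding d_def c_def by (rule line_array_eq)
    also have "fps_const \<mu> * fps_X * c * (expand_at a [:- crossing i j, 1:] * expand_at a Q) = d * (fps_X * (fps_const \<mu> * expand_at a Q))"
      unfolding dd by (simp only: mult_ac)
    finally have "line_array \<mu> (line_point a) u i j * (F a (swap i j \<circ> p) + F a p) = fps_X * (fps_const \<mu> * expand_at a Q)"
      by (simp only: mult_left_cancel[OF d0])
    then show ?thesis using ij unfolding Q_def by (simp only: if_False)
  qed
  have "fps_X * expand_at a (nabla f p) = euler (F a p) - (\<Sum>i\<in>UNIV. \<Sum>j\<in>UNIV.
      fps_X * (if i = j then 0 else fps_const \<mu> * expand_at a ((f (swap i j \<circ> p) + f p) div [:- crossing i j, 1:])))"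
    unfolding nabla_def F_def euler_def
    by (simp add: expand_diff expand_sum expand_pderiv expand_smult right_diff_distrib sum_distrib_left
       if_distrib[of "expand_at a"] cong: if_cong)
  then show ?thesis unfolding kzop_def 1 .
qed

text \<open>
  Since \<open>X\<^sup>-\<^sup>2\<^sup>m \<eta>\<close> is flat for the dual connection, pairing with it turns \<open>\<nabla>\<close> into the ordinary derivative,
  which preserves regularity.
\<close>

lemma nabla_lattice:
  assumes f: "f \<in> lattice"
  shows "nabla f \<in> lattice"
  unfolding lattice_def
proof (intro CollectI allI impI)
  fix i j \<eta> n assume ij: "i \<noteq> j" and \<eta>: "dual_sol i j \<eta>" and n: "n < 2 * m"
  define A where "A = line_array \<mu> (line_point (crossing i j)) u"
  define F where "F = (\<lambda>p. expand_at (crossing i j) (f p))"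
  define G where "G = (\<lambda>p. expand_at (crossing i j) (nabla f p))"
  define h where "h p = euler (\<eta> p) - fps_const (of_nat (2 * m)) * \<eta> p + kzop A \<eta> p" for p
  have h0: "h p $$ k = 0" if "k \<le> 2 * m" for p k
  proof -
    have "kzop (line_array (- \<mu>) (line_point (crossing i j)) u) \<eta> p = - kzop A \<eta> p"
      unfolding kzop_def A_def line_array_minus by (simp add: sum_negf)
    then show ?thesis using \<eta> that unfolding dual_sol_def h_def by simp
  qed
  have "euler (F p) = fps_X * G p + kzop A F p" for p
    using nabla_expand[OF f, of "crossing i j" p] by (simp add: F_def G_def A_def)
  moreover have "euler (\<eta> p) = h p + fps_const (of_nat (2 * m)) * \<eta> p - kzop A \<eta> p" for p
    by (simp add: h_def)
  ultimately have "euler (fpair \<eta> F) = fpair (\<lambda>p. h p + fps_const (of_nat (2 * m)) * \<eta> p - kzop A \<eta> p) F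
     + (fps_X * fpair \<eta> G + fpair \<eta> (kzop A F))"
    by (simp only: fpair_euler fpair_add_right fpair_scale_right)
  also have "fpair (\<lambda>p. h p + fps_const (of_nat (2 * m)) * \<eta> p - kzop A \<eta> p) F
     = fpair h F + fps_const (of_nat (2 * m)) * fpair \<eta> F - fpair (kzop A \<eta>) F"
    unfolding fpair_def by (simp add: algebra_simps sum.distrib sum_subtractf sum_distrib_left)
  finally have *: "euler (fpair \<eta> F) - fps_const (of_nat (2 * m)) * fpair \<eta> F = fpair h F + fps_X * fpair \<eta> G"
    by (simp add: fpair_kzop)
  have y0: "fpair \<eta> F $$ k = 0" if "k < 2 * m" for k
    using f ij \<eta> that unfolding lattice_def F_def by blast
  \<comment> \<open>For \<open>n + 1 = 2m\<close> the pairing need not vanish, but then the factor in front of it does.\<close>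
  have 0: "(of_nat (Suc n) - of_nat (2 * m)) * fpair \<eta> F $$ Suc n = 0"
    using y0[of "Suc n"] n by (cases "Suc n = 2 * m") auto
  have 1: "fpair h F $$ Suc n = 0"
    using n by (intro fpair_low_order h0) simp
  have "of_nat (Suc n) * fpair \<eta> F $$ Suc n - of_nat (2 * m) * fpair \<eta> F $$ Suc n = fpair \<eta> G $$ n"
    using arg_cong[OF *, of "\<lambda>f. f $$ Suc n"] 1 by (simp del: of_nat_Suc of_nat_mult)
  then have "fpair \<eta> G $$ n = 0"
    using 0 by (simp only: left_diff_distrib)
  then show "fpair \<eta> (\<lambda>p. expand_at (crossing i j) (nabla f p)) $$ n = 0" by (simp add: G_def)
qed

text \<open>
  A monic polynomial that vanishes to order at least \<open>2m\<close> at every crossing. Its degree depends only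
  on \<open>m\<close> and the number of variables, which later bounds the solutions uniformly in the direction.
\<close>

definition clearing :: "complex poly"
  where "clearing = (\<Prod>i\<in>UNIV. \<Prod>j\<in>UNIV - {i}. [:- crossing i j, 1:] ^ (2 * m))"

lemma clearing_lattice: "(\<lambda>p. smult (w p) clearing) \<in> lattice"
  unfolding lattice_def
proof (intro CollectI allI impI)
  fix i j :: 'n and \<eta> n assume ij: "i \<noteq> j" and n: "n < 2 * m"
  have "[:- crossing i j, 1:] ^ (2 * m) dvd (\<Prod>j\<in>UNIV - {i}. [:- crossing i j, 1:] ^ (2 * m))"
    using ij by (intro dvd_prodI) auto
  also have "\<dots> dvd clearing" unfolding clearing_def by (intro dvd_prodI[of UNIV i "\<lambda>i. \<Prod>j\<in>UNIV - {i}. [:- crossing i j, 1:] ^ (2 * m)"]) auto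
  finally obtain r where "clearing = [:- crossing i j, 1:] ^ (2 * m) * r" by (rule dvdE)
  moreover have "expand_at (crossing i j) ([:- crossing i j, 1:] ^ k) = fps_X ^ k" for k
  proof (induction k)
    case 0
    then show ?case by (simp add: expand_at_def pcompose_1)
  next
    case (Suc k)
    then show ?case unfolding power_Suc expand_mult expand_linear by simp
  qed
  ultimately have clearing_expand: "expand_at (crossing i j) clearing = fps_X ^ (2 * m) * expand_at (crossing i j) r"
    by (simp add: expand_mult)
  have "fpair \<eta> (\<lambda>p. expand_at (crossing i j) (smult (w p) clearing)) = fps_X ^ (2 * m) * fpair \<eta> (\<lambda>p. fps_const (w p) * expand_at (crossing i j) r)"
    unfolding fpair_scale_right[symmetric] by (simp add: expand_smult clearing_expand mult_ac)
  then show "fpair \<eta> (\<lambda>p. expand_at (crossing i j) (smult (w p) clearing)) $$ n = 0"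
    using n by (simp add: fps_X_power_mult_nth)
qed

lemma monic_clearing: "lead_coeff clearing = 1"
  unfolding clearing_def by (simp add: lead_coeff_prod lead_coeff_power)

lemma degree_clearing: "degree clearing = 2 * m * (CARD('n) * (CARD('n) - 1))"
proof -
  have "degree (\<Prod>j\<in>UNIV - {i}. [:- crossing i j, 1:] ^ (2 * m)) = (CARD('n) - 1) * (2 * m)" for i
    by (subst degree_prod_sum_eq) (auto simp: degree_power_eq)
  then show ?thesis
    unfolding clearing_def by (subst degree_prod_sum_eq) (auto simp: algebra_simps)
qed

definition bounded_lattice :: "(('n \<Rightarrow> 'n) \<Rightarrow> complex poly) set"
  where "bounded_lattice = {f \<in> lattice. \<forall>p n. n > degree clearing \<longrightarrow> coeff (f p) n = 0}"

text \<open>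
  The connection has only a simple pole at infinity, so differentiation loses a degree.
\<close>

lemma nabla_degree:
  assumes "f \<in> bounded_lattice" and n: "n \<ge> degree clearing"
  shows "coeff (nabla f p) n = 0"
proof -
  have f: "f \<in> lattice" and d: "\<And>p n. n > degree clearing \<Longrightarrow> coeff (f p) n = 0" using assms by (auto simp: bounded_lattice_def)
  have "coeff ((f (swap i j \<circ> p) + f p) div [:- crossing i j, 1:]) n = 0" if ij: "i \<noteq> j" for i j
  proof (rule ccontr)
    define Q where "Q = (f (swap i j \<circ> p) + f p) div [:- crossing i j, 1:]"
    assume "coeff ((f (swap i j \<circ> p) + f p) div [:- crossing i j, 1:]) n \<noteq> 0"
    then have Q: "coeff Q n \<noteq> 0" by (simp add: Q_def)
    then have "Q \<noteq> 0" "degree Q \<ge> degree clearing" using n le_degree order_trans by fastforce+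
    then have "degree ([:- crossing i j, 1:] * Q) > degree clearing" by (subst degree_mult_eq) auto
    moreover have "[:- crossing i j, 1:] * Q = f (swap i j \<circ> p) + f p"
      unfolding Q_def by (rule lattice_div[OF f ij])
    ultimately have "degree (f (swap i j \<circ> p) + f p) > degree clearing" by simp
    moreover have "degree (f (swap i j \<circ> p) + f p) \<le> degree clearing"
      by (rule degree_le) (simp add: d)
    ultimately show False by simp
  qed
  then show ?thesis
    unfolding nabla_def by (simp add: coeff_sum coeff_pderiv d n le_imp_less_Suc if_distrib[of "\<lambda>f. coeff f n"] cong: if_cong)
qed

text \<open>
  A horizontal member of the lattice is a polynomial solution of the radial equation and therefore
  coincides with the formal solution.
\<close>

lemma nabla_zero_solution:
  assumes f: "f \<in> lattice" and "nabla f = (\<lambda>p. 0)" 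
  shows "coeff (f p) n = radial \<mu> z u (\<lambda>p. poly (f p) 0) n p"
proof -
  have "fps_of_poly (f p) $$ n = radial \<mu> z u (\<lambda>p. poly (f p) 0) n p"
  proof (rule radial_unique[OF z])
    fix p
    have "line_point 0 = z" by (simp add: line_point_def fun_eq_iff)
    then show "euler (fps_of_poly (f p)) = kzop (line_array \<mu> z u) (\<lambda>p. fps_of_poly (f p)) p"
      using nabla_expand[OF f, of 0 p] assms(2) by (simp add: expand_at_zero)
    show "fps_of_poly (f p) $$ 0 = poly (f p) 0" by (simp add: poly_0_coeff_0)
  qed
  then show ?thesis by simp
qed

lemma radial_zero: "radial \<mu> z u (\<lambda>p. 0) n p = 0"
proof -
  have "(0 :: complex fps) $$ n = radial \<mu> z u (\<lambda>p. 0) n p"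
    by (rule radial_unique[OF z, where F = "\<lambda>p. 0"]) (simp_all add: euler_def)
  then show ?thesis by simp
qed

definition scaleW :: "complex \<Rightarrow> (('n \<Rightarrow> 'n) \<Rightarrow> complex poly) \<Rightarrow> ('n \<Rightarrow> 'n) \<Rightarrow> complex poly"
  where "scaleW c f = (\<lambda>p. smult c (f p))"

lemma vector_space_scaleW: "vector_space scaleW"
  by unfold_locales (auto simp: scaleW_def fun_eq_iff smult_add_right smult_add_left)

text \<open>
  The endomorphism \<open>f \<mapsto> \<nabla>f + q f(0)\<close> of the lattice vectors of degree at most \<open>deg q\<close> is injective: the
  coefficient of degree \<open>deg q\<close> of the image is \<open>f(0)\<close>, so \<open>f\<close> in the kernel is a solution with initial
  value \<open>0\<close>. A preimage of \<open>q w\<close> has \<open>f(0) = w\<close> and \<open>\<nabla>f = 0\<close> by the same comparison. So the formal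
  solution is a polynomial.
\<close>

lemma radial_vanishes:
  assumes n: "n > 2 * m * (CARD('n) * (CARD('n) - 1))"
  shows "radial \<mu> z u w n p = 0"
proof -
  interpret W: vector_space scaleW by (rule vector_space_scaleW)
  define T where "T f = (\<lambda>p. nabla f p + smult (poly (f p) 0) clearing)" for f
  have sub: "W.subspace bounded_lattice"
    unfolding W.subspace_def
  proof (intro conjI ballI allI)
    show "0 \<in> bounded_lattice" by (simp add: bounded_lattice_def lattice_def fpair_def fps_sum_nth)
    fix f assume f: "f \<in> bounded_lattice"
    show "scaleW c f \<in> bounded_lattice" for c
    proof -
      have "fpair \<eta> (\<lambda>p. expand_at (crossing i j) (scaleW c f p)) = fps_const c * fpair \<eta> (\<lambda>p. expand_at (crossing i j) (f p))" for \<eta> i j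
        by (simp add: scaleW_def expand_smult fpair_scale_right)
      then show ?thesis using f by (simp add: bounded_lattice_def lattice_def) (simp add: scaleW_def)
    qed
    fix g assume g: "g \<in> bounded_lattice"
    have "fpair \<eta> (\<lambda>p. expand_at (crossing i j) ((f + g) p)) = fpair \<eta> (\<lambda>p. expand_at (crossing i j) (f p)) + fpair \<eta> (\<lambda>p. expand_at (crossing i j) (g p))" for \<eta> i j
      by (simp add: expand_add fpair_add_right)
    then show "f + g \<in> bounded_lattice" using f g by (simp add: bounded_lattice_def lattice_def)
  qed
  have linT: "Vector_Spaces.linear scaleW scaleW T"
    unfolding Vector_Spaces.linear_iff
  proof (intro conjI allI vector_space_scaleW)
    fix f g c
    have "nabla (f + g) p = nabla f p + nabla g p" for p
    proof -
      have "(f + g) (swap i j \<circ> p) + (f + g) p = (f (swap i j \<circ> p) + f p) + (g (swap i j \<circ> p) + g p)" for i j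
        by simp
      then have "(if i = j then 0 else smult \<mu> (((f + g) (swap i j \<circ> p) + (f + g) p) div [:- crossing i j, 1:])) =
         (if i = j then 0 else smult \<mu> ((f (swap i j \<circ> p) + f p) div [:- crossing i j, 1:])) +
         (if i = j then 0 else smult \<mu> ((g (swap i j \<circ> p) + g p) div [:- crossing i j, 1:]))" for i j
        by (simp only: poly_div_add_left smult_add_right) simp
      then show ?thesis
        unfolding nabla_def by (simp only: sum.distrib) (simp add: pderiv_add)
    qed
    then show "T (f + g) = T f + T g"
      by (simp add: T_def fun_eq_iff smult_add_left)
    have "nabla (scaleW c f) p = smult c (nabla f p)" for p
    proof -
      have "scaleW c f (swap i j \<circ> p) + scaleW c f p = smult c (f (swap i j \<circ> p) + f p)" for i j
        by (simp add: scaleW_def smult_add_right)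
      then have "(if i = j then 0 else smult \<mu> ((scaleW c f (swap i j \<circ> p) + scaleW c f p) div [:- crossing i j, 1:])) =
         smult c (if i = j then 0 else smult \<mu> ((f (swap i j \<circ> p) + f p) div [:- crossing i j, 1:]))" for i j
        by (simp add: div_smult_left mult.commute)
      then show ?thesis
        unfolding nabla_def smult_diff_right additive_sum[of "smult c", OF smult_add_right]
        by (simp only:) (simp add: scaleW_def pderiv_smult)
    qed
    then show "T (scaleW c f) = scaleW c (T f)"
      by (simp add: T_def fun_eq_iff scaleW_def smult_add_right)
  qed
  define b :: "('n \<Rightarrow> 'n) \<Rightarrow> nat \<Rightarrow> ('n \<Rightarrow> 'n) \<Rightarrow> complex poly" where "b p n = (\<lambda>p'. if p' = p then monom 1 n else 0)" for p n
  define B where "B = (\<lambda>(p, n). b p n) ` (UNIV \<times> {..degree clearing})"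
  have finB: "finite B" by (simp add: B_def)
  have spanB: "bounded_lattice \<subseteq> W.span B"
  proof
    fix f assume f: "f \<in> bounded_lattice"
    have "f = (\<Sum>p\<in>UNIV. \<Sum>n\<le>degree clearing. scaleW (coeff (f p) n) (b p n))"
    proof
      fix p
      have s: "(\<Sum>x\<in>S. g x) p = (\<Sum>x\<in>S. g x p)" for S :: "'s set" and g :: "'s \<Rightarrow> ('n \<Rightarrow> 'n) \<Rightarrow> complex poly"
        by (induction S rule: infinite_finite_induct) auto
      have "degree (f p) \<le> degree clearing" using f by (intro degree_le) (simp add: bounded_lattice_def)
      then have "f p = (\<Sum>n\<le>degree clearing. monom (coeff (f p) n) n)"
        by (simp add: poly_as_sum_of_monoms')
      also have "\<dots> = (\<Sum>p'\<in>UNIV. if p = p' then (\<Sum>n\<le>degree clearing. monom (coeff (f p) n) n) else 0)"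
        by simp
      also have "\<dots> = (\<Sum>p'\<in>UNIV. \<Sum>n\<le>degree clearing. scaleW (coeff (f p') n) (b p' n) p)"
        by (intro sum.cong refl) (auto simp: scaleW_def b_def smult_monom)
      finally show "f p = (\<Sum>p\<in>UNIV. \<Sum>n\<le>degree clearing. scaleW (coeff (f p) n) (b p n)) p"
        by (simp add: s)
    qed
    also have "\<dots> \<in> W.span B"
      by (intro W.span_sum W.span_scale W.span_base) (auto simp: B_def)
    finally show "f \<in> W.span B" .
  qed
  have qq: "coeff clearing (degree clearing) = 1" by (rule monic_clearing)
  have clearing_bounded: "(\<lambda>p. smult (c p) clearing) \<in> bounded_lattice" for c
    using clearing_lattice[of c] by (simp add: bounded_lattice_def coeff_eq_0)
  have T_bounded: "T f \<in> bounded_lattice" if f: "f \<in> bounded_lattice" for f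
  proof -
    have "nabla f \<in> bounded_lattice"
      using f nabla_lattice[of f] nabla_degree[OF f] by (auto simp: bounded_lattice_def)
    then have "nabla f + (\<lambda>p. smult (poly (f p) 0) clearing) \<in> bounded_lattice"
      using clearing_bounded by (intro W.subspace_add[OF sub])
    then show ?thesis by (simp add: T_def plus_fun_def)
  qed
  have top: "coeff (T f p) (degree clearing) = poly (f p) 0" if "f \<in> bounded_lattice" for f p
    using nabla_degree[OF that, of "degree clearing" p] qq by (simp add: T_def)
  have inj: "f = 0" if f: "f \<in> bounded_lattice" and Tf: "T f = 0" for f
  proof -
    have f0: "poly (f p) 0 = 0" for p using top[OF f, of p] Tf by simp
    have "nabla f = (\<lambda>p. 0)" using Tf by (simp add: T_def f0 fun_eq_iff)
    then have "coeff (f p) n = 0" for p n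
      using nabla_zero_solution[of f p n] f by (simp add: f0 radial_zero bounded_lattice_def)
    then show ?thesis by (simp add: fun_eq_iff poly_eq_iff)
  qed
  obtain f where f: "f \<in> bounded_lattice" and Tf: "T f = (\<lambda>p. smult (w p) clearing)"
    using W.injective_endo_surjective[OF sub finB spanB linT T_bounded inj clearing_bounded] by blast
  have w: "poly (f p) 0 = w p" for p
    using top[OF f, of p] qq by (simp add: Tf)
  have "nabla f = (\<lambda>p. 0)"
  proof
    fix p
    show "nabla f p = 0" using fun_cong[OF Tf, of p] by (simp add: T_def w)
  qed
  then have "coeff (f p) n = radial \<mu> z u w n p"
    using nabla_zero_solution[of f p n] f by (simp add: w bounded_lattice_def)
  then show ?thesis using f n by (simp add: bounded_lattice_def degree_clearing)
qed

end

section \<open>Solutions of the scalar system\<close>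

lemma finite_bad_parameters:
  fixes L :: "'l \<Rightarrow> ('n \<Rightarrow> complex) \<Rightarrow> complex"
  assumes "finite S" and lin: "\<And>l x y c. L l (\<lambda>k. x k + c * y k) = L l x + c * L l y"
    and nz: "\<And>l. l \<in> S \<Longrightarrow> L l x \<noteq> 0 \<or> L l y \<noteq> 0"
  shows "finite {c. \<exists>l\<in>S. L l (\<lambda>k. x k + c * y k) = 0}"
proof -
  have "finite {c. L l x + c * L l y = 0}" if "l \<in> S" for l
  proof (rule finite_subset)
    show "{c. L l x + c * L l y = 0} \<subseteq> {- L l x / L l y}"
    proof
      fix c assume "c \<in> {c. L l x + c * L l y = 0}"
      then have c: "c * L l y = - L l x" by (simp add: eq_neg_iff_add_eq_0 add.commute)
      then have "L l y \<noteq> 0" using nz[OF that] by auto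
      then show "c \<in> {- L l x / L l y}" using c by (simp add: field_simps)
    qed
  qed simp
  moreover have "{c. \<exists>l\<in>S. L l (\<lambda>k. x k + c * y k) = 0} = (\<Union>l\<in>S. {c. L l x + c * L l y = 0})"
    by (auto simp: lin)
  ultimately show ?thesis using assms(1) by simp
qed

text \<open>
  Induction over the forms: a point good for all but one of them is moved along a line on which the
  remaining form is not identically zero, and each form excludes at most one parameter.
\<close>

lemma avoid_kernels:
  fixes L :: "'l \<Rightarrow> ('n \<Rightarrow> complex) \<Rightarrow> complex"
  assumes "finite S" and lin: "\<And>l x y c. L l (\<lambda>k. x k + c * y k) = L l x + c * L l y"
    and nz: "\<And>l. l \<in> S \<Longrightarrow> \<exists>x. L l x \<noteq> 0"
  shows "\<exists>x. \<forall>l\<in>S. L l x \<noteq> 0"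
  using assms(1) nz
proof (induction S rule: finite_induct)
  case empty
  then show ?case by simp
next
  case (insert a S)
  obtain x where x: "\<forall>l\<in>S. L l x \<noteq> 0" using insert by auto
  obtain y where y: "L a y \<noteq> 0" using insert.prems by blast
  have "finite {c. \<exists>l\<in>insert a S. L l (\<lambda>k. x k + c * y k) = 0}"
    by (rule finite_bad_parameters[OF _ lin]) (use insert x y in auto)
  then obtain c where "c \<notin> {c. \<exists>l\<in>insert a S. L l (\<lambda>k. x k + c * y k) = 0}"
    using ex_new_if_finite infinite_UNIV_char_0 by blast
  then show ?case by blast
qed

text \<open>
  A given direction \<open>u\<close> is moved to \<open>u + c v\<close>, which is generic for all but finitely many \<open>c\<close>; a
  polynomial in \<open>c\<close> with infinitely many zeros vanishes at \<open>c = 0\<close> too.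
\<close>

lemma radial_vanishes_everywhere:
  fixes z u :: "'n :: finite \<Rightarrow> complex" and m :: nat
  assumes m: "m > 0" and z: "\<And>i j. i \<noteq> j \<Longrightarrow> z i \<noteq> z j"
    and n: "n > 2 * m * (CARD('n) * (CARD('n) - 1))"
  shows "radial (of_nat m / 2) z u w n p = 0"
proof -
  define L :: "('n \<times> 'n) \<times> ('n \<times> 'n) \<Rightarrow> ('n \<Rightarrow> complex) \<Rightarrow> complex" where
    "L = (\<lambda>((i, j), (k, l)) x. if {i, j} = {k, l} then x i - x j
       else (z i - z j) * (x k - x l) - (z k - z l) * (x i - x j))"
  define S where "S = {((i :: 'n, j), (k :: 'n, l)). i \<noteq> j \<and> k \<noteq> l}"
  have fin: "finite S" by (rule finite_subset[OF subset_UNIV]) simp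
  have lin: "L e (\<lambda>k. x k + c * y k) = L e x + c * L e y" for e x y c
    unfolding L_def by (auto simp: algebra_simps split: prod.splits)
  have nonzero: "\<exists>x. L e x \<noteq> 0" if "e \<in> S" for e
  proof -
    obtain i j k l where e: "e = ((i, j), (k, l))" by (metis prod.exhaust)
    have ij: "i \<noteq> j" "k \<noteq> l" using that by (auto simp: S_def e)
    show ?thesis
    proof (cases "{i, j} = {k, l}")
      case True
      then have "L e (\<lambda>a. if a = i then 1 else 0) \<noteq> 0" using ij by (simp add: L_def e)
      then show ?thesis by blast
    next
      case False
      then consider "k \<notin> {i, j}" | "l \<notin> {i, j}" using ij by auto
      then show ?thesis
      proof cases
        case 1
        then have "L e (\<lambda>a. if a = k then 1 else 0) \<noteq> 0" using ij False z[of i j] by (auto simp: L_def e)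
        then show ?thesis by blast
      next
        case 2
        then have "L e (\<lambda>a. if a = l then 1 else 0) \<noteq> 0" using ij False z[of i j] by (auto simp: L_def e)
        then show ?thesis by blast
      qed
    qed
  qed
  obtain v where v: "\<And>e. e \<in> S \<Longrightarrow> L e v \<noteq> 0"
    using avoid_kernels[where L = L, OF fin lin nonzero] by blast
  define bad where "bad = {c. \<exists>e\<in>S. L e (\<lambda>k. u k + c * v k) = 0}"
  have bad: "finite bad" unfolding bad_def by (rule finite_bad_parameters[OF fin lin]) (use v in blast)
  have "poly (pencil_radial (of_nat m / 2) z u v w n p) c = 0" if "c \<notin> bad" for c
  proof -
    define u' where "u' k = u k + c * v k" for k
    have nz: "L e u' \<noteq> 0" if "e \<in> S" for e using \<open>c \<notin> bad\<close> that unfolding bad_def u'_def by blast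
    interpret generic_line z u' m
    proof
      show "0 < m" by fact
      show "z i \<noteq> z j" if "i \<noteq> j" for i j using z that .
      show "u' i \<noteq> u' j" if "i \<noteq> j" for i j
        using nz[of "((i, j), (i, j))"] that by (simp add: S_def L_def)
      show "(z i - z j) * (u' k - u' l) \<noteq> (z k - z l) * (u' i - u' j)"
        if "i \<noteq> j" "k \<noteq> l" "{i, j} \<noteq> {k, l}" for i j k l
        using nz[of "((i, j), (k, l))"] that by (simp add: S_def L_def)
    qed
    have "radial \<mu> z u' w n p = 0" by (rule radial_vanishes[OF n])
    then show ?thesis by (simp add: pencil_radial_eval \<mu>_def u'_def[abs_def])
  qed
  then have "- bad \<subseteq> {c. poly (pencil_radial (of_nat m / 2) z u v w n p) c = 0}" by blast
  moreover have "infinite (- bad)" using bad infinite_UNIV_char_0 by (simp add: Compl_eq_Diff_UNIV Diff_infinite_finite)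
  ultimately have "infinite {c. poly (pencil_radial (of_nat m / 2) z u v w n p) c = 0}"
    using finite_subset by blast
  then have "pencil_radial (of_nat m / 2) z u v w n p = 0"
    using poly_roots_finite by blast
  then have "poly (pencil_radial (of_nat m / 2) z u v w n p) 0 = 0" by simp
  then show ?thesis by (simp add: pencil_radial_eval)
qed

text \<open>
  The tilt equation is an identity of power series in the line parameter. As the series terminate,
  multiplying by the product \<open>\<Delta>\<close> of all denominators turns it into an identity of polynomials, which
  can be evaluated at the parameter \<open>1\<close>.
\<close>

lemma radial_sum_derivative:
  fixes z x v :: "'n :: finite \<Rightarrow> complex" and m :: nat and w :: "('n \<Rightarrow> 'n) \<Rightarrow> complex"
  assumes m: "m > 0" and z: "\<And>i j. i \<noteq> j \<Longrightarrow> z i \<noteq> z j" and x: "\<And>i j. i \<noteq> j \<Longrightarrow> x i \<noteq> x j"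
  defines "N \<equiv> 2 * m * (CARD('n) * (CARD('n) - 1))" and "\<mu> \<equiv> of_nat m / 2 :: complex"
  defines "u \<equiv> \<lambda>k. x k - z k"
  defines "F \<equiv> \<lambda>p. \<Sum>n\<le>N. radial \<mu> z u w n p"
  shows "(\<Sum>n\<le>N. poly (pderiv (pencil_radial \<mu> z u v w n p)) 0) =
    kzop (\<lambda>i j. \<mu> * (v i - v j) / (x i - x j)) F p"
proof -
  define D where "D n = poly (pderiv (pencil_radial \<mu> z u v w n p)) 0" for n
  define B where "B i j = Abs_fps (tilt_coeff \<mu> (1 / (z i - z j)) (u i - u j) (v i - v j))" for i j
  have B: "poly (tilt_array \<mu> z u v i j $$ n) 0 = B i j $$ n" for i j n
    by (simp add: tilt_array_def B_def tilt_coeff_def poly_power)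
  have P0: "pencil_radial \<mu> z u v w n p = 0" if "n > N" for n p
  proof (rule ccontr)
    assume "pencil_radial \<mu> z u v w n p \<noteq> 0"
    then have "finite {c. poly (pencil_radial \<mu> z u v w n p) c = 0}" by (rule poly_roots_finite)
    moreover have "{c. poly (pencil_radial \<mu> z u v w n p) c = 0} = UNIV"
      using radial_vanishes_everywhere[OF m z] that by (auto simp: pencil_radial_eval \<mu>_def N_def)
    ultimately show False using infinite_UNIV_char_0 by metis
  qed
  define f where "f p = (\<Sum>n\<le>N. monom (radial \<mu> z u w n p) n)" for p
  define G where "G = (\<Sum>n\<le>N. monom (D n) n)"
  have R: "poly (pencil_radial \<mu> z u v w n p) 0 = radial \<mu> z u w n p" for n p
    by (simp add: pencil_radial_eval)
  have r0: "radial \<mu> z u w n p = 0" if "n > N" for n p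
    using P0[OF that, of p] R[of n p] by simp
  have cf: "coeff (f p) n = radial \<mu> z u w n p" for p n
    by (simp add: f_def coeff_sum r0 not_le)
  have cG: "coeff G n = D n" for n
    by (simp add: G_def coeff_sum D_def P0 not_le)
  have fps: "fps_of_poly G = kzop B (\<lambda>q. fps_of_poly (f q)) p"
  proof (rule fps_ext)
    fix n
    have "fps_of_poly G $$ n = (\<Sum>k\<le>n. kzop (\<lambda>i j. B i j $$ (n - k)) (radial \<mu> z u w k) p)"
      by (simp add: cG D_def pencil_radial_deriv[OF z] poly_sum poly_kzop B R)
    then show "fps_of_poly G $$ n = kzop B (\<lambda>q. fps_of_poly (f q)) p $$ n"
      by (simp add: kzop_nth cf)
  qed
  define S where "S = {(i :: 'n, j). i \<noteq> j}"
  have S: "finite S" by (rule finite_subset[OF subset_UNIV]) simp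
  define d where "d = (\<lambda>(i, j). [:z i - z j, u i - u j:])"
  define \<Delta> where "\<Delta> = (\<Prod>e\<in>S. d e)"
  define \<Delta>' where "\<Delta>' e = (\<Prod>e\<in>S - {e}. d e)" for e
  have \<Delta>: "\<Delta> = d e * \<Delta>' e" if "e \<in> S" for e
    unfolding \<Delta>_def \<Delta>'_def using S that by (rule prod.remove)
  have dB: "fps_of_poly (d (i, j)) * B i j = fps_of_poly [:0, \<mu> * (v i - v j):]" if "i \<noteq> j" for i j
  proof -
    have "fps_of_poly (d (i, j)) = fps_const (z i - z j) + fps_const (u i - u j) * fps_X"
      by (simp add: d_def fps_of_poly_pCons mult.commute)
    moreover have "fps_of_poly [:0, c * c':] = fps_const c * fps_X * fps_const c'" for c c' :: complex
      by (simp add: fps_of_poly_pCons mult_ac fps_const_mult[symmetric] del: fps_const_mult)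
    moreover have "(fps_const (z i - z j) + fps_const (u i - u j) * fps_X) * B i j
        = fps_const \<mu> * fps_X * fps_const (v i - v j)"
      unfolding B_def by (rule tilt_coeff_eq) (use z[OF that] in simp)
    ultimately show ?thesis by (simp only:)
  qed
  have "fps_of_poly (\<Delta> * G) = fps_of_poly (\<Sum>i\<in>UNIV. \<Sum>j\<in>UNIV. if i = j then 0
      else \<Delta>' (i, j) * [:0, \<mu> * (v i - v j):] * (f (swap i j \<circ> p) + f p))"
  proof -
    have "fps_of_poly \<Delta> * (B i j * (fps_of_poly (f (swap i j \<circ> p)) + fps_of_poly (f p))) =
       fps_of_poly (if i = j then 0 else \<Delta>' (i, j) * [:0, \<mu> * (v i - v j):] * (f (swap i j \<circ> p) + f p))" for i j
    proof (cases "i = j")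
      case True
      have "B i i = 0" by (rule fps_ext) (simp add: B_def tilt_coeff_def)
      then show ?thesis using True by simp
    next
      case False
      then have "(i, j) \<in> S" by (simp add: S_def)
      from \<Delta>[OF this] have "fps_of_poly \<Delta> * (B i j * (fps_of_poly (f (swap i j \<circ> p)) + fps_of_poly (f p))) =
        fps_of_poly (\<Delta>' (i, j)) * (fps_of_poly (d (i, j)) * B i j) * fps_of_poly (f (swap i j \<circ> p) + f p)"
        by (simp only: fps_of_poly_mult fps_of_poly_add mult_ac)
      then show ?thesis unfolding dB[OF False] using False by (simp only: fps_of_poly_mult if_False)
    qed
    then show ?thesis
      unfolding fps_of_poly_mult fps kzop_def sum_distrib_left fps_of_poly_sum by (simp only:)
  qed
  then have eq: "\<Delta> * G = (\<Sum>i\<in>UNIV. \<Sum>j\<in>UNIV. if i = j then 0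
      else \<Delta>' (i, j) * [:0, \<mu> * (v i - v j):] * (f (swap i j \<circ> p) + f p))"
    by (simp only: fps_of_poly_eq_iff)
  have d1: "poly (d (i, j)) 1 = x i - x j" for i j
    by (simp add: d_def u_def)
  have \<Delta>1: "poly \<Delta> 1 \<noteq> 0"
    unfolding \<Delta>_def poly_prod using S x by (auto simp: d1 S_def)
  have f1: "poly (f q) 1 = F q" for q by (simp add: f_def F_def poly_sum poly_monom)
  have "poly \<Delta> 1 * poly G 1 = (\<Sum>i\<in>UNIV. \<Sum>j\<in>UNIV. if i = j then 0
      else poly (\<Delta>' (i, j)) 1 * (\<mu> * (v i - v j)) * (F (swap i j \<circ> p) + F p))"
    using arg_cong[OF eq, of "\<lambda>f. poly f 1"]
    by (simp add: poly_sum f1 if_distrib[of "\<lambda>f. poly f 1"] mult_ac cong: if_cong)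
  also have "\<dots> = (\<Sum>i\<in>UNIV. \<Sum>j\<in>UNIV. poly \<Delta> 1 * (\<mu> * (v i - v j) / (x i - x j) * (F (swap i j \<circ> p) + F p)))"
  proof (intro sum.cong refl)
    fix i j
    show "(if i = j then 0 else poly (\<Delta>' (i, j)) 1 * (\<mu> * (v i - v j)) * (F (swap i j \<circ> p) + F p)) =
       poly \<Delta> 1 * (\<mu> * (v i - v j) / (x i - x j) * (F (swap i j \<circ> p) + F p))"
    proof (cases "i = j")
      case False
      then have "(i, j) \<in> S" by (simp add: S_def)
      from \<Delta>[OF this] have "poly \<Delta> 1 = (x i - x j) * poly (\<Delta>' (i, j)) 1" by (simp add: d1)
      then show ?thesis using x[OF False] False by simp
    qed simp
  qed
  also have "\<dots> = poly \<Delta> 1 * kzop (\<lambda>i j. \<mu> * (v i - v j) / (x i - x j)) F p"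
    by (simp add: kzop_def sum_distrib_left)
  finally have "poly G 1 = kzop (\<lambda>i j. \<mu> * (v i - v j) / (x i - x j)) F p"
    using \<Delta>1 by simp
  then show ?thesis by (simp add: G_def D_def poly_sum poly_monom)
qed

text \<open>
  Specialises sums over ordered pairs to the direction of the \<open>i\<close>-th coordinate axis.
\<close>

lemma sum_axis_differences:
  fixes x :: "'n :: finite \<Rightarrow> complex" and y :: "'n \<Rightarrow> 'n \<Rightarrow> complex"
  assumes y: "\<And>a b. y a b = y b a"
  shows "(\<Sum>a\<in>UNIV. \<Sum>b\<in>UNIV. ((if a = i then 1 else 0) - (if b = i then 1 else 0)) / (x a - x b) * y a b) =
    2 * (\<Sum>j\<in>UNIV - {i}. 1 / (x i - x j) * y i j)"
proof -
  have "(\<Sum>a\<in>UNIV. \<Sum>b\<in>UNIV. ((if a = i then 1 else 0) - (if b = i then 1 else 0)) / (x a - x b) * y a b)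
     = (\<Sum>a\<in>UNIV. \<Sum>b\<in>UNIV. if a = i then y a b / (x a - x b) else 0)
       - (\<Sum>a\<in>UNIV. \<Sum>b\<in>UNIV. if b = i then y a b / (x a - x b) else 0)"
    unfolding sum_subtractf[symmetric] by (intro sum.cong refl) (simp add: diff_divide_distrib left_diff_distrib)
  also have "(\<Sum>a\<in>UNIV. \<Sum>b\<in>UNIV. if a = i then y a b / (x a - x b) else 0)
     = (\<Sum>a\<in>UNIV. if a = i then \<Sum>b\<in>UNIV. y a b / (x a - x b) else 0)"
    by (intro sum.cong refl) simp
  also have "\<dots> = (\<Sum>b\<in>UNIV. y i b / (x i - x b))" by simp
  also have "(\<Sum>a\<in>UNIV. \<Sum>b\<in>UNIV. if b = i then y a b / (x a - x b) else 0) = (\<Sum>a\<in>UNIV. y a i / (x a - x i))"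
    by simp
  also have "\<dots> = - (\<Sum>b\<in>UNIV. y i b / (x i - x b))"
    unfolding sum_negf[symmetric]
  proof (intro sum.cong refl)
    fix b
    show "y b i / (x b - x i) = - (y i b / (x i - x b))"
      by (metis y minus_diff_eq minus_divide_right)
  qed
  finally have "(\<Sum>a\<in>UNIV. \<Sum>b\<in>UNIV. ((if a = i then 1 else 0) - (if b = i then 1 else 0)) / (x a - x b) * y a b)
     = 2 * (\<Sum>b\<in>UNIV. y i b / (x i - x b))" by simp
  also have "(\<Sum>b\<in>UNIV. y i b / (x i - x b)) = (\<Sum>b\<in>UNIV - {i}. y i b / (x i - x b))"
    by (rule sum.mono_neutral_right) auto
  finally show ?thesis by simp
qed

definition complex_differentiable_at :: "(complex ^ 'n :: finite \<Rightarrow> complex) \<Rightarrow> complex ^ 'n \<Rightarrow> bool"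
  where "complex_differentiable_at f z \<longleftrightarrow>
    (\<exists>D. (f has_derivative D) (at z) \<and> Vector_Spaces.linear (*s) (*) D)"

lemma clinear_vec_iff:
  "Vector_Spaces.linear (*s) (*) (D :: complex ^ 'n :: finite \<Rightarrow> complex) \<longleftrightarrow>
    (\<forall>x y. D (x + y) = D x + D y) \<and> (\<forall>c x. D (c *s x) = c * D x)"
proof -
  have "vector_space ((*s) :: complex \<Rightarrow> complex ^ 'n \<Rightarrow> _)" "vector_space ((*) :: complex \<Rightarrow> complex \<Rightarrow> _)"
    by (auto intro!: vec.vector_space_axioms vector_space.intro simp: algebra_simps)
  then show ?thesis by (simp add: Vector_Spaces.linear_iff)
qed

lemma cdiff_const: "complex_differentiable_at (\<lambda>z. c) z"
  unfolding complex_differentiable_at_def clinear_vec_iff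
  by (rule exI[of _ "\<lambda>_. 0"]) simp

lemma cdiff_coordinate: "complex_differentiable_at (\<lambda>z. z $ i) z"
  unfolding complex_differentiable_at_def clinear_vec_iff
  by (rule exI[of _ "\<lambda>h. h $ i"]) (auto intro!: bounded_linear_imp_has_derivative bounded_linear_vec_nth)

lemma cdiff_add:
  assumes "complex_differentiable_at f z" "complex_differentiable_at g z"
  shows "complex_differentiable_at (\<lambda>z. f z + g z) z"
proof -
  obtain D E where "(f has_derivative D) (at z)" "Vector_Spaces.linear (*s) (*) D"
    "(g has_derivative E) (at z)" "Vector_Spaces.linear (*s) (*) E"
    using assms unfolding complex_differentiable_at_def by blast
  then show ?thesis
    unfolding complex_differentiable_at_def clinear_vec_iff
    by (intro exI[of _ "\<lambda>h. D h + E h"] conjI has_derivative_add) (auto simp: algebra_simps)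
qed

lemma cdiff_mult:
  assumes "complex_differentiable_at f z" "complex_differentiable_at g z"
  shows "complex_differentiable_at (\<lambda>z. f z * g z) z"
proof -
  obtain D E where "(f has_derivative D) (at z)" "Vector_Spaces.linear (*s) (*) D"
    "(g has_derivative E) (at z)" "Vector_Spaces.linear (*s) (*) E"
    using assms unfolding complex_differentiable_at_def by blast
  then show ?thesis
    unfolding complex_differentiable_at_def clinear_vec_iff
    by (intro exI[of _ "\<lambda>h. f z * E h + D h * g z"] conjI has_derivative_mult) (auto simp: algebra_simps)
qed

lemma cdiff_inverse:
  assumes "complex_differentiable_at f z" "f z \<noteq> 0"
  shows "complex_differentiable_at (\<lambda>z. inverse (f z)) z"
proof -
  obtain D where "(f has_derivative D) (at z)" "Vector_Spaces.linear (*s) (*) D"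
    using assms unfolding complex_differentiable_at_def by blast
  then show ?thesis
    unfolding complex_differentiable_at_def clinear_vec_iff using assms(2)
    by (intro exI[of _ "\<lambda>h. - (inverse (f z) * D h * inverse (f z))"] conjI Deriv.has_derivative_inverse) (auto simp: algebra_simps)
qed

lemma cdiff_sum:
  assumes "\<And>i. i \<in> S \<Longrightarrow> complex_differentiable_at (f i) z"
  shows "complex_differentiable_at (\<lambda>z. \<Sum>i\<in>S. f i z) z"
  using assms by (induction S rule: infinite_finite_induct) (auto intro: cdiff_const cdiff_add)

lemma cdiff_prod:
  assumes "\<And>i. i \<in> S \<Longrightarrow> complex_differentiable_at (f i) z"
  shows "complex_differentiable_at (\<lambda>z. \<Prod>i\<in>S. f i z) z"
  using assms by (induction S rule: infinite_finite_induct) (auto intro: cdiff_const cdiff_mult)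

lemma cdiff_power:
  assumes "complex_differentiable_at f z"
  shows "complex_differentiable_at (\<lambda>z. f z ^ n) z"
  by (induction n) (auto intro: cdiff_const cdiff_mult assms)

lemma cdiff_diff:
  assumes "complex_differentiable_at f z" "complex_differentiable_at g z"
  shows "complex_differentiable_at (\<lambda>z. f z - g z) z"
  using cdiff_add[OF assms(1) cdiff_mult[OF cdiff_const[of "-1"] assms(2)]] by simp

lemma cdiff_kzop:
  assumes "\<And>i j. complex_differentiable_at (\<lambda>z. a z i j) z" "\<And>p. complex_differentiable_at (\<lambda>z. f z p) z"
  shows "complex_differentiable_at (\<lambda>z. kzop (a z) (f z) p) z"
  unfolding kzop_def by (intro cdiff_sum cdiff_mult cdiff_add assms)

lemma cdiff_radial:
  "complex_differentiable_at (\<lambda>x. radial \<mu> z (\<lambda>k. x $ k - z k) w n p) y"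
proof (induction n arbitrary: p rule: less_induct)
  case (less n)
  have A: "complex_differentiable_at (\<lambda>x. line_array \<mu> z (\<lambda>k. x $ k - z k) i j $$ n) y" for i j n
  proof (cases "n = 0")
    case True
    then show ?thesis by (simp add: line_array_def line_coeff_def cdiff_const)
  next
    case False
    have "complex_differentiable_at (\<lambda>x. - \<mu> * ((- (1 / (z i - z j))) * ((x $ i - z i) - (x $ j - z j))) ^ n) y"
      by (intro cdiff_mult cdiff_power cdiff_const cdiff_diff cdiff_coordinate)
    then show ?thesis using False by (simp add: line_array_def line_coeff_def)
  qed
  show ?case
  proof (cases "n = 0")
    case True
    then show ?thesis by (simp add: radial_def cdiff_const)
  next
    case False
    have "radial \<mu> z u w n p = 1 / of_nat n * (\<Sum>k<n. kzop (\<lambda>i j. line_array \<mu> z u i j $$ (n - k)) (radial \<mu> z u w k) p)" for u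
      using False by (subst (1) radial_def, subst two_term_series.simps) (simp add: radial_def)
    moreover have "complex_differentiable_at (\<lambda>x. 1 / of_nat n * (\<Sum>k<n. kzop (\<lambda>i j. line_array \<mu> z (\<lambda>k. x $ k - z k) i j $$ (n - k))
        (radial \<mu> z (\<lambda>k. x $ k - z k) w k) p)) y"
      by (intro cdiff_mult cdiff_const cdiff_sum cdiff_kzop A less.IH) simp
    ultimately show ?thesis by simp
  qed
qed

text \<open>
  The KZ system for the coefficients of a function with values in the group algebra.
\<close>

definition scalar_KZ :: "int \<Rightarrow> (complex ^ 'n :: finite \<Rightarrow> ('n \<Rightarrow> 'n) \<Rightarrow> complex) \<Rightarrow> bool"
  where "scalar_KZ m F \<longleftrightarrow> (\<forall>z\<in>config_space. \<forall>p. p permutes UNIV \<longrightarrow>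
     complex_differentiable_at (\<lambda>x. F x p) z \<and>
     (\<forall>i. ((\<lambda>t. F (z + axis i t) p) has_field_derivative
        of_int m * (\<Sum>j\<in>UNIV - {i}. 1 / (z $ i - z $ j) * (F z (swap i j \<circ> p) + F z p))) (at 0)))"

lemma scalar_KZ_positive:
  fixes z0 :: "complex ^ 'n :: finite" and m :: nat
  assumes m: "m > 0" and z0: "z0 \<in> config_space"
  shows "\<exists>F. scalar_KZ (int m) F \<and> F z0 = w"
proof -
  define N where "N = 2 * m * (CARD('n) * (CARD('n) - 1))"
  define \<mu> :: complex where "\<mu> = of_nat m / 2"
  define F where "F x p = (\<Sum>n\<le>N. radial \<mu> (($) z0) (\<lambda>k. x $ k - z0 $ k) w n p)" for x p
  have z: "z0 $ i \<noteq> z0 $ j" if "i \<noteq> j" for i j using z0 that by (simp add: config_space_def)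
  have "scalar_KZ (int m) F"
    unfolding scalar_KZ_def
  proof (intro ballI allI impI conjI)
    fix y :: "complex ^ 'n" and p i assume y: "y \<in> config_space"
    then have x: "y $ i \<noteq> y $ j" if "i \<noteq> j" for i j using that by (simp add: config_space_def)
    show "complex_differentiable_at (\<lambda>x. F x p) y"
      unfolding F_def by (intro cdiff_sum cdiff_radial)
    define v :: "'n \<Rightarrow> complex" where "v k = (if k = i then 1 else 0)" for k
    have Ft: "F (y + axis i t) p = (\<Sum>n\<le>N. poly (pencil_radial \<mu> (($) z0) (\<lambda>k. y $ k - z0 $ k) v w n p) t)" for t
    proof -
      have "(\<lambda>k. (y + axis i t) $ k - z0 $ k) = (\<lambda>k. (y $ k - z0 $ k) + t * v k)"
        by (auto simp: v_def axis_def fun_eq_iff)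
      then show ?thesis by (simp only: F_def pencil_radial_eval)
    qed
    have "((\<lambda>t. F (y + axis i t) p) has_field_derivative
        (\<Sum>n\<le>N. poly (pderiv (pencil_radial \<mu> (($) z0) (\<lambda>k. y $ k - z0 $ k) v w n p)) 0)) (at 0)"
      unfolding Ft by (intro DERIV_sum poly_DERIV)
    also have "(\<Sum>n\<le>N. poly (pderiv (pencil_radial \<mu> (($) z0) (\<lambda>k. y $ k - z0 $ k) v w n p)) 0) =
       kzop (\<lambda>i j. \<mu> * (v i - v j) / (y $ i - y $ j)) (F y) p"
      unfolding N_def \<mu>_def F_def
      by (rule radial_sum_derivative[OF m z x])
    also have "\<dots> = \<mu> * (\<Sum>a\<in>UNIV. \<Sum>b\<in>UNIV. ((if a = i then 1 else 0) - (if b = i then 1 else 0)) / (y $ a - y $ b) *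
         (F y (swap a b \<circ> p) + F y p))"
      by (simp add: kzop_def v_def sum_distrib_left mult.assoc)
    also have "\<dots> = of_int (int m) * (\<Sum>j\<in>UNIV - {i}. 1 / (y $ i - y $ j) * (F y (swap i j \<circ> p) + F y p))"
      by (subst sum_axis_differences) (simp_all add: transpose_commute \<mu>_def)
    finally show "((\<lambda>t. F (y + axis i t) p) has_field_derivative
        of_int (int m) * (\<Sum>j\<in>UNIV - {i}. 1 / (y $ i - y $ j) * (F y (swap i j \<circ> p) + F y p))) (at 0)" .
  qed
  moreover have "F z0 p = w p" for p
  proof -
    have "radial \<mu> (($) z0) (\<lambda>k. 0) w n p = (if n = 0 then w p else 0)" for n
    proof -
      have "fps_const (w p) $$ n = radial \<mu> (($) z0) (\<lambda>k. 0) w n p"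
      proof (rule radial_unique[OF z, where F = "\<lambda>p. fps_const (w p)"])
        have "line_array \<mu> (($) z0) (\<lambda>k. 0) i j = 0" for i j
          by (rule fps_ext) (use z in \<open>auto simp: line_array_def line_coeff_def power_0_left\<close>)
        then show "euler (fps_const (w p)) = kzop (line_array \<mu> (($) z0) (\<lambda>k. 0)) (\<lambda>p. fps_const (w p)) p" for p
          by (simp add: euler_def kzop_def)
      qed simp_all
      then show ?thesis by (simp split: if_splits)
    qed
    then show ?thesis by (simp add: F_def)
  qed
  ultimately show ?thesis by blast
qed

lemma DERIV_prod_logarithmic:
  fixes f :: "'i \<Rightarrow> complex \<Rightarrow> complex"
  assumes "finite S" "\<And>e. e \<in> S \<Longrightarrow> (f e has_field_derivative f e t * l e) (at t)"
  shows "((\<lambda>t. \<Prod>e\<in>S. f e t) has_field_derivative (\<Prod>e\<in>S. f e t) * (\<Sum>e\<in>S. l e)) (at t)"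
  using assms
proof (induction S rule: finite_induct)
  case (insert a S)
  have "((\<lambda>t. f a t * (\<Prod>e\<in>S. f e t)) has_field_derivative
     f a t * l a * (\<Prod>e\<in>S. f e t) + (\<Prod>e\<in>S. f e t) * (\<Sum>e\<in>S. l e) * f a t) (at t)"
    using insert by (intro DERIV_mult) auto
  then show ?case using insert.hyps by (simp add: algebra_simps)
qed simp

text \<open>
  The product \<open>\<Delta>\<close> over ordered pairs is, up to sign, the square of the Vandermonde determinant, so
  \<open>\<Delta>\<^sup>-\<^sup>m\<close> shifts \<open>m (s + 1)\<close> by \<open>-2m\<close> to \<open>m (s - 1)\<close>; twisting by the sign character turns this into
  \<open>-m (s + 1)\<close>.
\<close>

lemma scalar_KZ_negative:
  fixes z0 :: "complex ^ 'n :: finite" and m :: nat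
  assumes m: "m > 0" and z0: "z0 \<in> config_space"
  shows "\<exists>F. scalar_KZ (- int m) F \<and> (\<forall>p. p permutes UNIV \<longrightarrow> F z0 p = w p)"
proof -
  define \<Delta> :: "complex ^ 'n \<Rightarrow> complex" where "\<Delta> z = (\<Prod>a\<in>UNIV. \<Prod>b\<in>UNIV - {a}. z $ a - z $ b)" for z
  have \<Delta>0: "\<Delta> z \<noteq> 0" if "z \<in> config_space" for z
    using that by (auto simp: \<Delta>_def config_space_def)
  define sg :: "('n \<Rightarrow> 'n) \<Rightarrow> complex" where "sg p = of_int (sign p)" for p
  have sg2: "sg p * sg p = 1" for p by (simp add: sg_def sign_def)
  obtain F where F: "scalar_KZ (int m) F" and F0: "F z0 = (\<lambda>p. sg p * \<Delta> z0 ^ m * w p)"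
    using scalar_KZ_positive[OF m z0] by blast
  define H where "H z p = sg p * F z p * inverse (\<Delta> z ^ m)" for z p
  have "scalar_KZ (- int m) H"
    unfolding scalar_KZ_def
  proof (intro ballI allI impI conjI)
    fix z :: "complex ^ 'n" and p :: "'n \<Rightarrow> 'n" and i
    assume z: "z \<in> config_space" and p: "p permutes UNIV"
    have zz: "z $ a \<noteq> z $ b" if "a \<noteq> b" for a b using z that by (simp add: config_space_def)
    have "complex_differentiable_at (\<lambda>x. F x p) z" using F z p unfolding scalar_KZ_def by blast
    then show "complex_differentiable_at (\<lambda>x. H x p) z"
      unfolding H_def \<Delta>_def using \<Delta>0[OF z]
      by (intro cdiff_mult cdiff_const cdiff_inverse cdiff_power cdiff_prod cdiff_diff cdiff_coordinate)
        (simp_all add: \<Delta>_def)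
    define S where "S = (\<Sum>j\<in>UNIV - {i}. 1 / (z $ i - z $ j))"
    define K where "K = (\<Sum>j\<in>UNIV - {i}. 1 / (z $ i - z $ j) * (F z (swap i j \<circ> p) + F z p))"
    have dF: "((\<lambda>t. F (z + axis i t) p) has_field_derivative of_nat m * K) (at 0)"
      using F z p unfolding scalar_KZ_def K_def by simp
    have d1: "((\<lambda>t. (z + axis i t) $ a - (z + axis i t) $ b) has_field_derivative
         ((z + axis i 0) $ a - (z + axis i 0) $ b) * (((if a = i then 1 else 0) - (if b = i then 1 else 0)) / (z $ a - z $ b))) (at 0)"
      if "a \<noteq> b" for a b
    proof -
      have "((\<lambda>t. (z $ a + t * (if a = i then 1 else 0)) - (z $ b + t * (if b = i then 1 else 0))) has_field_derivative
           ((if a = i then 1 else 0) - (if b = i then 1 else 0))) (at 0)"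
        by (auto intro!: derivative_eq_intros)
      moreover have "(\<lambda>t. (z + axis i t) $ a - (z + axis i t) $ b) =
          (\<lambda>t. (z $ a + t * (if a = i then 1 else 0)) - (z $ b + t * (if b = i then 1 else 0)))"
        by (rule ext) (simp add: axis_def)
      moreover have "((z + axis i 0) $ a - (z + axis i 0) $ b) * (((if a = i then 1 else 0) - (if b = i then 1 else 0)) / (z $ a - z $ b))
          = (if a = i then 1 else 0) - (if b = i then 1 else 0)"
        using zz[OF that] by (simp add: axis_def)
      ultimately show ?thesis by (simp only:)
    qed
    have ax: "z + axis i 0 = z" by (simp add: axis_def vec_eq_iff)
    have "((\<lambda>t. \<Delta> (z + axis i t)) has_field_derivative \<Delta> (z + axis i 0) *
        (\<Sum>a\<in>UNIV. \<Sum>b\<in>UNIV - {a}. ((if a = i then 1 else 0) - (if b = i then 1 else 0)) / (z $ a - z $ b))) (at 0)"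
      unfolding \<Delta>_def by (intro DERIV_prod_logarithmic d1) auto
    also have "(\<Sum>a\<in>UNIV. \<Sum>b\<in>UNIV - {a}. ((if a = i then 1 else 0) - (if b = i then 1 else 0)) / (z $ a - z $ b))
       = (\<Sum>a\<in>UNIV. \<Sum>b\<in>UNIV. ((if a = i then 1 else 0) - (if b = i then 1 else 0)) / (z $ a - z $ b) * 1)"
      by (intro sum.cong refl sum.mono_neutral_cong_left) auto
    also have "\<dots> = 2 * S"
      by (subst sum_axis_differences) (simp_all add: S_def)
    finally have d\<Delta>: "((\<lambda>t. \<Delta> (z + axis i t)) has_field_derivative \<Delta> z * (2 * S)) (at 0)" unfolding ax .
    have dH: "((\<lambda>t. H (z + axis i t) p) has_field_derivative
        sg p * (of_nat m * K) * inverse (\<Delta> z ^ m) - 2 * of_nat m * S * H z p) (at 0)"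
    proof -
      define P where "P t = \<Delta> (z + axis i t) ^ m" for t
      have P0: "P 0 = \<Delta> z ^ m" "P 0 \<noteq> 0" using \<Delta>0[OF z] by (simp_all add: P_def ax)
      have "\<Delta> z * \<Delta> z ^ (m - Suc 0) = \<Delta> z ^ m" using m by (simp add: power_Suc[symmetric])
      then have "of_nat m * (\<Delta> z * (2 * S) * \<Delta> (z + axis i 0) ^ (m - Suc 0)) = P 0 * (2 * of_nat m * S)"
        unfolding ax P0 by (simp add: mult_ac)
      then have "(P has_field_derivative P 0 * (2 * of_nat m * S)) (at 0)"
        using DERIV_power[OF d\<Delta>, of m] unfolding P_def[abs_def] by metis
      from DERIV_inverse_fun[OF this P0(2)]
      have "((\<lambda>t. inverse (P t)) has_field_derivative - (2 * of_nat m * S) * inverse (P 0)) (at 0)"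
        by (rule DERIV_cong) (use P0(2) in \<open>simp add: field_simps power2_eq_square\<close>)
      from DERIV_mult[OF DERIV_cmult[OF dF, of "sg p"] this]
      have "((\<lambda>t. sg p * F (z + axis i t) p * inverse (P t)) has_field_derivative
         sg p * (of_nat m * K) * inverse (\<Delta> z ^ m) - 2 * of_nat m * S * H z p) (at 0)"
        by (rule DERIV_cong) (simp add: H_def ax P0(1) algebra_simps)
      then show ?thesis by (simp only: H_def P_def)
    qed
    have sgs: "sg (swap i j \<circ> p) = - sg p" if "j \<in> UNIV - {i}" for j
      using p that permutation_permutes[of p]
      by (subst sg_def, subst sign_compose) (auto simp: sign_swap_id permutation_swap_id sg_def)
    have "of_int (- int m) * (\<Sum>j\<in>UNIV - {i}. 1 / (z $ i - z $ j) * (H z (swap i j \<circ> p) + H z p))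
       = - of_nat m * (\<Sum>j\<in>UNIV - {i}. - (sg p * inverse (\<Delta> z ^ m) * (1 / (z $ i - z $ j) * (F z (swap i j \<circ> p) + F z p)))
            + 2 * H z p * (1 / (z $ i - z $ j)))"
    proof -
      have "1 / (z $ i - z $ j) * (H z (swap i j \<circ> p) + H z p) =
          - (sg p * inverse (\<Delta> z ^ m) * (1 / (z $ i - z $ j) * (F z (swap i j \<circ> p) + F z p)))
            + 2 * H z p * (1 / (z $ i - z $ j))" if "j \<in> UNIV - {i}" for j
        unfolding H_def sgs[OF that] by (simp add: algebra_simps)
      then show ?thesis
        unfolding of_int_minus of_int_of_nat_eq by (intro arg_cong[where f = "(*) _"] sum.cong refl)
    qed
    also have "\<dots> = sg p * (of_nat m * K) * inverse (\<Delta> z ^ m) - 2 * of_nat m * S * H z p"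
      unfolding sum.distrib sum_negf sum_distrib_left[symmetric] K_def[symmetric] S_def[symmetric]
      by (simp add: algebra_simps)
    finally show "((\<lambda>t. H (z + axis i t) p) has_field_derivative
        of_int (- int m) * (\<Sum>j\<in>UNIV - {i}. 1 / (z $ i - z $ j) * (H z (swap i j \<circ> p) + H z p))) (at 0)"
      using dH by simp
  qed
  moreover have "H z0 p = w p" for p
    using \<Delta>0[OF z0] by (simp add: H_def F0 sg2 mult.assoc[symmetric])
  ultimately show ?thesis by blast
qed

lemma scalar_KZ_exists:
  fixes z0 :: "complex ^ 'n :: finite" and m :: int
  assumes z0: "z0 \<in> config_space"
  shows "\<exists>F. scalar_KZ m F \<and> (\<forall>p. p permutes UNIV \<longrightarrow> F z0 p = w p)"
proof -
  consider "m = 0" | n where "n > 0" "m = int n" | n where "n > 0" "m = - int n"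
    by (metis int_cases4 neq0_conv of_nat_0 neg_0_equal_iff_equal)
  then show ?thesis
  proof cases
    case 1
    have "scalar_KZ 0 (\<lambda>z :: complex ^ 'n. w)"
      by (auto simp: scalar_KZ_def cdiff_const)
    then show ?thesis using 1 by blast
  next
    case 2
    then show ?thesis using scalar_KZ_positive[OF _ z0, of n w] by blast
  next
    case 3
    then show ?thesis using scalar_KZ_negative[OF _ z0] by blast
  qed
qed

section \<open>Solutions in a representation and the pairing\<close>

lemma clinear_sum: "clinear l \<Longrightarrow> l (\<Sum>x\<in>S. f x) = (\<Sum>x\<in>S. l (f x))"
  by (simp add: additive_sum[of l] clinear_iff)

lemma clinear_comb:
  fixes l :: "'v :: complex_vector \<Rightarrow> complex"
  assumes "clinear l"
  shows "l (\<Sum>x\<in>S. c x *\<^sub>C f x) = (\<Sum>x\<in>S. c x * l (f x))"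
  using assms by (simp add: clinear_sum[OF assms]) (simp add: clinear_iff scaleC_complex_def)

lemma clinear_scale:
  fixes l :: "'v :: complex_vector \<Rightarrow> complex"
  shows "clinear l \<Longrightarrow> l (c *\<^sub>C x) = c * l x"
  by (simp add: clinear_iff scaleC_complex_def)

lemma eventually_config:
  assumes "(z :: complex ^ 'n :: finite) \<in> config_space"
  shows "eventually (\<lambda>t. z + axis i t \<in> config_space) (at 0)"
proof -
  have "eventually (\<lambda>t. z $ a + (if a = i then t else 0) \<noteq> z $ b + (if b = i then t else 0)) (at 0)" if "a \<noteq> b" for a b
  proof -
    have "((\<lambda>t. (z $ a + (if a = i then t else 0)) - (z $ b + (if b = i then t else 0))) \<longlongrightarrow>
        (z $ a + 0) - (z $ b + 0)) (at 0)"
      by (cases "a = i"; cases "b = i") (auto intro!: tendsto_eq_intros)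
    moreover have "(z $ a + 0) - (z $ b + 0) \<noteq> 0" using assms that by (simp add: config_space_def)
    ultimately have "eventually (\<lambda>t. (z $ a + (if a = i then t else 0)) - (z $ b + (if b = i then t else 0)) \<noteq> 0) (at 0)"
      by (rule tendsto_imp_eventually_ne)
    then show ?thesis by simp
  qed
  then have "eventually (\<lambda>t. \<forall>a b. a \<noteq> b \<longrightarrow> z $ a + (if a = i then t else 0) \<noteq> z $ b + (if b = i then t else 0)) (at 0)"
    by (intro eventually_all_finite) (auto simp: eventually_mono)
  then show ?thesis
    by (rule eventually_mono) (auto simp: config_space_def axis_def)
qed

lemma open_config_space: "open (config_space :: (complex ^ 'n :: finite) set)"
proof -
  have eq: "config_space = (\<Inter>e\<in>{(a :: 'n, b). a \<noteq> b}. {z :: complex ^ 'n. z $ fst e \<noteq> z $ snd e})"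
    by (auto simp: config_space_def)
  show ?thesis
    unfolding eq by (intro open_INT ballI finite open_Collect_neq continuous_intros)
qed

text \<open>
  The map \<open>p \<mapsto> \<rho>(p) v\<close> from the group algebra to \<open>V\<close> is equivariant, so it carries the solution with
  initial value the identity to a solution with initial value \<open>v\<close>.
\<close>

lemma KZ_initial_value:
  fixes \<rho> :: "('n :: finite \<Rightarrow> 'n) \<Rightarrow> 'v :: complex_vector \<Rightarrow> 'v"
  assumes rep: "is_representation \<rho>" and z0: "z0 \<in> config_space"
  obtains \<psi> where "\<psi> \<in> KZ \<rho> m" "\<psi> z0 = v"
proof -
  let ?P = "{p :: 'n \<Rightarrow> 'n. p permutes UNIV}"
  have lin: "clinear (\<rho> p)" if "p permutes UNIV" for p using rep that by (simp add: is_representation_def)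
  have \<rho>id: "\<rho> id v = v" for v using rep by (simp add: is_representation_def)
  have comp: "\<rho> p (\<rho> q v) = \<rho> (p \<circ> q) v" if "p permutes UNIV" "q permutes UNIV" for p q v
    using rep that unfolding is_representation_def by (metis comp_apply)
  obtain F where F: "scalar_KZ m F" and F0: "\<And>p. p permutes UNIV \<Longrightarrow> F z0 p = (if p = id then 1 else 0)"
    using scalar_KZ_exists[OF z0, of m "\<lambda>p. if p = id then 1 else 0"] by blast
  define \<psi> where "\<psi> z = (if z \<in> config_space then \<Sum>p\<in>?P. F z p *\<^sub>C \<rho> p v else 0)" for z
  have l\<psi>: "l (\<psi> z) = (\<Sum>p\<in>?P. F z p * l (\<rho> p v))" if "clinear l" "z \<in> config_space" for l :: "'v \<Rightarrow> complex" and z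
    using clinear_comb[OF that(1)] that(2) by (simp only: \<psi>_def if_True)
  have act: "\<rho> (swap i j) (\<psi> z) = (\<Sum>p\<in>?P. F z (swap i j \<circ> p) *\<^sub>C \<rho> p v)" if "z \<in> config_space" for z i j
  proof -
    have s: "swap i j permutes UNIV" by (rule permutes_swap_id) auto
    have ss: "swap i j \<circ> (swap i j \<circ> p) = p" for p :: "'n \<Rightarrow> 'n" by (simp add: fun_eq_iff)
    have "\<rho> (swap i j) (\<psi> z) = (\<Sum>p\<in>?P. F z p *\<^sub>C \<rho> (swap i j \<circ> p) v)"
      using that lin[OF s] by (simp add: \<psi>_def clinear_sum) (simp add: clinear_iff comp s)
    also have "\<dots> = (\<Sum>p\<in>?P. F z (swap i j \<circ> p) *\<^sub>C \<rho> p v)"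
      by (rule sum.reindex_bij_witness[of _ "\<lambda>p. swap i j \<circ> p" "\<lambda>p. swap i j \<circ> p"])
        (auto simp: ss permutes_compose s)
    finally show ?thesis .
  qed
  have "\<psi> \<in> KZ \<rho> m"
    unfolding KZ_def
  proof (intro CollectI conjI allI impI ballI)
    show "\<psi> z = 0" if "z \<notin> config_space" for z using that by (simp add: \<psi>_def)
    show "vholomorphic_on \<psi> config_space"
      unfolding vholomorphic_on_def
    proof (intro allI impI ballI)
      fix l :: "'v \<Rightarrow> complex" and z :: "complex ^ 'n"
      assume l: "clinear l" and z: "z \<in> config_space"
      have "complex_differentiable_at (\<lambda>z. \<Sum>p\<in>?P. F z p * l (\<rho> p v)) z"
        using F z unfolding scalar_KZ_def by (intro cdiff_sum cdiff_mult cdiff_const) auto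
      then obtain D where D: "((\<lambda>z. \<Sum>p\<in>?P. F z p * l (\<rho> p v)) has_derivative D) (at z)" "Vector_Spaces.linear (*s) (*) D"
        unfolding complex_differentiable_at_def by blast
      have "((\<lambda>w. l (\<psi> w)) has_derivative D) (at z)"
        by (rule has_derivative_transform_within_open[OF D(1) open_config_space z]) (simp add: l\<psi>[OF l])
      then show "\<exists>D. ((\<lambda>w. l (\<psi> w)) has_derivative D) (at z) \<and> Vector_Spaces.linear (*s) (*) D"
        using D(2) by blast
    qed
    fix z i assume z: "z \<in> (config_space :: (complex ^ 'n) set)"
    show "has_partial_derivative \<psi> i (of_int m *\<^sub>C (\<Sum>j\<in>UNIV - {i}.
        (1 / (z $ i - z $ j)) *\<^sub>C (\<rho> (swap i j) (\<psi> z) + \<psi> z))) z"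
      unfolding has_partial_derivative_def
    proof (intro allI impI)
      fix l :: "'v \<Rightarrow> complex" assume l: "clinear l"
      have "((\<lambda>t. \<Sum>p\<in>?P. F (z + axis i t) p * l (\<rho> p v)) has_field_derivative
         (\<Sum>p\<in>?P. of_int m * (\<Sum>j\<in>UNIV - {i}. 1 / (z $ i - z $ j) * (F z (swap i j \<circ> p) + F z p)) * l (\<rho> p v))) (at 0)"
        using F z unfolding scalar_KZ_def by (intro DERIV_sum DERIV_cmult_right) auto
      also have "(\<Sum>p\<in>?P. of_int m * (\<Sum>j\<in>UNIV - {i}. 1 / (z $ i - z $ j) * (F z (swap i j \<circ> p) + F z p)) * l (\<rho> p v))
        = of_int m * (\<Sum>j\<in>UNIV - {i}. 1 / (z $ i - z $ j) * (\<Sum>p\<in>?P. (F z (swap i j \<circ> p) + F z p) * l (\<rho> p v)))"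
        unfolding sum_distrib_left sum_distrib_right by (subst sum.swap) (simp only: mult.assoc)
      also have "\<dots> = l (of_int m *\<^sub>C (\<Sum>j\<in>UNIV - {i}. (1 / (z $ i - z $ j)) *\<^sub>C (\<rho> (swap i j) (\<psi> z) + \<psi> z)))"
      proof -
        have "l (\<rho> (swap i j) (\<psi> z) + \<psi> z) = (\<Sum>p\<in>?P. (F z (swap i j \<circ> p) + F z p) * l (\<rho> p v))" for j
        proof -
          have "l (\<rho> (swap i j) (\<psi> z) + \<psi> z) = l (\<rho> (swap i j) (\<psi> z)) + l (\<psi> z)"
            using l by (simp add: clinear_iff)
          then show ?thesis
            unfolding act[OF z] l\<psi>[OF l z] clinear_comb[OF l] by (simp add: distrib_right sum.distrib)
        qed
        then show ?thesis by (simp only: clinear_scale[OF l] clinear_comb[OF l])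
      qed
      finally show "((\<lambda>t. l (\<psi> (z + axis i t))) has_field_derivative
          l (of_int m *\<^sub>C (\<Sum>j\<in>UNIV - {i}. (1 / (z $ i - z $ j)) *\<^sub>C (\<rho> (swap i j) (\<psi> z) + \<psi> z)))) (at 0)"
      proof (rule DERIV_cong_ev[OF refl _ refl, THEN iffD1, rotated])
        have "eventually (\<lambda>t. z + axis i t \<in> config_space) (nhds 0)"
          unfolding eventually_nhds_conv_at
        proof
          show "eventually (\<lambda>t. z + axis i t \<in> config_space) (at 0)" by (rule eventually_config[OF z])
          have "z + axis i 0 = z" by (simp add: axis_def vec_eq_iff)
          then show "z + axis i 0 \<in> config_space" using z by (simp only:)
        qed
        then show "eventually (\<lambda>t. (\<Sum>p\<in>?P. F (z + axis i t) p * l (\<rho> p v)) = l (\<psi> (z + axis i t))) (nhds 0)"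
          by (rule eventually_mono) (simp add: l\<psi>[OF l])
      qed
    qed
  qed
  moreover have "\<psi> z0 = v"
  proof -
    have "\<psi> z0 = (\<Sum>p\<in>?P. F z0 p *\<^sub>C \<rho> p v)"
      using z0 by (simp only: \<psi>_def if_True)
    also have "\<dots> = (\<Sum>p\<in>?P. if p = id then v else 0)"
      by (rule sum.cong) (simp_all add: F0 \<rho>id[unfolded id_def] id_def scaleC_one)
    also have "\<dots> = v" using permutes_id by (subst sum.delta) (auto simp: finite_permutations)
    finally show ?thesis .
  qed
  ultimately show ?thesis by (rule that)
qed

lemma clinear_Rep_dual: "clinear (Rep_dual l)"
  using Rep_dual[of l] by simp

lemma Rep_dual_rep:
  assumes "is_representation \<rho>" "p permutes UNIV"
  shows "Rep_dual (dual_rep \<rho> p l) = (\<lambda>v. Rep_dual l (\<rho> (inv p) v))"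
proof -
  have "clinear (\<rho> (inv p))" using assms permutes_inv by (auto simp: is_representation_def)
  then have "clinear (\<lambda>v. Rep_dual l (\<rho> (inv p) v))"
    using clinear_Rep_dual[of l] by (simp add: clinear_iff)
  then show ?thesis by (simp add: dual_rep_def pairing_def Abs_dual_inverse)
qed

lemma is_representation_dual_rep:
  fixes \<rho> :: "('n :: finite \<Rightarrow> 'n) \<Rightarrow> 'v :: complex_vector \<Rightarrow> 'v"
  assumes rep: "is_representation \<rho>"
  shows "is_representation (dual_rep \<rho>)"
  unfolding is_representation_def
proof (intro conjI allI impI)
  fix p :: "'n \<Rightarrow> 'n" assume p: "p permutes UNIV"
  show "clinear (dual_rep \<rho> p)"
    unfolding clinear_iff Rep_dual_inject[symmetric]
    by (simp add: Rep_dual_rep[OF rep p] plus_dual.rep_eq scaleC_dual.rep_eq)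
next
  show "dual_rep \<rho> id = id"
    using rep Rep_dual_rep[OF rep permutes_id]
    by (simp add: fun_eq_iff Rep_dual_inject[symmetric] is_representation_def)
next
  fix p q :: "'n \<Rightarrow> 'n" assume p: "p permutes UNIV" and q: "q permutes UNIV"
  have "inv (p \<circ> q) = inv q \<circ> inv p" using p q by (simp add: o_inv_distrib permutes_bij)
  moreover have "\<rho> (inv q \<circ> inv p) = \<rho> (inv q) \<circ> \<rho> (inv p)"
    using rep permutes_inv[OF p] permutes_inv[OF q] by (simp add: is_representation_def)
  ultimately show "dual_rep \<rho> (p \<circ> q) = dual_rep \<rho> p \<circ> dual_rep \<rho> q"
    using p q permutes_compose[OF q p]
    by (intro ext) (simp add: Rep_dual_inject[symmetric] Rep_dual_rep[OF rep])
qed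

text \<open>
  On the complex line through \<open>x\<close> and \<open>y\<close> each hyperplane is met at most once, since \<open>x\<close> is not on it.
  The complement of finitely many points in the plane is connected.
\<close>

lemma config_space_constant:
  fixes f :: "complex ^ 'n :: finite \<Rightarrow> complex"
  assumes hol: "\<And>z. z \<in> config_space \<Longrightarrow> complex_differentiable_at f z"
    and part: "\<And>z i. z \<in> config_space \<Longrightarrow> ((\<lambda>t. f (z + axis i t)) has_field_derivative 0) (at 0)"
    and x: "x \<in> config_space" and y: "y \<in> config_space"
  shows "f x = f y"
proof -
  define \<gamma> where "\<gamma> t = x + t *s (y - x)" for t
  define T where "T = {t. \<gamma> t \<in> config_space}"
  have D0: "(f has_derivative (\<lambda>h. 0)) (at z)" if z: "z \<in> config_space" for z
  proof -
    obtain D where D: "(f has_derivative D) (at z)" and lin: "Vector_Spaces.linear (*s) (*) D"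
      using hol[OF z] unfolding complex_differentiable_at_def by blast
    have D_axis: "D (axis i 1) = 0" for i
    proof -
      have a: "((\<lambda>t. z + axis i t) has_derivative (\<lambda>t. axis i t)) (at 0)"
      proof -
        have "bounded_linear (\<lambda>t :: complex. axis i t :: complex ^ 'n)"
          by (intro linear_conv_bounded_linear[THEN iffD1] linearI) (auto simp: axis_def vec_eq_iff)
        then show ?thesis
          by (auto intro!: derivative_eq_intros bounded_linear_imp_has_derivative)
      qed
      have "z + axis i 0 = z" by (simp add: axis_def vec_eq_iff)
      then have "(f has_derivative D) (at (z + axis i 0))" using D by (simp only:)
      with a have "((\<lambda>t. f (z + axis i t)) has_derivative (\<lambda>t. D (axis i t))) (at 0)"
        by (rule has_derivative_compose)
      moreover have "((\<lambda>t. f (z + axis i t)) has_derivative (\<lambda>t. 0)) (at 0)"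
        using part[OF z, of i] by (simp add: has_field_derivative_def lambda_zero)
      ultimately have "(\<lambda>t. D (axis i t)) = (\<lambda>t. 0)" by (rule has_derivative_unique)
      then show ?thesis by metis
    qed
    have D_expand: "D h = (\<Sum>i\<in>UNIV. h $ i * D (axis i 1))" for h
    proof -
      have "D (\<Sum>i\<in>UNIV. h $ i *s axis i 1) = (\<Sum>i\<in>UNIV. D (h $ i *s axis i 1))"
        using lin by (intro additive_sum) (simp add: clinear_vec_iff)
      then show ?thesis using lin by (simp add: clinear_vec_iff basis_expansion)
    qed
    have "D = (\<lambda>h. 0)" by (rule ext, subst D_expand) (simp add: D_axis)
    then show ?thesis using D by simp
  qed
  have "finite (- T)"
  proof (rule finite_subset)
    show "- T \<subseteq> (\<Union>e\<in>{(a, b). a \<noteq> b}. {- (x $ fst e - x $ snd e) / ((y - x) $ fst e - (y - x) $ snd e)})"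
    proof
      fix t assume "t \<in> - T"
      then obtain a b where ab: "a \<noteq> b" "\<gamma> t $ a = \<gamma> t $ b" by (auto simp: T_def config_space_def)
      then have teq: "t * ((y - x) $ a - (y - x) $ b) = - (x $ a - x $ b)"
        by (simp add: \<gamma>_def algebra_simps)
      moreover have "x $ a - x $ b \<noteq> 0" using x ab(1) by (simp add: config_space_def)
      ultimately have nz: "(y - x) $ a - (y - x) $ b \<noteq> 0" by (metis mult_zero_right neg_equal_0_iff_equal)
      then have "t = - (x $ a - x $ b) / ((y - x) $ a - (y - x) $ b)"
        using teq by (rule nonzero_eq_divide_eq[THEN iffD2])
      then show "t \<in> (\<Union>e\<in>{(a, b). a \<noteq> b}. {- (x $ fst e - x $ snd e) / ((y - x) $ fst e - (y - x) $ snd e)})"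
        using ab(1) by force
    qed
  qed (auto intro: finite_subset[OF subset_UNIV])
  then have conn: "connected T" and op: "open T"
    using connected_open_delete_finite[of UNIV "- T"] finite_imp_closed[of "- T"]
    by (auto simp: connected_UNIV Diff_Diff_Int Compl_eq_Diff_UNIV[symmetric] open_closed)
  have "((\<lambda>t. f (\<gamma> t)) has_derivative (\<lambda>h. 0)) (at t)" if "t \<in> T" for t
  proof -
    have "bounded_linear (\<lambda>t. t *s (y - x))"
      by (rule bounded_linearI') (auto simp: vector_sadd_rdistrib vec_eq_iff scaleR_diff_right algebra_simps)
    then have "(\<gamma> has_derivative (\<lambda>t. t *s (y - x))) (at t)"
      using has_derivative_add[OF has_derivative_const[of x] bounded_linear_imp_has_derivative]
      unfolding \<gamma>_def[abs_def] by fastforce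
    from has_derivative_compose[OF this D0] show ?thesis using that by (simp add: T_def)
  qed
  moreover have \<gamma>01: "\<gamma> 0 = x" "\<gamma> 1 = y" by (simp_all add: \<gamma>_def)
  moreover have "0 \<in> T" "1 \<in> T" using x y by (simp_all only: T_def mem_Collect_eq \<gamma>01)
  ultimately have "f (\<gamma> 0) = f (\<gamma> 1)"
    by (intro has_derivative_zero_unique_connected[OF op conn, of "\<lambda>t. f (\<gamma> t)"])
  then show ?thesis by (simp only: \<gamma>01)
qed

text \<open>
  In a basis of \<open>V\<close> the pairing is a finite sum of products of coordinates, to which the product rule
  applies.
\<close>

lemma KZ_pairing_constant:
  fixes \<rho> :: "('n :: finite \<Rightarrow> 'n) \<Rightarrow> 'v :: complex_vector \<Rightarrow> 'v"
  assumes fin: "finite_dimensional TYPE('v)" and rep: "is_representation \<rho>"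
    and \<psi>: "\<psi> \<in> KZ \<rho> m" and \<phi>: "\<phi> \<in> KZ (dual_rep \<rho>) (- m)"
    and x: "x \<in> config_space" and y: "y \<in> config_space"
  shows "pairing (\<psi> x) (\<phi> x) = pairing (\<psi> y) (\<phi> y)"
proof -
  obtain B0 :: "'v set" where B0: "finite B0" "complex_vector.span B0 = UNIV"
    using fin unfolding finite_dimensional_def by blast
  obtain B where B: "B \<subseteq> (UNIV :: 'v set)" "complex_vector.independent B" "UNIV \<subseteq> complex_vector.span B"
    by (rule complex_vector.maximal_independent_subset)
  have finB: "finite B" using complex_vector.independent_span_bound[OF B0(1) B(2)] B0(2) by simp
  define c where "c b v = complex_vector.representation B v b" for b v
  have c_lin: "clinear (c b)" for b
    unfolding clinear_iff c_def scaleC_complex_def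
    using complex_vector.representation_add[OF B(2)] complex_vector.representation_scale[OF B(2)] B(3)
    by (metis subset_UNIV top.extremum_uniqueI UNIV_I)
  have expand: "v = (\<Sum>b\<in>B. c b v *\<^sub>C b)" for v
    unfolding c_def using B finB
    by (intro complex_vector.sum_representation_eq[symmetric]) auto
  define ev :: "'v \<Rightarrow> 'v dual \<Rightarrow> complex" where "ev b l = Rep_dual l b" for b l
  have ev_lin: "clinear (ev b)" for b
    by (simp add: clinear_iff ev_def plus_dual.rep_eq scaleC_dual.rep_eq)
  have pair: "pairing v l = (\<Sum>b\<in>B. c b v * ev b l)" for v l
    unfolding pairing_def ev_def
    by (subst expand[of v]) (rule clinear_comb[OF clinear_Rep_dual])
  have \<psi>d: "complex_differentiable_at (\<lambda>z. l (\<psi> z)) z" if "clinear l" "z \<in> config_space" for l :: "'v \<Rightarrow> complex" and z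
    using \<psi> that unfolding KZ_def vholomorphic_on_def complex_differentiable_at_def by blast
  have \<phi>d: "complex_differentiable_at (\<lambda>z. l (\<phi> z)) z" if "clinear l" "z \<in> config_space" for l :: "'v dual \<Rightarrow> complex" and z
    using \<phi> that unfolding KZ_def vholomorphic_on_def complex_differentiable_at_def by blast
  show ?thesis
  proof (rule config_space_constant[OF _ _ x y])
    fix z :: "complex ^ 'n" assume z: "z \<in> config_space"
    show "complex_differentiable_at (\<lambda>z. pairing (\<psi> z) (\<phi> z)) z"
      unfolding pair by (intro cdiff_sum cdiff_mult \<psi>d \<phi>d c_lin ev_lin z)
    fix i
    let ?k = "\<lambda>j. 1 / (z $ i - z $ j)"
    define P where "P = of_int m *\<^sub>C (\<Sum>j\<in>UNIV - {i}. ?k j *\<^sub>C (\<rho> (swap i j) (\<psi> z) + \<psi> z))"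
    define Q where "Q = of_int (- m) *\<^sub>C (\<Sum>j\<in>UNIV - {i}. ?k j *\<^sub>C (dual_rep \<rho> (swap i j) (\<phi> z) + \<phi> z))"
    have dP: "((\<lambda>t. l (\<psi> (z + axis i t))) has_field_derivative l P) (at 0)" if "clinear l" for l :: "'v \<Rightarrow> complex"
      using \<psi> z that unfolding KZ_def has_partial_derivative_def P_def by blast
    have dQ: "((\<lambda>t. l (\<phi> (z + axis i t))) has_field_derivative l Q) (at 0)" if "clinear l" for l :: "'v dual \<Rightarrow> complex"
      using \<phi> z that unfolding KZ_def has_partial_derivative_def Q_def by blast
    have ax: "z + axis i 0 = z" by (simp add: axis_def vec_eq_iff)
    have "((\<lambda>t. pairing (\<psi> (z + axis i t)) (\<phi> (z + axis i t))) has_field_derivative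
        (\<Sum>b\<in>B. c b P * ev b (\<phi> (z + axis i 0)) + ev b Q * c b (\<psi> (z + axis i 0)))) (at 0)"
      unfolding pair by (intro DERIV_sum DERIV_mult dP dQ c_lin ev_lin)
    also have "(\<Sum>b\<in>B. c b P * ev b (\<phi> (z + axis i 0)) + ev b Q * c b (\<psi> (z + axis i 0))) =
        pairing P (\<phi> z) + pairing (\<psi> z) Q"
      unfolding ax pair by (simp add: sum.distrib mult.commute)
    also have "\<dots> = 0"
    proof -
      have sw: "pairing (\<psi> z) (dual_rep \<rho> (swap i j) (\<phi> z)) = pairing (\<rho> (swap i j) (\<psi> z)) (\<phi> z)" for j
        unfolding pairing_def
        by (subst Rep_dual_rep[OF rep]) (auto intro: permutes_swap_id)
      have ev': "clinear (\<lambda>l. pairing v l)" for v :: 'v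
        using ev_lin[of v] unfolding ev_def[abs_def] pairing_def .
      have pv': "clinear (\<lambda>v. pairing v l)" for l :: "'v dual"
        using clinear_Rep_dual by (simp add: pairing_def)
      have "pairing P (\<phi> z) = of_int m * (\<Sum>j\<in>UNIV - {i}. ?k j * (pairing (\<rho> (swap i j) (\<psi> z)) (\<phi> z) + pairing (\<psi> z) (\<phi> z)))"
        unfolding P_def clinear_scale[OF pv'] clinear_comb[OF pv'] using pv' by (simp add: clinear_iff)
      moreover have "pairing (\<psi> z) Q = of_int (- m) * (\<Sum>j\<in>UNIV - {i}. ?k j * (pairing (\<rho> (swap i j) (\<psi> z)) (\<phi> z) + pairing (\<psi> z) (\<phi> z)))"
        unfolding Q_def clinear_scale[OF ev'] clinear_comb[OF ev'] sw[symmetric] using ev' by (simp add: clinear_iff)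
      ultimately show ?thesis by simp
    qed
    finally show "((\<lambda>t. pairing (\<psi> (z + axis i t)) (\<phi> (z + axis i t))) has_field_derivative 0) (at 0)" .
  qed
qed

lemma config_space_nonempty: "\<exists>z :: complex ^ 'n :: finite. z \<in> config_space"
proof -
  obtain f :: "'n \<Rightarrow> nat" where "inj f" using finite_imp_inj_to_nat_seg[of "UNIV :: 'n set"] by auto
  then have "(\<chi> i. of_nat (f i)) \<in> (config_space :: (complex ^ 'n) set)"
    by (auto simp: config_space_def inj_def)
  then show ?thesis by blast
qed

lemma subspace_KZ:
  fixes \<rho> :: "('n :: finite \<Rightarrow> 'n) \<Rightarrow> 'v :: complex_vector \<Rightarrow> 'v"
  assumes rep: "is_representation \<rho>"
  shows "complex_vector.subspace (KZ \<rho> m)"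
proof -
  have lin: "clinear (\<rho> (swap i j))" for i j
    using rep permutes_swap_id[of i UNIV j] by (simp add: is_representation_def)
  define R where "R i z v = of_int m *\<^sub>C (\<Sum>j\<in>UNIV - {i}. (1 / (z $ i - z $ j)) *\<^sub>C (\<rho> (swap i j) v + v))"
    for i and z :: "complex ^ 'n" and v
  have R_add: "R i z (v + w) = R i z v + R i z w" for i z v w
  proof -
    have "\<rho> (swap i j) (v + w) + (v + w) = (\<rho> (swap i j) v + v) + (\<rho> (swap i j) w + w)" for j
      using lin by (simp add: clinear_iff)
    then show ?thesis unfolding R_def by (simp only: scaleC_add_right sum.distrib)
  qed
  have R_scale: "R i z (c *\<^sub>C v) = c *\<^sub>C R i z v" for i z v c
  proof -
    have "\<rho> (swap i j) (c *\<^sub>C v) + c *\<^sub>C v = c *\<^sub>C (\<rho> (swap i j) v + v)" for j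
      using lin by (simp add: clinear_iff scaleC_add_right)
    then show ?thesis
      unfolding R_def complex_vector.scale_sum_right by (simp add: scaleC_scaleC mult_ac)
  qed
  have KZ_iff: "\<psi> \<in> KZ \<rho> m \<longleftrightarrow> (\<forall>z. z \<notin> config_space \<longrightarrow> \<psi> z = 0) \<and>
     (\<forall>l :: 'v \<Rightarrow> complex. clinear l \<longrightarrow> (\<forall>z\<in>config_space. complex_differentiable_at (\<lambda>w. l (\<psi> w)) z)) \<and>
     (\<forall>z\<in>config_space. \<forall>i. \<forall>l :: 'v \<Rightarrow> complex. clinear l \<longrightarrow>
        ((\<lambda>t. l (\<psi> (z + axis i t))) has_field_derivative l (R i z (\<psi> z))) (at 0))" for \<psi>
    unfolding KZ_def vholomorphic_on_def has_partial_derivative_def R_def complex_differentiable_at_def by blast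
  have l_add: "l (v + w) = l v + l w" if "clinear l" for l :: "'v \<Rightarrow> complex" and v w
    using that by (simp add: clinear_iff)
  show ?thesis
    unfolding complex_vector.subspace_def
  proof (intro conjI ballI allI)
    have R0: "R i z 0 = 0" for i z using R_scale[of i z 0 0] by simp
    have l0: "l 0 = 0" if "clinear l" for l :: "'v \<Rightarrow> complex" using l_add[OF that, of 0 0] by simp
    show "0 \<in> KZ \<rho> m"
      unfolding KZ_iff by (simp add: R0 l0 cdiff_const)
    fix \<psi> \<phi> assume \<psi>: "\<psi> \<in> KZ \<rho> m"
    show "c *\<^sub>C \<psi> \<in> KZ \<rho> m" for c
      using \<psi> unfolding KZ_iff scaleC_fun_def R_scale
      by (auto simp: clinear_scale intro!: cdiff_mult cdiff_const DERIV_cmult)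
    assume \<phi>: "\<phi> \<in> KZ \<rho> m"
    show "\<psi> + \<phi> \<in> KZ \<rho> m"
      using \<psi> \<phi> unfolding KZ_iff plus_fun_def R_add
      by (auto simp: l_add intro!: cdiff_add DERIV_add)
  qed
qed

text \<open>
  A nonzero solution is nonzero at some point of the configuration space. There a suitable functional,
  respectively vector, separates it from \<open>0\<close>, and it is the value of a solution of the other equation.
\<close>

theorem lemma4p2:
  fixes \<rho> :: "('n :: finite \<Rightarrow> 'n) \<Rightarrow> 'v :: complex_vector \<Rightarrow> 'v"
    and m :: int
  assumes "finite_dimensional TYPE('v)"
    and "is_representation \<rho>"
  shows "(\<forall>\<psi>\<in>KZ \<rho> m. \<forall>\<phi>\<in>KZ (dual_rep \<rho>) (- m).
            (\<lambda>z. pairing (\<psi> z) (\<phi> z)) constant_on config_space) \<and>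
         nondegenerate_pairing (KZ \<rho> m) (KZ (dual_rep \<rho>) (- m)) KZ_pairing"
proof
  let ?A = "KZ \<rho> m" and ?B = "KZ (dual_rep \<rho>) (- m)"
  have rep': "is_representation (dual_rep \<rho>)" by (rule is_representation_dual_rep[OF assms(2)])
  obtain z0 :: "complex ^ 'n" where z0: "z0 \<in> config_space" using config_space_nonempty by blast
  show "\<forall>\<psi>\<in>?A. \<forall>\<phi>\<in>?B. (\<lambda>z. pairing (\<psi> z) (\<phi> z)) constant_on config_space"
    unfolding constant_on_def
  proof (intro ballI exI)
    fix \<psi> \<phi> and z :: "complex ^ 'n" assume "\<psi> \<in> ?A" "\<phi> \<in> ?B" "z \<in> config_space"
    then show "pairing (\<psi> z) (\<phi> z) = pairing (\<psi> z0) (\<phi> z0)"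
      using z0 by (rule KZ_pairing_constant[OF assms])
  qed
  have pairing_eq: "KZ_pairing \<psi> \<phi> = pairing (\<psi> z) (\<phi> z)"
    if "\<psi> \<in> ?A" "\<phi> \<in> ?B" "z \<in> config_space" for \<psi> \<phi> z
    unfolding KZ_pairing_def
  proof (rule the_equality)
    show "\<forall>z'\<in>config_space. pairing (\<psi> z') (\<phi> z') = pairing (\<psi> z) (\<phi> z)"
      using KZ_pairing_constant[OF assms that(1,2) _ that(3)] by blast
    then show "c = pairing (\<psi> z) (\<phi> z)" if "\<forall>z\<in>config_space. pairing (\<psi> z) (\<phi> z) = c" for c
      using that \<open>z \<in> config_space\<close> by simp
  qed
  have subA: "complex_vector.subspace ?A" by (rule subspace_KZ[OF assms(2)])
  have subB: "complex_vector.subspace ?B" by (rule subspace_KZ[OF rep'])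
  note memA = complex_vector.subspace_add[OF subA] complex_vector.subspace_scale[OF subA]
  note memB = complex_vector.subspace_add[OF subB] complex_vector.subspace_scale[OF subB]
  have nzA: "x = 0" if x: "x \<in> ?A" and 0: "\<forall>y\<in>?B. KZ_pairing x y = 0" for x
  proof
    fix z
    show "x z = 0 z"
    proof (cases "z \<in> config_space")
      case True
      have "Rep_dual l (x z) = 0" for l
      proof -
        obtain y where y: "y \<in> ?B" "y z = l" using KZ_initial_value[OF rep' True] by blast
        show ?thesis using 0 y pairing_eq[OF x y(1) True] by (simp add: pairing_def)
      qed
      then have l0: "l (x z) = 0" if "clinear l" for l :: "'v \<Rightarrow> complex"
        using that by (metis Abs_dual_inverse mem_Collect_eq)
      show ?thesis
      proof (rule ccontr)
        assume "x z \<noteq> 0 z"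
        then have "complex_vector.independent {x z}" by simp
        then obtain g :: "'v \<Rightarrow> complex" where "clinear g" "g (x z) = 1"
          using vector_space_pair.linear_independent_extend[of scaleC scaleC "{x z}" "\<lambda>_. 1 :: complex"]
          by (auto simp: vector_space_pair_def complex_vector.vector_space_axioms)
        then show False using l0[of g] by simp
      qed
    next
      case False
      then show ?thesis using x by (simp add: KZ_def)
    qed
  qed
  have nzB: "y = 0" if y: "y \<in> ?B" and 0: "\<forall>x\<in>?A. KZ_pairing x y = 0" for y
  proof
    fix z
    show "y z = 0 z"
    proof (cases "z \<in> config_space")
      case True
      have "Rep_dual (y z) v = 0" for v
      proof -
        obtain x where x: "x \<in> ?A" "x z = v" using KZ_initial_value[OF assms(2) True] by blast
        show ?thesis using 0 x pairing_eq[OF x(1) y True] by (simp add: pairing_def)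
      qed
      then show ?thesis by (simp add: Rep_dual_inject[symmetric] zero_dual.rep_eq fun_eq_iff)
    next
      case False
      then show ?thesis using y by (simp add: KZ_def)
    qed
  qed
  have add: "Rep_dual l (v + w) = Rep_dual l v + Rep_dual l w"
    and scale: "Rep_dual l (c *\<^sub>C v) = c * Rep_dual l v" for l :: "'v dual" and v w c
    using clinear_Rep_dual[of l] by (simp_all add: clinear_iff scaleC_complex_def)
  show "nondegenerate_pairing ?A ?B KZ_pairing"
    unfolding nondegenerate_pairing_def
  proof (intro conjI ballI allI impI subA subB)
    show "KZ_pairing (x + x') y = KZ_pairing x y + KZ_pairing x' y" if "x \<in> ?A" "x' \<in> ?A" "y \<in> ?B" for x x' y
      using that by (simp add: pairing_eq[OF _ _ z0] memA pairing_def add)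
    show "KZ_pairing x (y + y') = KZ_pairing x y + KZ_pairing x y'" if "x \<in> ?A" "y \<in> ?B" "y' \<in> ?B" for x y y'
      using that by (simp add: pairing_eq[OF _ _ z0] memB pairing_def plus_dual.rep_eq)
    show "KZ_pairing (c *\<^sub>C x) y = c * KZ_pairing x y" if "x \<in> ?A" "y \<in> ?B" for c x y
      using that pairing_eq[OF memA(2)[OF that(1), of c] that(2) z0] pairing_eq[OF that z0]
      by (simp add: pairing_def scaleC_fun_def scale)
    show "KZ_pairing x (c *\<^sub>C y) = c * KZ_pairing x y" if "x \<in> ?A" "y \<in> ?B" for c x y
      using that pairing_eq[OF that(1) memB(2)[OF that(2), of c] z0] pairing_eq[OF that z0]
      by (simp add: pairing_def scaleC_fun_def scaleC_dual.rep_eq scaleC_complex_def)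
    show "x = 0" if "x \<in> ?A" "\<forall>y\<in>?B. KZ_pairing x y = 0" for x using nzA that by blast
    show "y = 0" if "y \<in> ?B" "\<forall>x\<in>?A. KZ_pairing x y = 0" for y using nzB that by blast
  qed
qed

end
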